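(* (1) If $\alpha$ is a Liouville number, then there exist a NICIS $C^\infty$-diffeomorphism $f\in G^\infty$ and a lift $\tilde f$ of $f$ such that $\rho(\tilde f)=\alpha$. (2) For any irrational number $\alpha$, there exist a NICIS homeomorphism $f\in G^0$ and a lift $\tilde f$ of $f$ such that $\rho(\tilde f)=\alpha$.
   Context: Let $S^1=\mathbb{R}/\mathbb{Z}$ and let $\mathbb{A}=S^1\times[-1,1]$ be the closed annulus equipped with the standard area. For $r=0,1,\dots,\infty$, $G^r$ denotes the group of area preserving $C^r$ diffeomorphisms of $\mathbb{A}$ (homeomorphisms when $r=0$) which are isotopic to the identity. A map $f\in G^r$ is called a NICIS map if it admits no nonempty compact invariant set contained in the interior $S^1\times(-1,1)$ of $\mathbb{A}$. Let $\tilde{\mathbb{A}}=\mathbb{R}\times[-1,1]$ be the universal cover of $\mathbb{A}$ and let $p:\tilde{\mathbb{A}}\to\mathbb{R}$ be the projection onto the first factor. For a lift $\tilde f:\tilde{\mathbb{A}}\to\tilde{\mathbb{A}}$ of $f$, the function $p\circ\tilde f-p$ is invariant under the covering transformations and hence defines a function on $\mathbb{A}$, denoted by the same symbol. For a NICIS map $f\in G^0$ with lift $\tilde f$, there is a single irrational number, called the rotation number of $\tilde f$ and denoted $\rho(\tilde f)$, such that $\int_{\mathbb{A}}(p\circ\tilde f-p)\,d\mu=\rho(\tilde f)$ for every $f$-invariant Borel probability measure $\mu$ on $\mathbb{A}$. Thus $\rho(\tilde f)=\alpha$ means that $\int_{\mathbb{A}}(p\circ\tilde f-p)\,d\mu=\alpha$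 for every $f$-invariant Borel probability measure $\mu$ on $\mathbb{A}$. An irrational number $\alpha$ is called a Liouville number if for any $\tau>0$ and $\varepsilon>0$ there is a rational number $p/q$ with $(p,q)=1$ (and $q\ge 1$) such that $|\alpha-p/q|<\varepsilon/q^\tau$. *)

theory Defs
  imports "HOL-Probability.Probability"
begin

section \<open>The closed annulus and its universal cover\<close>

text \<open>
  The circle \<open>\<real>/\<int>\<close> is modelled as the unit circle of \<open>\<complex>\<close>, the class of \<open>x\<close> being
  \<open>exp (2 \<pi> i x)\<close>. Self-maps of the annulus are total functions on \<open>\<complex> \<times> \<real>\<close>; only their
  values on the annulus matter.
\<close>

definition annulus :: "(complex \<times> real) set" where
  "annulus = sphere 0 1 \<times> {-1..1}"

definition annulus_interior :: "(complex \<times> real) set" where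
  "annulus_interior = sphere 0 1 \<times> {-1<..<1}"

definition strip :: "(real \<times> real) set" where
  "strip = UNIV \<times> {-1..1}"

definition cover :: "real \<times> real \<Rightarrow> complex \<times> real" where
  "cover z = (cis (2 * pi * fst z), snd z)"

definition annulus_borel :: "(complex \<times> real) measure" where
  "annulus_borel = restrict_space borel annulus"

text \<open>The standard area, of total mass 2: the image of Lebesgue measure on a fundamental domain.\<close>

definition area :: "(complex \<times> real) measure" where
  "area = distr (restrict_space lborel ({0..<1} \<times> {-1..1})) annulus_borel cover"

definition measure_preserving :: "'a measure \<Rightarrow> ('a \<Rightarrow> 'a) \<Rightarrow> bool" where
  "measure_preserving M f \<longleftrightarrow> f \<in> measurable M M \<and> distr M M f = M"

section \<open>Maps of class \<open>C\<^sup>r\<close>\<close>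

text \<open>
  Derivatives are taken within \<open>S\<close>, hence one-sided at boundary points. The definition is meant
  for convex sets \<open>S\<close> with nonempty interior, on which such derivatives are unique.
\<close>

primrec C_nat_on ::
  "nat \<Rightarrow> ('a::euclidean_space \<Rightarrow> 'b::real_normed_vector) \<Rightarrow> 'a set \<Rightarrow> bool" where
  "C_nat_on 0 f S \<longleftrightarrow> continuous_on S f"
| "C_nat_on (Suc n) f S \<longleftrightarrow>
     (\<exists>f'. (\<forall>x\<in>S. (f has_derivative f' x) (at x within S)) \<and>
           (\<forall>v. C_nat_on n (\<lambda>x. f' x v) S))"

definition C_on ::
  "enat \<Rightarrow> ('a::euclidean_space \<Rightarrow> 'b::real_normed_vector) \<Rightarrow> 'a set \<Rightarrow> bool" where
  "C_on r f S \<longleftrightarrow> (\<forall>n. enat n \<le> r \<longrightarrow> C_nat_on n f S)"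

text \<open>
  The cover is a local diffeomorphism and the annulus is an embedded submanifold of
  \<open>\<complex> \<times> \<real>\<close>, so a self-map \<open>f\<close> of the annulus is \<open>C\<^sup>r\<close> iff \<open>f \<circ> cover\<close> is \<open>C\<^sup>r\<close> on the strip
  as a map to \<open>\<complex> \<times> \<real>\<close>.
\<close>

definition annulus_diffeo :: "enat \<Rightarrow> (complex \<times> real \<Rightarrow> complex \<times> real) \<Rightarrow> bool" where
  "annulus_diffeo r f \<longleftrightarrow>
     (\<exists>g. homeomorphism annulus annulus f g \<and>
          C_on r (f \<circ> cover) strip \<and> C_on r (g \<circ> cover) strip)"

text \<open>
  An isotopy of class \<open>C\<^sup>r\<close> is jointly \<open>C\<^sup>r\<close> in time and space; its intermediate maps are
  \<open>C\<^sup>r\<close> diffeomorphisms, not required to preserve area.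
\<close>

definition isotopic_to_id :: "enat \<Rightarrow> (complex \<times> real \<Rightarrow> complex \<times> real) \<Rightarrow> bool" where
  "isotopic_to_id r f \<longleftrightarrow>
     (\<exists>H :: real \<Rightarrow> complex \<times> real \<Rightarrow> complex \<times> real.
        C_on r (\<lambda>(t, z). H t (cover z)) ({0..1} \<times> strip) \<and>
        (\<forall>t\<in>{0..1}. annulus_diffeo r (H t)) \<and>
        (\<forall>a\<in>annulus. H 0 a = a) \<and> (\<forall>a\<in>annulus. H 1 a = f a))"

definition area_diffeos :: "enat \<Rightarrow> (complex \<times> real \<Rightarrow> complex \<times> real) set"  ("G\<^sup>_" [1000] 1000)
  where
  "G\<^sup>r = {f. annulus_diffeo r f \<and> measure_preserving area f \<and> isotopic_to_id r f}"

section \<open>NICIS maps, lifts and rotation numbers\<close>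

definition NICIS :: "(complex \<times> real \<Rightarrow> complex \<times> real) \<Rightarrow> bool" where
  "NICIS f \<longleftrightarrow> \<not> (\<exists>K. K \<noteq> {} \<and> compact K \<and> K \<subseteq> annulus_interior \<and> f ` K = K)"

definition is_lift ::
  "(complex \<times> real \<Rightarrow> complex \<times> real) \<Rightarrow> (real \<times> real \<Rightarrow> real \<times> real) \<Rightarrow> bool" where
  "is_lift f F \<longleftrightarrow>
     continuous_on strip F \<and> F ` strip \<subseteq> strip \<and> (\<forall>z\<in>strip. cover (F z) = f (cover z))"

text \<open>
  The function on the annulus induced by \<open>p \<circ> F - p\<close>. It is well defined there when \<open>F\<close> is a lift of
  a map isotopic to the identity, since \<open>F\<close> then commutes with the covering transformations.
\<close>

definition displacement :: "(real \<times> real \<Rightarrow> real \<times> real) \<Rightarrow> complex \<times> real \<Rightarrow> real" where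
  "displacement F a = (THE d. \<forall>z\<in>strip. cover z = a \<longrightarrow> fst (F z) - fst z = d)"

definition invariant_prob ::
  "(complex \<times> real \<Rightarrow> complex \<times> real) \<Rightarrow> (complex \<times> real) measure \<Rightarrow> bool" where
  "invariant_prob f \<mu> \<longleftrightarrow>
     prob_space \<mu> \<and> sets \<mu> = sets annulus_borel \<and> measure_preserving \<mu> f"

definition has_rotation_number ::
  "(complex \<times> real \<Rightarrow> complex \<times> real) \<Rightarrow> (real \<times> real \<Rightarrow> real \<times> real) \<Rightarrow> real \<Rightarrow> bool" where
  "has_rotation_number f F \<alpha> \<longleftrightarrow>
     (\<forall>\<mu>. invariant_prob f \<mu> \<longrightarrow> (\<integral>a. displacement F a \<partial>\<mu>) = \<alpha>)"

definition liouville :: "real \<Rightarrow> bool" where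
  "liouville \<alpha> \<longleftrightarrow> \<alpha> \<notin> \<rat> \<and>
     (\<forall>\<tau>>0. \<forall>\<epsilon>>0. \<exists>p q :: int. q \<ge> 1 \<and> coprime p q \<and>
        \<bar>\<alpha> - real_of_int p / real_of_int q\<bar> < \<epsilon> / real_of_int q powr \<tau>)"

end

theory Submission imports Defs begin

text \<open>
  The maps are produced by the method of approximation by conjugation of Anosov and Katok. Let \<open>R s\<close> be
  the rotation of the annulus by \<open>s\<close>, let \<open>h\<close> be an area preserving diffeomorphism and \<open>p / q\<close> a rational
  number close to \<open>\<alpha>\<close>, say \<open>\<alpha> = p / q + d\<close>. If an area preserving diffeomorphism \<open>k\<close> commutes with
  \<open>R (p / q)\<close>, then replacing \<open>h\<close> by \<open>h \<circ> k\<close> does not change the conjugate of \<open>R (p / q)\<close>, and it changes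
  the conjugate of \<open>R \<alpha>\<close> only by the conjugate under \<open>h\<close> of the commutator of \<open>k\<close> with the small rotation
  \<open>R d\<close>. Iterating this with rapidly improving \<open>p / q\<close> gives a convergent sequence of conjugates of \<open>R \<alpha>\<close>,
  although the conjugating maps need not converge.

  The map \<open>k\<close> twists ellipses around the points \<open>(j / q, 0)\<close> that reach from one boundary circle to the
  other, by an angle that runs through a full turn near the rim of the ellipse. Hence the image of every
  horizontal circle comes close to the boundary (\<open>twist_reaches_boundary\<close>). As \<open>\<alpha>\<close> is irrational,
  the orbits of \<open>R \<alpha>\<close> are dense in the horizontal circles, so every orbit of the conjugate of \<open>R \<alpha>\<close> by \<open>h \<circ> k\<close>
  comes close to the boundary within a bounded time. Also, \<open>J\<close> steps of such a conjugate displace every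
  point by \<open>J * \<alpha>\<close> up to an error independent of \<open>J\<close>. Both properties, for a fixed distance to the boundary
  and a fixed \<open>J\<close>, survive small perturbations in the \<open>C\<^sup>0\<close> sense (\<open>escaping_stable\<close>). If each correction
  is small compared with the perturbations allowed by all earlier stages, the limit has all these
  properties: its orbits come arbitrarily close to the boundary, so that no compact set in the interior is
  invariant, and the mean displacement of every invariant measure is \<open>\<alpha>\<close>.

  The twist for \<open>q\<close> is a fixed map rescaled by \<open>q\<close> in the horizontal direction. Rescaled back, the
  commutator with \<open>R d\<close> is a member \<open>e (q * d)\<close> of a fixed smooth family \<open>e\<close> with \<open>e 0\<close> the identity, and
  each derivative costs at most a factor \<open>q\<close>. So the correction tends to zero in the \<open>C\<^sup>m\<close> sense as soon as
  \<open>q ^ (m + 1) * d\<close> does (\<open>commutators_conv\<close>). For a Liouville number suitable \<open>p / q\<close> exist for all \<open>m\<close>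
  simultaneously, and for an arbitrary irrational number Dirichlet's theorem provides them for \<open>m = 0\<close>. The
  two parts of the theorem are the cases \<open>r = \<infinity>\<close> and \<open>r = 0\<close> of
  \<open>approximable_rotation_number_realized\<close>.

  The isotopy to the identity is built together with the map: the stages are families of maps with a time
  \<open>t\<close> in \<open>{0..1}\<close>, corrected at time \<open>t\<close> by the commutator with \<open>R (t * d)\<close>. All limits are therefore taken for
  maps on the product of \<open>{0..1}\<close> with the strip, and the limit family is the isotopy.
\<close>

section \<open>Sequences of maps converging with their derivatives\<close>

text \<open>
  A convergent sequence and its limit form one family indexed by \<open>enat\<close>, with the limit at \<open>\<infinity>\<close>. A
  statement about such families covers single maps (constant families) and convergence at the same time.
\<close>

definition uconv :: "(enat \<Rightarrow> 'a::metric_space \<Rightarrow> 'b::metric_space) \<Rightarrow> 'a set \<Rightarrow> bool" where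
  "uconv F S \<longleftrightarrow> (\<forall>i. uniformly_continuous_on S (F i)) \<and>
     uniform_limit S (\<lambda>n. F (enat n)) (F \<infinity>) sequentially"

text \<open>
  Convergence of all derivatives up to order \<open>m\<close>, uniformly on \<open>S\<close>. The derivatives of each member, but
  not the member itself, are required to be bounded, so that lifts of annulus maps are admitted;
  uniform continuity makes the notion stable under composition.
\<close>

primrec Cconv ::
  "nat \<Rightarrow> (enat \<Rightarrow> 'a::euclidean_space \<Rightarrow> 'b::real_normed_vector) \<Rightarrow> 'a set \<Rightarrow> bool" where
  "Cconv 0 F S \<longleftrightarrow> uconv F S"
| "Cconv (Suc m) F S \<longleftrightarrow> uconv F S \<and>
     (\<exists>F'. (\<forall>i. \<forall>x\<in>S. (F i has_derivative F' i x) (at x within S)) \<and>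
       (\<forall>b\<in>Basis. (\<forall>i. bounded ((\<lambda>x. F' i x b) ` S)) \<and> Cconv m (\<lambda>i x. F' i x b) S))"

lemma Cconv_imp_uconv: "Cconv m F S \<Longrightarrow> uconv F S"
  by (cases m) auto

lemma Cconv_SucD: "Cconv (Suc m) F S \<Longrightarrow> Cconv m F S"
proof (induction m arbitrary: F)
  case 0
  then show ?case by simp
next
  case (Suc m)
  from Suc.prems obtain F' where "uconv F S"
    "\<forall>i. \<forall>x\<in>S. (F i has_derivative F' i x) (at x within S)"
    "\<forall>b\<in>Basis. (\<forall>i. bounded ((\<lambda>x. F' i x b) ` S)) \<and> Cconv (Suc m) (\<lambda>i x. F' i x b) S"
    unfolding Cconv.simps(2)[of "Suc m"] by blast
  then show ?case using Suc.IH by (auto intro!: exI[of _ F'])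
qed

lemma Cconv_antimono: "Cconv n F S \<Longrightarrow> m \<le> n \<Longrightarrow> Cconv m F S"
proof (induction n)
  case (Suc n)
  then show ?case using Cconv_SucD le_Suc_eq by metis
qed simp

lemma uniformly_continuous_on_subset:
  fixes f :: "'a::metric_space \<Rightarrow> 'b::metric_space"
  shows "uniformly_continuous_on S f \<Longrightarrow> T \<subseteq> S \<Longrightarrow> uniformly_continuous_on T f"
  unfolding uniformly_continuous_on_def subset_eq by metis

lemma uconv_subset: "uconv F S \<Longrightarrow> T \<subseteq> S \<Longrightarrow> uconv F T"
  unfolding uconv_def using uniformly_continuous_on_subset uniform_limit_on_subset by blast

lemma Cconv_subset: "Cconv m F S \<Longrightarrow> T \<subseteq> S \<Longrightarrow> Cconv m F T"
proof (induction m arbitrary: F)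
  case 0
  then show ?case by (auto intro: uconv_subset)
next
  case (Suc m)
  then obtain F' where F': "uconv F S"
    "\<forall>i. \<forall>x\<in>S. (F i has_derivative F' i x) (at x within S)"
    "\<forall>b\<in>Basis. (\<forall>i. bounded ((\<lambda>x. F' i x b) ` S)) \<and> Cconv m (\<lambda>i x. F' i x b) S"
    by auto
  have "\<forall>b\<in>Basis. (\<forall>i. bounded ((\<lambda>x. F' i x b) ` T)) \<and> Cconv m (\<lambda>i x. F' i x b) T"
  proof (intro ballI conjI allI)
    fix b :: 'a and i assume b: "b \<in> Basis"
    show "bounded ((\<lambda>x. F' i x b) ` T)"
      using F'(3) b bounded_subset[OF _ image_mono[OF Suc.prems(2)]] by blast
    show "Cconv m (\<lambda>i x. F' i x b) T"
      using F'(3) b by (intro Suc.IH[OF _ Suc.prems(2)]) blast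
  qed
  then show ?case unfolding Cconv.simps
    using F'(2) Suc.prems(2) uconv_subset[OF F'(1) Suc.prems(2)]
    by (intro conjI exI[of _ F'] allI ballI)
       (auto intro!: has_derivative_subset[OF _ Suc.prems(2)])
qed

lemma uconv_cong:
  assumes "\<And>i x. x \<in> S \<Longrightarrow> F i x = G i x" "uconv F S" shows "uconv G S"
  using assms by (auto simp: uconv_def uniformly_continuous_on_def uniform_limit_iff)

lemma Cconv_cong:
  assumes "\<And>i x. x \<in> S \<Longrightarrow> F i x = G i x" "Cconv m F S" shows "Cconv m G S"
proof (cases m)
  case 0
  then show ?thesis using uconv_cong[of S F G] assms by simp
next
  case (Suc k)
  with assms obtain F' where F': "uconv F S"
    "\<forall>i. \<forall>x\<in>S. (F i has_derivative F' i x) (at x within S)"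
    "\<forall>b\<in>Basis. (\<forall>i. bounded ((\<lambda>x. F' i x b) ` S)) \<and> Cconv k (\<lambda>i x. F' i x b) S"
    by auto
  have "(G i has_derivative F' i x) (at x within S)" if "x \<in> S" for i x
    by (rule has_derivative_transform[OF that _ F'(2)[rule_format, OF that]]) (simp add: assms(1))
  then show ?thesis using F' Suc uconv_cong[OF assms(1) F'(1)] by auto
qed

lemma uconv_const: "uconv (\<lambda>_. f) S \<longleftrightarrow> uniformly_continuous_on S f"
  by (auto simp: uconv_def uniform_limit_iff)

lemma bounded_const_image: "bounded ((\<lambda>x. c) ` S)"
  by (rule bounded_subset[of "{c}"]) auto

lemma Cconv_const [simp]: "Cconv m (\<lambda>_ _. c) S"
proof (induction m arbitrary: c)
  case 0
  then show ?case by (simp add: uconv_const uniformly_continuous_on_const)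
next
  case (Suc m)
  then show ?case
    by (auto intro!: exI[of _ "\<lambda>_ _ _. 0"] simp: uconv_const uniformly_continuous_on_const bounded_const_image)
qed

lemma uconv_bounded_linear:
  assumes "bounded_linear L" "uconv F S" shows "uconv (\<lambda>i x. L (F i x)) S"
  using assms unfolding uconv_def
  by (auto intro: bounded_linear.uniform_limit bounded_linear.uniformly_continuous_on)

lemma Cconv_bounded_linear:
  assumes L: "bounded_linear L" shows "Cconv m F S \<Longrightarrow> Cconv m (\<lambda>i x. L (F i x)) S"
proof (induction m arbitrary: F)
  case 0
  then show ?case using uconv_bounded_linear[OF L] by simp
next
  case (Suc m)
  then obtain F' where F': "uconv F S"
    "\<forall>i. \<forall>x\<in>S. (F i has_derivative F' i x) (at x within S)"
    "\<forall>b\<in>Basis. (\<forall>i. bounded ((\<lambda>x. F' i x b) ` S)) \<and> Cconv m (\<lambda>i x. F' i x b) S"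
    by auto
  have "bounded ((\<lambda>x. L (F' i x b)) ` S)" if "b \<in> Basis" for i b
    using bounded_linear_image[OF _ L, of "(\<lambda>x. F' i x b) ` S"] F'(3) that
    by (simp add: image_image)
  then show ?case using F' Suc.IH uconv_bounded_linear[OF L]
    by (auto intro!: exI[of _ "\<lambda>i x h. L (F' i x h)"] bounded_linear.has_derivative[OF L])
qed

lemma uconv_add:
  fixes F G :: "enat \<Rightarrow> 'a::metric_space \<Rightarrow> 'b::real_normed_vector"
  assumes "uconv F S" "uconv G S" shows "uconv (\<lambda>i x. F i x + G i x) S"
  using assms unfolding uconv_def
  by (auto intro!: uniform_limit_add uniformly_continuous_on_add)

lemma Cconv_add: "Cconv m F S \<Longrightarrow> Cconv m G S \<Longrightarrow> Cconv m (\<lambda>i x. F i x + G i x) S"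
proof (induction m arbitrary: F G)
  case 0
  then show ?case using uconv_add by simp
next
  case (Suc m)
  then obtain F' G' where F': "uconv F S"
    "\<forall>i. \<forall>x\<in>S. (F i has_derivative F' i x) (at x within S)"
    "\<forall>b\<in>Basis. (\<forall>i. bounded ((\<lambda>x. F' i x b) ` S)) \<and> Cconv m (\<lambda>i x. F' i x b) S"
    and G': "uconv G S"
    "\<forall>i. \<forall>x\<in>S. (G i has_derivative G' i x) (at x within S)"
    "\<forall>b\<in>Basis. (\<forall>i. bounded ((\<lambda>x. G' i x b) ` S)) \<and> Cconv m (\<lambda>i x. G' i x b) S"
    by auto
  show ?case using F' G' Suc.IH uconv_add
    by (auto intro!: exI[of _ "\<lambda>i x h. F' i x h + G' i x h"] has_derivative_add bounded_plus_comp)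
qed

lemma Cconv_diff:
  "Cconv m F S \<Longrightarrow> Cconv m G S \<Longrightarrow> Cconv m (\<lambda>i x. F i x - G i x) S"
  using Cconv_add[OF _ Cconv_bounded_linear[OF bounded_linear_minus[OF bounded_linear_ident]], of m F S G] by simp

lemma Cconv_sum:
  "finite A \<Longrightarrow> (\<And>a. a \<in> A \<Longrightarrow> Cconv m (F a) S) \<Longrightarrow> Cconv m (\<lambda>i x. \<Sum>a\<in>A. F a i x) S"
  by (induction A rule: finite_induct) (auto intro: Cconv_add)

lemma Cconv_Pair:
  assumes "Cconv m F S" "Cconv m G S" shows "Cconv m (\<lambda>i x. (F i x, G i x)) S"
proof -
  have "Cconv m (\<lambda>i x. (F i x, 0) + (0, G i x)) S"
    by (intro Cconv_add Cconv_bounded_linear[OF _ assms(1)] Cconv_bounded_linear[OF _ assms(2)])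
       (auto intro!: bounded_linear_intros)
  then show ?thesis by simp
qed

lemma Cconv_linear:
  assumes L: "bounded_linear L" shows "Cconv m (\<lambda>_. L) S"
proof -
  have uc: "uniformly_continuous_on S L"
    by (rule bounded_linear.uniformly_continuous_on[OF L uniformly_continuous_on_id])
  show ?thesis
  proof (cases m)
    case 0
    then show ?thesis using uc by (simp add: uconv_const)
  next
    case (Suc k)
    then show ?thesis using uc bounded_linear_imp_has_derivative[OF L]
      by (auto intro!: exI[of _ "\<lambda>_ _. L"] simp: uconv_const bounded_const_image)
  qed
qed

lemma uconv_scaleR:
  fixes A :: "enat \<Rightarrow> 'a::metric_space \<Rightarrow> real" and U :: "enat \<Rightarrow> 'a \<Rightarrow> 'b::real_normed_vector"
  assumes A: "uconv A S" "\<And>i. bounded (A i ` S)" and U: "uconv U S" "\<And>i. bounded (U i ` S)"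
  shows "uconv (\<lambda>i x. A i x *\<^sub>R U i x) S"
proof -
  have "uniformly_continuous_on S (\<lambda>x. A i x *\<^sub>R U i x)" for i
  proof -
    obtain a where a: "a > 0" "\<And>x. x \<in> S \<Longrightarrow> \<bar>A i x\<bar> \<le> a"
      using A(2)[of i] unfolding bounded_pos by auto
    obtain u where u: "u > 0" "\<And>x. x \<in> S \<Longrightarrow> norm (U i x) \<le> u"
      using U(2)[of i] unfolding bounded_pos by auto
    show ?thesis unfolding uniformly_continuous_on_def
    proof (intro allI impI)
      fix e :: real assume e: "e > 0"
      obtain d1 where d1: "d1 > 0" "\<And>x y. x \<in> S \<Longrightarrow> y \<in> S \<Longrightarrow> dist y x < d1 \<Longrightarrow> dist (A i y) (A i x) < e / (2 * u)"
        using A(1) e u(1) unfolding uconv_def uniformly_continuous_on_def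
        by (metis divide_pos_pos mult_pos_pos zero_less_numeral)
      obtain d2 where d2: "d2 > 0" "\<And>x y. x \<in> S \<Longrightarrow> y \<in> S \<Longrightarrow> dist y x < d2 \<Longrightarrow> dist (U i y) (U i x) < e / (2 * a)"
        using U(1) e a(1) unfolding uconv_def uniformly_continuous_on_def
        by (metis divide_pos_pos mult_pos_pos zero_less_numeral)
      have "dist (A i y *\<^sub>R U i y) (A i x *\<^sub>R U i x) < e"
        if xy: "x \<in> S" "y \<in> S" "dist y x < min d1 d2" for x y
      proof -
        have "A i y *\<^sub>R U i y - A i x *\<^sub>R U i x
            = (A i y - A i x) *\<^sub>R U i y + A i x *\<^sub>R (U i y - U i x)"
          by (simp add: algebra_simps)
        then have "norm (A i y *\<^sub>R U i y - A i x *\<^sub>R U i x)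
            \<le> \<bar>A i y - A i x\<bar> * norm (U i y) + \<bar>A i x\<bar> * norm (U i y - U i x)"
          by (metis norm_scaleR norm_triangle_ineq)
        also have "\<dots> \<le> \<bar>A i y - A i x\<bar> * u + a * norm (U i y - U i x)"
          using xy a u by (intro add_mono mult_left_mono mult_right_mono) auto
        also have "\<dots> < e / (2 * u) * u + a * (e / (2 * a))"
          using d1(2)[OF xy(1,2)] d2(2)[OF xy(1,2)] xy(3) a(1) u(1)
          by (intro add_strict_mono mult_strict_left_mono mult_strict_right_mono)
             (auto simp: dist_norm)
        also have "\<dots> = e" using a(1) u(1) by simp
        finally show ?thesis by (simp add: dist_norm)
      qed
      then show "\<exists>d>0. \<forall>x\<in>S. \<forall>x'\<in>S. dist x' x < d \<longrightarrow>
          dist (A i x' *\<^sub>R U i x') (A i x *\<^sub>R U i x) < e"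
        using d1(1) d2(1) by (intro exI[of _ "min d1 d2"]) auto
    qed
  qed
  moreover have "uniform_limit S (\<lambda>n x. A (enat n) x *\<^sub>R U (enat n) x) (\<lambda>x. A \<infinity> x *\<^sub>R U \<infinity> x) sequentially"
    using assms unfolding uconv_def
    by (intro bounded_bilinear.bounded_uniform_limit[OF bounded_bilinear_scaleR]) auto
  ultimately show ?thesis unfolding uconv_def by auto
qed

lemma bounded_scaleR_image:
  fixes a :: "'a \<Rightarrow> real" and u :: "'a \<Rightarrow> 'b::real_normed_vector"
  assumes "bounded (a ` S)" "bounded (u ` S)" shows "bounded ((\<lambda>x. a x *\<^sub>R u x) ` S)"
proof -
  obtain A where A: "A > 0" "\<And>x. x \<in> S \<Longrightarrow> \<bar>a x\<bar> \<le> A"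
    using assms(1) unfolding bounded_pos by auto
  obtain B where B: "B > 0" "\<And>x. x \<in> S \<Longrightarrow> norm (u x) \<le> B"
    using assms(2) unfolding bounded_pos by auto
  have "norm (a x *\<^sub>R u x) \<le> A * B" if "x \<in> S" for x
    using A(2)[OF that] B(2)[OF that] A(1) by (auto intro!: mult_mono)
  then show ?thesis unfolding bounded_iff by auto
qed

text \<open>
  Boundedness of the factors is what makes products converge uniformly; derivatives of members are
  bounded by definition, and this is how the product rule will be used in the chain rule.
\<close>

lemma Cconv_scaleR:
  fixes A :: "enat \<Rightarrow> 'a::euclidean_space \<Rightarrow> real" and U :: "enat \<Rightarrow> 'a \<Rightarrow> 'b::real_normed_vector"
  shows "Cconv m A S \<Longrightarrow> (\<And>i. bounded (A i ` S)) \<Longrightarrow> Cconv m U S \<Longrightarrow> (\<And>i. bounded (U i ` S)) \<Longrightarrow>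
    Cconv m (\<lambda>i x. A i x *\<^sub>R U i x) S"
proof (induction m arbitrary: A U)
  case 0
  then show ?case using uconv_scaleR[of A S U] by simp
next
  case (Suc m)
  then obtain A' U' where A': "uconv A S"
    "\<forall>i. \<forall>x\<in>S. (A i has_derivative A' i x) (at x within S)"
    "\<forall>b\<in>Basis. (\<forall>i. bounded ((\<lambda>x. A' i x b) ` S)) \<and> Cconv m (\<lambda>i x. A' i x b) S"
    and U': "uconv U S"
    "\<forall>i. \<forall>x\<in>S. (U i has_derivative U' i x) (at x within S)"
    "\<forall>b\<in>Basis. (\<forall>i. bounded ((\<lambda>x. U' i x b) ` S)) \<and> Cconv m (\<lambda>i x. U' i x b) S"
    by auto
  note bA = Suc.prems(2) and bU = Suc.prems(4)
  have m: "Cconv m A S" "Cconv m U S"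
    using Suc.prems Cconv_SucD by blast+
  show ?case unfolding Cconv.simps
  proof (intro conjI exI[of _ "\<lambda>i x h. A i x *\<^sub>R U' i x h + A' i x h *\<^sub>R U i x"] allI ballI)
    show "uconv (\<lambda>i x. A i x *\<^sub>R U i x) S" by (rule uconv_scaleR[OF A'(1) bA U'(1) bU])
  next
    fix i x assume "x \<in> S"
    then show "((\<lambda>x. A i x *\<^sub>R U i x) has_derivative
       (\<lambda>h. A i x *\<^sub>R U' i x h + A' i x h *\<^sub>R U i x)) (at x within S)"
      using A'(2) U'(2) by (auto intro!: has_derivative_scaleR)
  next
    fix b :: 'a and i assume b: "b \<in> Basis"
    show "bounded ((\<lambda>x. A i x *\<^sub>R U' i x b + A' i x b *\<^sub>R U i x) ` S)"
      using A'(3) U'(3) b bA bU by (intro bounded_plus_comp bounded_scaleR_image) auto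
  next
    fix b :: 'a assume b: "b \<in> Basis"
    show "Cconv m (\<lambda>i x. A i x *\<^sub>R U' i x b + A' i x b *\<^sub>R U i x) S"
      using A'(3) U'(3) b bA bU m by (intro Cconv_add Suc.IH) auto
  qed
qed

lemma uconv_compose:
  assumes F: "uconv F T" and G: "uconv G S" and im: "\<And>i. G i ` S \<subseteq> T"
  shows "uconv (\<lambda>i x. F i (G i x)) S"
  unfolding uconv_def
proof (intro conjI allI)
  fix i
  show "uniformly_continuous_on S (\<lambda>x. F i (G i x))"
    using F G im[of i] uniformly_continuous_on_compose[of S "G i" "F i"]
      uniformly_continuous_on_subset[of T "F i" "G i ` S"]
    by (auto simp: uconv_def)
next
  show "uniform_limit S (\<lambda>n x. F (enat n) (G (enat n) x)) (\<lambda>x. F \<infinity> (G \<infinity> x)) sequentially"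
    unfolding uniform_limit_iff
  proof (intro allI impI)
    fix e :: real assume e: "e > 0"
    obtain d where d: "d > 0" "\<And>x y. x \<in> T \<Longrightarrow> y \<in> T \<Longrightarrow> dist y x < d \<Longrightarrow> dist (F \<infinity> y) (F \<infinity> x) < e / 2"
      using F e unfolding uconv_def uniformly_continuous_on_def by (meson half_gt_zero)
    have 1: "\<forall>\<^sub>F n in sequentially. \<forall>x\<in>T. dist (F (enat n) x) (F \<infinity> x) < e / 2"
      using F e unfolding uconv_def uniform_limit_iff by (meson half_gt_zero)
    have 2: "\<forall>\<^sub>F n in sequentially. \<forall>x\<in>S. dist (G (enat n) x) (G \<infinity> x) < d"
      using G d(1) unfolding uconv_def uniform_limit_iff by blast
    from 1 2 show "\<forall>\<^sub>F n in sequentially. \<forall>x\<in>S. dist (F (enat n) (G (enat n) x)) (F \<infinity> (G \<infinity> x)) < e"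
    proof eventually_elim
      case (elim n)
      show ?case
      proof
        fix x assume x: "x \<in> S"
        have T: "G (enat n) x \<in> T" "G \<infinity> x \<in> T" using im x by auto
        have "dist (F (enat n) (G (enat n) x)) (F \<infinity> (G (enat n) x)) < e / 2"
          using elim(1) T by auto
        moreover have "dist (F \<infinity> (G (enat n) x)) (F \<infinity> (G \<infinity> x)) < e / 2"
          using d(2) elim(2) T x by auto
        ultimately show "dist (F (enat n) (G (enat n) x)) (F \<infinity> (G \<infinity> x)) < e"
          using dist_triangle[of "F (enat n) (G (enat n) x)" "F \<infinity> (G \<infinity> x)" "F \<infinity> (G (enat n) x)"]
          by linarith
      qed
    qed
  qed
qed

lemma bounded_sum_image:
  fixes f :: "'c \<Rightarrow> 'a \<Rightarrow> 'b::real_normed_vector"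
  assumes "finite A" "\<And>a. a \<in> A \<Longrightarrow> bounded (f a ` S)"
  shows "bounded ((\<lambda>x. \<Sum>a\<in>A. f a x) ` S)"
  using assms
proof (induction A rule: finite_induct)
  case (insert a A)
  then show ?case using bounded_plus_comp[of "f a" S "\<lambda>x. \<Sum>a\<in>A. f a x"] by simp
qed (simp add: bounded_const_image)

text \<open>
  By the chain rule a directional derivative of \<open>F i \<circ> G i\<close> is the sum over the basis of products of
  components of a derivative of \<open>G i\<close> with partial derivatives of \<open>F i\<close> composed with \<open>G i\<close>. These have
  one order less, so induction on the order applies with \<open>G\<close> kept fixed.
\<close>

lemma Cconv_compose:
  fixes F :: "enat \<Rightarrow> 'b::euclidean_space \<Rightarrow> 'c::real_normed_vector"
    and G :: "enat \<Rightarrow> 'a::euclidean_space \<Rightarrow> 'b"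
  shows "Cconv m F T \<Longrightarrow> Cconv m G S \<Longrightarrow> (\<And>i. G i ` S \<subseteq> T) \<Longrightarrow> Cconv m (\<lambda>i x. F i (G i x)) S"
proof (induction m arbitrary: F)
  case 0
  have "uconv F T" "uconv G S" using "0.prems" by simp_all
  then have "uconv (\<lambda>i x. F i (G i x)) S" using "0.prems"(3) by (rule uconv_compose)
  then show ?case by simp
next
  case (Suc m)
  from Suc.prems(1,2) obtain F' G' where F': "uconv F T"
    "\<forall>i. \<forall>x\<in>T. (F i has_derivative F' i x) (at x within T)"
    "\<forall>b\<in>Basis. (\<forall>i. bounded ((\<lambda>x. F' i x b) ` T)) \<and> Cconv m (\<lambda>i x. F' i x b) T"
    and G': "uconv G S"
    "\<forall>i. \<forall>x\<in>S. (G i has_derivative G' i x) (at x within S)"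
    "\<forall>b\<in>Basis. (\<forall>i. bounded ((\<lambda>x. G' i x b) ` S)) \<and> Cconv m (\<lambda>i x. G' i x b) S"
    unfolding Cconv.simps by blast
  note im = Suc.prems(3)
  have Gm: "Cconv m G S" by (rule Cconv_SucD[OF Suc.prems(2)])
  let ?D = "\<lambda>i x h. \<Sum>c\<in>Basis. (G' i x h \<bullet> c) *\<^sub>R F' i (G i x) c"
  have D: "((\<lambda>x. F i (G i x)) has_derivative ?D i x) (at x within S)" if x: "x \<in> S" for i x
  proof -
    have dF: "(F i has_derivative F' i (G i x)) (at (G i x) within T)"
      using F'(2) im[of i] x by blast
    have 1: "((\<lambda>x. F i (G i x)) has_derivative (\<lambda>h. F' i (G i x) (G' i x h))) (at x within S)"
      by (rule has_derivative_in_compose2[OF F'(2)[rule_format] im x G'(2)[rule_format, OF x]])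
    have 2: "F' i (G i x) v = (\<Sum>c\<in>Basis. (v \<bullet> c) *\<^sub>R F' i (G i x) c)" for v
    proof -
      interpret linear "F' i (G i x)" using has_derivative_linear[OF dF] .
      show ?thesis using sum[of "\<lambda>c. (v \<bullet> c) *\<^sub>R c" Basis]
        by (simp add: euclidean_representation scale)
    qed
    show ?thesis by (rule has_derivative_eq_rhs[OF 1]) (rule ext, rule 2)
  qed
  have bF: "bounded ((\<lambda>x. F' i (G i x) c) ` S)" if "c \<in> Basis" for i c
  proof (rule bounded_subset)
    show "bounded ((\<lambda>x. F' i x c) ` T)" using F'(3) that by simp
    show "(\<lambda>x. F' i (G i x) c) ` S \<subseteq> (\<lambda>x. F' i x c) ` T" using im[of i] by auto
  qed
  have bG: "bounded ((\<lambda>x. G' i x b \<bullet> c) ` S)" if "b \<in> Basis" for i b c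
  proof -
    have "bounded ((\<lambda>x. G' i x b) ` S)" using G'(3) that by blast
    from bounded_linear_image[OF this bounded_linear_inner_left, of c] show ?thesis
      by (simp only: image_image)
  qed
  show ?case unfolding Cconv.simps
  proof (intro conjI exI[of _ ?D] allI ballI)
    show "uconv (\<lambda>i x. F i (G i x)) S" by (rule uconv_compose[OF F'(1) G'(1) im])
  next
    fix i x assume "x \<in> S"
    then show "((\<lambda>x. F i (G i x)) has_derivative ?D i x) (at x within S)" by (rule D)
  next
    fix b :: 'a and i assume b: "b \<in> Basis"
    show "bounded ((\<lambda>x. ?D i x b) ` S)"
    proof (rule bounded_sum_image[OF finite_Basis])
      fix c :: 'b assume "c \<in> Basis"
      then show "bounded ((\<lambda>x. (G' i x b \<bullet> c) *\<^sub>R F' i (G i x) c) ` S)"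
        by (rule bounded_scaleR_image[OF bG[OF b] bF])
    qed
  next
    fix b :: 'a assume b: "b \<in> Basis"
    show "Cconv m (\<lambda>i x. ?D i x b) S"
    proof (intro Cconv_sum Cconv_scaleR finite_Basis bG bF b)
      fix c :: 'b assume c: "c \<in> Basis"
      show "Cconv m (\<lambda>i x. G' i x b \<bullet> c) S"
        by (rule Cconv_bounded_linear[OF bounded_linear_inner_left]) (use G'(3) b in auto)
      show "Cconv m (\<lambda>i x. F' i (G i x) c) S"
        by (rule Suc.IH[OF _ Gm im]) (use F'(3) c in auto)
    qed
  qed
qed

lemma Cconv_fixed: "Cconv m F S \<Longrightarrow> Cconv m (\<lambda>_. F i) S"
proof (induction m arbitrary: F)
  case 0
  then show ?case by (simp add: uconv_const) (simp add: uconv_def)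
next
  case (Suc m)
  then obtain F' where F': "uconv F S"
    "\<forall>i. \<forall>x\<in>S. (F i has_derivative F' i x) (at x within S)"
    "\<forall>b\<in>Basis. (\<forall>i. bounded ((\<lambda>x. F' i x b) ` S)) \<and> Cconv m (\<lambda>i x. F' i x b) S"
    by auto
  have "uniformly_continuous_on S (F i)" using F'(1) by (simp add: uconv_def)
  moreover have "Cconv m (\<lambda>_ x. F' i x b) S" if "b \<in> Basis" for b
    using Suc.IH[of "\<lambda>i x. F' i x b"] F'(3) that by blast
  ultimately show ?case using F' by (auto simp: uconv_const intro!: exI[of _ "\<lambda>_. F' i"])
qed

lemma Cconv_mult:
  fixes A U :: "enat \<Rightarrow> 'a::euclidean_space \<Rightarrow> real"
  assumes "Cconv m A S" "\<And>i. bounded (A i ` S)" "Cconv m U S" "\<And>i. bounded (U i ` S)"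
  shows "Cconv m (\<lambda>i x. A i x * U i x) S"
  using Cconv_scaleR[OF assms] by simp

lemma Cconv_imp_C_nat_on: "Cconv m F S \<Longrightarrow> C_nat_on m (F i) S"
proof (induction m arbitrary: F)
  case 0
  then show ?case by (simp add: uconv_def uniformly_continuous_imp_continuous)
next
  case (Suc m)
  then obtain F' where F': "\<forall>i. \<forall>x\<in>S. (F i has_derivative F' i x) (at x within S)"
    "\<forall>b\<in>Basis. Cconv m (\<lambda>i x. F' i x b) S"
    by auto
  have "C_nat_on m (\<lambda>x. F' i x v) S" for v
  proof (rule Suc.IH[of "\<lambda>i x. F' i x v"])
    have "Cconv m (\<lambda>i x. \<Sum>b\<in>Basis. (v \<bullet> b) *\<^sub>R F' i x b) S"
      using F'(2) by (intro Cconv_sum finite_Basis Cconv_bounded_linear[OF bounded_linear_scaleR_right]) auto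
    then show "Cconv m (\<lambda>i x. F' i x v) S"
    proof (rule Cconv_cong[rotated])
      fix i x assume "x \<in> S"
      then interpret linear "F' i x" using F'(1) has_derivative_linear by blast
      show "(\<Sum>b\<in>Basis. (v \<bullet> b) *\<^sub>R F' i x b) = F' i x v"
        using sum[of "\<lambda>b. (v \<bullet> b) *\<^sub>R b" Basis] by (simp add: euclidean_representation scale)
    qed
  qed
  then show ?case using F'(1) by (auto intro!: exI[of _ "F' i"])
qed

text \<open>
  A quantitative counterpart of convergence to zero: the map and its partial derivatives up to order \<open>m\<close>
  are bounded by \<open>e\<close>. This is the form in which corrections are summed.
\<close>

primrec Cm_le ::
  "nat \<Rightarrow> real \<Rightarrow> ('a::euclidean_space \<Rightarrow> 'b::real_normed_vector) \<Rightarrow> 'a set \<Rightarrow> bool" where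
  "Cm_le 0 e u S \<longleftrightarrow> uniformly_continuous_on S u \<and> (\<forall>x\<in>S. norm (u x) \<le> e)"
| "Cm_le (Suc m) e u S \<longleftrightarrow> uniformly_continuous_on S u \<and> (\<forall>x\<in>S. norm (u x) \<le> e) \<and>
     (\<exists>u'. (\<forall>x\<in>S. (u has_derivative u' x) (at x within S)) \<and>
       (\<forall>b\<in>Basis. Cm_le m e (\<lambda>x. u' x b) S))"

lemma Cm_leD:
  assumes "Cm_le m e u S"
  shows "uniformly_continuous_on S u" "\<And>x. x \<in> S \<Longrightarrow> norm (u x) \<le> e"
  using assms by (cases m; auto)+

lemma Cm_le_imp_Cconv: "Cm_le m e u S \<Longrightarrow> Cconv m (\<lambda>_. u) S"
proof (induction m arbitrary: u)
  case 0
  then show ?case by (simp add: uconv_const)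
next
  case (Suc m)
  then obtain u' where u': "\<forall>x\<in>S. (u has_derivative u' x) (at x within S)"
    "\<forall>b\<in>Basis. Cm_le m e (\<lambda>x. u' x b) S"
    by auto
  have "bounded ((\<lambda>x. u' x b) ` S)" if "b \<in> Basis" for b
    using Cm_leD(2)[OF u'(2)[rule_format, OF that]] unfolding bounded_iff by blast
  then show ?case using Suc u' by (auto simp: uconv_const intro!: exI[of _ "\<lambda>_. u'"])
qed

lemma uconv_eventually_le:
  fixes F :: "enat \<Rightarrow> 'a::metric_space \<Rightarrow> 'b::real_normed_vector"
  assumes "uconv F S" "e > 0"
  shows "\<forall>\<^sub>F n in sequentially. \<forall>x\<in>S. norm (F (enat n) x - F \<infinity> x) \<le> e"
proof -
  have "\<forall>\<^sub>F n in sequentially. \<forall>x\<in>S. dist (F (enat n) x) (F \<infinity> x) < e"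
    using assms unfolding uconv_def uniform_limit_iff by blast
  then show ?thesis by eventually_elim (auto simp: dist_norm less_imp_le)
qed

lemma uconv_diff_uc:
  fixes F :: "enat \<Rightarrow> 'a::metric_space \<Rightarrow> 'b::real_normed_vector"
  assumes "uconv F S" shows "uniformly_continuous_on S (\<lambda>x. F i x - F j x)"
  using assms unfolding uconv_def by (auto intro: uniformly_continuous_on_diff)

lemma Cconv_eventually_Cm_le:
  "Cconv m F S \<Longrightarrow> e > 0 \<Longrightarrow>
    \<forall>\<^sub>F n in sequentially. Cm_le m e (\<lambda>x. F (enat n) x - F \<infinity> x) S"
proof (induction m arbitrary: F)
  case 0
  then show ?case using uconv_eventually_le[of F S e] uconv_diff_uc[of F S] by simp
next
  case (Suc m)
  from Suc.prems(1) obtain F' where F': "uconv F S"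
    "\<And>i x. x\<in>S \<Longrightarrow> (F i has_derivative F' i x) (at x within S)"
    "\<And>b. b\<in>Basis \<Longrightarrow> Cconv m (\<lambda>i x. F' i x b) S"
    by auto
  have "\<forall>\<^sub>F n in sequentially. \<forall>b\<in>Basis. Cm_le m e (\<lambda>x. F' (enat n) x b - F' \<infinity> x b) S"
    using Suc.IH[OF F'(3) Suc.prems(2)] by (auto intro!: eventually_ball_finite)
  moreover note uconv_eventually_le[OF F'(1) Suc.prems(2)]
  ultimately show ?case
  proof eventually_elim
    case (elim n)
    then show ?case using uconv_diff_uc[OF F'(1)] F'(2)
      by (auto intro!: exI[of _ "\<lambda>x h. F' (enat n) x h - F' \<infinity> x h"] has_derivative_diff)
  qed
qed

lemma uniform_limit_uniformly_continuous:
  fixes f :: "nat \<Rightarrow> 'a::metric_space \<Rightarrow> 'b::metric_space"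
  assumes lim: "uniform_limit S f g sequentially" and uc: "\<And>n. uniformly_continuous_on S (f n)"
  shows "uniformly_continuous_on S g"
  unfolding uniformly_continuous_on_def
proof (intro allI impI)
  fix e :: real assume e: "e > 0"
  then have "e / 3 > 0" by simp
  then have "\<forall>\<^sub>F n in sequentially. \<forall>x\<in>S. dist (f n x) (g x) < e / 3"
    using lim unfolding uniform_limit_iff by blast
  then obtain n where n: "\<And>x. x \<in> S \<Longrightarrow> dist (f n x) (g x) < e / 3"
    using eventually_happens'[OF sequentially_bot] by blast
  obtain d where d: "d > 0" "\<And>x y. x \<in> S \<Longrightarrow> y \<in> S \<Longrightarrow> dist y x < d \<Longrightarrow> dist (f n y) (f n x) < e / 3"
    using uc[of n] e unfolding uniformly_continuous_on_def by (metis divide_pos_pos zero_less_numeral)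
  have "dist (g y) (g x) < e" if "x \<in> S" "y \<in> S" "dist y x < d" for x y
    using n[OF that(1)] n[OF that(2)] d(2)[OF that]
      dist_triangle[of "g y" "g x" "f n y"] dist_triangle[of "f n y" "g x" "f n x"]
    by (simp add: dist_commute)
  then show "\<exists>d>0. \<forall>x\<in>S. \<forall>x'\<in>S. dist x' x < d \<longrightarrow> dist (g x') (g x) < e"
    using d(1) by blast
qed

text \<open>
  The infinite triangle inequality for \<open>C\<^sup>m\<close> norms, which contains their completeness: Weierstrass' test
  applies to the maps and to all their partial derivatives, and the series may be differentiated term by term
  on a convex set.
\<close>

lemma Cm_le_suminf:
  fixes u :: "nat \<Rightarrow> 'a::euclidean_space \<Rightarrow> 'b::banach"
  assumes "convex S" and sm: "summable e"
  shows "(\<And>n. Cm_le m (e n) (u n) S) \<Longrightarrow> Cm_le m (suminf e) (\<lambda>x. \<Sum>n. u n x) S"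
proof (induction m arbitrary: u)
  have base: "uniformly_continuous_on S (\<lambda>x. \<Sum>n. u n x) \<and> (\<forall>x\<in>S. norm (\<Sum>n. u n x) \<le> suminf e) \<and>
      uniform_limit S (\<lambda>n x. \<Sum>i<n. u i x) (\<lambda>x. \<Sum>n. u n x) sequentially"
    if u: "\<And>n. uniformly_continuous_on S (u n)" "\<And>n x. x \<in> S \<Longrightarrow> norm (u n x) \<le> e n"
    for u :: "nat \<Rightarrow> 'a \<Rightarrow> 'b"
  proof -
    have lim: "uniform_limit S (\<lambda>n x. \<Sum>i<n. u i x) (\<lambda>x. \<Sum>n. u n x) sequentially"
      using u(2) sm by (rule Weierstrass_m_test)
    have "uniformly_continuous_on S (\<lambda>x. \<Sum>i<n. u i x)" for n
      by (induction n) (auto intro: uniformly_continuous_on_add u(1) simp: uniformly_continuous_on_const)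
    then have "uniformly_continuous_on S (\<lambda>x. \<Sum>n. u n x)"
      by (rule uniform_limit_uniformly_continuous[OF lim])
    moreover have "norm (\<Sum>n. u n x) \<le> suminf e" if "x \<in> S" for x
      using u(2)[OF that] sm by (rule norm_suminf_le)
    ultimately show ?thesis using lim by blast
  qed
  {
    case 0
    then show ?case using base[of u] by auto
  next
    case (Suc m)
    then have "\<exists>u'. (\<forall>x\<in>S. (u n has_derivative u' x) (at x within S)) \<and>
       (\<forall>b\<in>Basis. Cm_le m (e n) (\<lambda>x. u' x b) S)" for n
      by auto
    then obtain u' where u': "\<And>n x. x\<in>S \<Longrightarrow> (u n has_derivative u' n x) (at x within S)"
       "\<And>n b. b\<in>Basis \<Longrightarrow> Cm_le m (e n) (\<lambda>x. u' n x b) S"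
      by metis
    have b: "uniformly_continuous_on S (\<lambda>x. \<Sum>n. u n x)" "\<forall>x\<in>S. norm (\<Sum>n. u n x) \<le> suminf e"
        "uniform_limit S (\<lambda>n x. \<Sum>i<n. u i x) (\<lambda>x. \<Sum>n. u n x) sequentially"
      using base[OF Cm_leD[OF Suc.prems]] by auto
    have b': "uniform_limit S (\<lambda>n x. \<Sum>i<n. u' i x b) (\<lambda>x. \<Sum>n. u' n x b) sequentially"
      if "b \<in> Basis" for b
      using base[OF Cm_leD[OF u'(2)[OF that]]] by auto
    define g' where "g' = (\<lambda>x h. \<Sum>b\<in>Basis. (h \<bullet> b) *\<^sub>R (\<Sum>n. u' n x b))"
    have g'_Basis: "g' x b = (\<Sum>n. u' n x b)" if "b \<in> Basis" for x b
    proof -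
      have "g' x b = (\<Sum>c\<in>Basis. if c = b then (\<Sum>n. u' n x c) else 0)"
        unfolding g'_def using that by (intro sum.cong) (auto simp: inner_Basis)
      then show ?thesis using that by simp
    qed
    have ev: "\<forall>\<^sub>F n in sequentially. \<forall>x\<in>S. \<forall>h. norm ((\<Sum>i<n. u' i x h) - g' x h) \<le> \<epsilon> * norm h"
      if "\<epsilon> > 0" for \<epsilon> :: real
    proof -
      let ?d = "\<epsilon> / real DIM('a)"
      have "\<forall>\<^sub>F n in sequentially. \<forall>x\<in>S. dist (\<Sum>i<n. u' i x b) (\<Sum>n. u' n x b) < ?d"
        if "b \<in> Basis" for b
        using b'[OF that] \<open>\<epsilon> > 0\<close> unfolding uniform_limit_iff by (simp add: DIM_positive)
      then have "\<forall>\<^sub>F n in sequentially. \<forall>b\<in>Basis. \<forall>x\<in>S. dist (\<Sum>i<n. u' i x b) (\<Sum>n. u' n x b) < ?d"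
        by (intro eventually_ball_finite) auto
      then show ?thesis
      proof eventually_elim
        case (elim n)
        show ?case
        proof (intro ballI allI)
          fix x h assume x: "x \<in> S"
          have "(\<Sum>i<n. u' i x h) = (\<Sum>i<n. \<Sum>b\<in>Basis. (h \<bullet> b) *\<^sub>R u' i x b)"
          proof (rule sum.cong[OF refl])
            fix i
            interpret linear "u' i x" using u'(1)[OF x] has_derivative_linear by blast
            show "u' i x h = (\<Sum>b\<in>Basis. (h \<bullet> b) *\<^sub>R u' i x b)"
              using sum[of "\<lambda>b. (h \<bullet> b) *\<^sub>R b" Basis] by (simp add: euclidean_representation scale)
          qed
          also have "\<dots> = (\<Sum>b\<in>Basis. (h \<bullet> b) *\<^sub>R (\<Sum>i<n. u' i x b))"
            by (subst sum.swap) (simp add: scaleR_sum_right)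
          finally have "(\<Sum>i<n. u' i x h) - g' x h
              = (\<Sum>b\<in>Basis. (h \<bullet> b) *\<^sub>R ((\<Sum>i<n. u' i x b) - (\<Sum>n. u' n x b)))"
            by (simp add: g'_def sum_subtractf scaleR_diff_right)
          also have "norm \<dots> \<le> (\<Sum>b\<in>(Basis::'a set). norm h * ?d)"
          proof (rule sum_norm_le)
            fix b :: 'a assume bb: "b \<in> Basis"
            show "norm ((h \<bullet> b) *\<^sub>R ((\<Sum>i<n. u' i x b) - (\<Sum>n. u' n x b))) \<le> norm h * ?d"
              unfolding norm_scaleR
              using elim[rule_format, OF bb x] Basis_le_norm[OF bb, of h]
              by (intro mult_mono) (simp_all add: dist_norm less_imp_le)
          qed
          also have "\<dots> = \<epsilon> * norm h" by simp
          finally show "norm ((\<Sum>i<n. u' i x h) - g' x h) \<le> \<epsilon> * norm h" .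
        qed
      qed
    qed
    have "((\<lambda>x. \<Sum>n. u n x) has_derivative g' x) (at x within S)" if x: "x \<in> S" for x
    proof -
      have "summable (\<lambda>n. u n x)"
        using summable_comparison_test'[OF sm, of 0 "\<lambda>n. u n x"] Cm_leD(2)[OF Suc.prems x] by simp
      then obtain l where "(\<lambda>n. u n x) sums l" by (auto simp: summable_def)
      from has_derivative_series[OF assms(1) u'(1) ev x this] obtain g where
        g: "\<forall>x\<in>S. (\<lambda>n. u n x) sums g x \<and> (g has_derivative g' x) (at x within S)" by blast
      then show ?thesis using x by (intro has_derivative_transform[OF x _ g[rule_format, OF x, THEN conjunct2]])
         (auto simp: sums_iff)
    qed
    moreover have "\<forall>b\<in>Basis. Cm_le m (suminf e) (\<lambda>x. g' x b) S"
      using Suc.IH[of "\<lambda>n x. u' n x b" for b] u'(2) g'_Basis by simp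
    ultimately show ?case using b by auto
  }
qed

section \<open>Smooth maps with bounded derivatives\<close>

text \<open>
  Smooth maps with bounded, uniformly continuous derivatives of all positive orders. Lifts of smooth
  annulus maps have these properties by periodicity.
\<close>

definition tame :: "('a::euclidean_space \<Rightarrow> 'b::real_normed_vector) \<Rightarrow> 'a set \<Rightarrow> bool" where
  "tame f S \<longleftrightarrow> (\<forall>m. Cconv m (\<lambda>_. f) S)"

lemma tame_const: "tame (\<lambda>_. c) S"
  by (simp add: tame_def)

lemma tame_linear: "bounded_linear L \<Longrightarrow> tame L S"
  by (simp add: tame_def Cconv_linear)

lemma tame_bounded_linear: "bounded_linear L \<Longrightarrow> tame f S \<Longrightarrow> tame (\<lambda>x. L (f x)) S"
  using Cconv_bounded_linear[of L _ "\<lambda>_. f"] by (auto simp: tame_def)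

lemma tame_add: "tame f S \<Longrightarrow> tame g S \<Longrightarrow> tame (\<lambda>x. f x + g x) S"
  using Cconv_add[of _ "\<lambda>_. f" S "\<lambda>_. g"] by (auto simp: tame_def)

lemma tame_diff: "tame f S \<Longrightarrow> tame g S \<Longrightarrow> tame (\<lambda>x. f x - g x) S"
  using Cconv_diff[of _ "\<lambda>_. f" S "\<lambda>_. g"] by (auto simp: tame_def)

lemma tame_mult:
  fixes f g :: "'a::euclidean_space \<Rightarrow> real"
  assumes "tame f S" "bounded (f ` S)" "tame g S" "bounded (g ` S)"
  shows "tame (\<lambda>x. f x * g x) S"
  using Cconv_mult[of _ "\<lambda>_. f" S "\<lambda>_. g"] assms by (auto simp: tame_def)

lemma tame_Pair: "tame f S \<Longrightarrow> tame g S \<Longrightarrow> tame (\<lambda>x. (f x, g x)) S"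
  using Cconv_Pair[of _ "\<lambda>_. f" S "\<lambda>_. g"] by (auto simp: tame_def)

lemma tame_compose:
  fixes f :: "'b::euclidean_space \<Rightarrow> 'c::real_normed_vector" and g :: "'a::euclidean_space \<Rightarrow> 'b"
  assumes "tame f T" "tame g S" "g ` S \<subseteq> T" shows "tame (\<lambda>x. f (g x)) S"
  using Cconv_compose[of _ "\<lambda>_. f" T "\<lambda>_. g" S] assms by (auto simp: tame_def)

lemma tame_subset: "tame f S \<Longrightarrow> T \<subseteq> S \<Longrightarrow> tame f T"
  unfolding tame_def using Cconv_subset by blast

lemma tame_cong: "tame f S \<Longrightarrow> (\<And>x. x \<in> S \<Longrightarrow> f x = g x) \<Longrightarrow> tame g S"
  unfolding tame_def using Cconv_cong[of S "\<lambda>_. f" "\<lambda>_. g"] by auto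

lemma tame_uniformly_continuous: "tame f S \<Longrightarrow> uniformly_continuous_on S f"
  unfolding tame_def using Cconv_imp_uconv uconv_const by blast

lemma bounded_deriv_imp_uniformly_continuous:
  fixes f :: "real \<Rightarrow> real"
  assumes "\<And>x. (f has_real_derivative f' x) (at x)" "\<And>x. \<bar>f' x\<bar> \<le> B"
  shows "uniformly_continuous_on UNIV f"
proof -
  have B: "B \<ge> 0" using assms(2)[of 0] by linarith
  have lip: "norm (f x - f y) \<le> B * norm (x - y)" for x y
    using assms by (intro field_differentiable_bound[of UNIV f f' B]) auto
  show ?thesis unfolding uniformly_continuous_on_def
  proof (intro allI impI)
    fix e :: real assume e: "e > 0"
    have "dist (f x) (f y) < e" if "dist x y < e / (B + 1)" for x y
    proof -
      have "dist (f x) (f y) \<le> B * dist x y" using lip by (simp add: dist_norm)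
      also have "\<dots> \<le> (B + 1) * dist x y" by (intro mult_right_mono) auto
      also have "\<dots> < e" using that B by (simp add: field_simps)
      finally show ?thesis .
    qed
    then show "\<exists>d>0. \<forall>x\<in>UNIV. \<forall>x'\<in>UNIV. dist x' x < d \<longrightarrow> dist (f x') (f x) < e"
      using e B by (intro exI[of _ "e / (B + 1)"]) auto
  qed
qed

lemma Cconv_real_Suc:
  fixes f f' :: "real \<Rightarrow> real"
  assumes d: "\<And>x. (f has_real_derivative f' x) (at x)" and b: "\<And>x. \<bar>f' x\<bar> \<le> B"
    and C: "Cconv m (\<lambda>_. f') UNIV"
  shows "Cconv (Suc m) (\<lambda>_. f) UNIV"
proof -
  have "bounded (range f')" using b unfolding bounded_iff by auto
  moreover have "(f has_derivative (\<lambda>h. f' x * h)) (at x)" for x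
    using d[of x] by (simp add: has_field_derivative_def)
  moreover have "uniformly_continuous_on UNIV f"
    by (rule bounded_deriv_imp_uniformly_continuous[OF d b])
  ultimately show ?thesis using C
    by (auto simp: uconv_const intro!: exI[of _ "\<lambda>_ x h. f' x * h"])
qed

lemma tame_sin: "tame (sin :: real \<Rightarrow> real) UNIV" and tame_cos: "tame (cos :: real \<Rightarrow> real) UNIV"
proof -
  have "Cconv m (\<lambda>_ x. sin (x + a)) UNIV" for m and a :: real
  proof (induction m arbitrary: a)
    case 0
    have "uniformly_continuous_on UNIV (\<lambda>x. sin (x + a))"
      by (rule bounded_deriv_imp_uniformly_continuous[where f'="\<lambda>x. cos (x + a)" and B=1])
         (auto intro!: derivative_eq_intros)
    then show ?case by (simp add: uconv_const)
  next
    case (Suc m)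
    have "Cconv m (\<lambda>_ x. cos (x + a)) UNIV"
      using Suc[of "a + pi / 2"] by (simp add: sin_add cos_add)
    then show ?case
      by (rule Cconv_real_Suc[where B=1, rotated 2]) (auto intro!: derivative_eq_intros)
  qed
  from this[of _ 0] this[of _ "pi/2"]
  show "tame (sin :: real \<Rightarrow> real) UNIV" "tame (cos :: real \<Rightarrow> real) UNIV"
    by (simp_all add: tame_def sin_add)
qed

text \<open>
  The standard flat function is \<open>flat_exp 0\<close>. The family is closed under differentiation up to linear
  combinations, and \<open>flat_exp k x\<close> is at most \<open>fact k\<close> because \<open>t ^ k / fact k\<close> is one term of the series of
  \<open>exp t\<close> at \<open>t = 1 / x\<close>; this bounds all derivatives at once.
\<close>

definition flat_exp :: "nat \<Rightarrow> real \<Rightarrow> real" where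
  "flat_exp k x = (if x > 0 then exp (- 1 / x) / x ^ k else 0)"

lemma flat_exp_nonneg: "flat_exp k x \<ge> 0"
  by (simp add: flat_exp_def)

lemma flat_exp_le: "flat_exp k x \<le> fact k"
proof (cases "x > 0")
  case True
  define t where "t = 1 / x"
  have t: "t > 0" using True by (simp add: t_def)
  have "(\<Sum>n\<in>{k}. t ^ n /\<^sub>R fact n) \<le> (\<Sum>n. t ^ n /\<^sub>R fact n)"
    using t by (intro sum_le_suminf summable_exp_generic) auto
  then have "t ^ k / fact k \<le> exp t"
    by (simp add: exp_def divide_inverse mult.commute)
  then have "t ^ k * exp (- t) \<le> fact k"
    by (simp add: exp_minus field_simps)
  then show ?thesis using True by (simp add: flat_exp_def t_def power_one_over field_simps)
qed (simp add: flat_exp_def)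

lemma flat_exp_Suc: "flat_exp k x = x * flat_exp (Suc k) x"
  by (simp add: flat_exp_def)

text \<open>
  At the origin the difference quotient of \<open>flat_exp k\<close> is \<open>flat_exp (k + 1)\<close>, which is \<open>O(h)\<close> by the bound
  for \<open>flat_exp (k + 2)\<close>.
\<close>

lemma flat_exp_deriv:
  "(flat_exp k has_real_derivative flat_exp (k + 2) x - real k * flat_exp (k + 1) x) (at x)"
proof -
  consider "x > 0" | "x < 0" | "x = 0" by linarith
  then show ?thesis
  proof cases
    case 1
    have "((\<lambda>x. exp (- 1 / x) / x ^ k) has_real_derivative
        flat_exp (k + 2) x - real k * flat_exp (k + 1) x) (at x)"
      using 1 apply (auto intro!: derivative_eq_intros simp: flat_exp_def)
      apply (cases k)
       apply (auto simp: field_simps power2_eq_square)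
      done
    then show ?thesis
      by (rule has_field_derivative_transform_within_open[where S="{0<..}"])
         (use 1 in \<open>auto simp: flat_exp_def\<close>)
  next
    case 2
    have "((\<lambda>x. 0) has_real_derivative 0) (at x)" by simp
    then have "(flat_exp k has_real_derivative 0) (at x)"
      by (rule has_field_derivative_transform_within_open[where S="{..<0}"])
         (use 2 in \<open>auto simp: flat_exp_def\<close>)
    then show ?thesis using 2 by (simp add: flat_exp_def)
  next
    case 3
    have "((\<lambda>h. flat_exp k h / h) \<longlongrightarrow> 0) (at 0)"
    proof (rule tendsto_0_le[where f="\<lambda>h. h" and K="fact (k + 2)"])
      show "\<forall>\<^sub>F h in at 0. norm (flat_exp k h / h) \<le> norm h * fact (k + 2)"
      proof (rule eventuallyI)
        fix h :: real
        have "flat_exp k h / h = (if h = 0 then 0 else h * flat_exp (k + 2) h)"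
          using flat_exp_Suc[of k h] flat_exp_Suc[of "Suc k" h] by simp
        then show "norm (flat_exp k h / h) \<le> norm h * fact (k + 2)"
          using flat_exp_le[of "k + 2" h] flat_exp_nonneg[of "k + 2" h]
          by (auto simp: abs_mult intro!: mult_left_mono)
      qed
    qed (rule tendsto_ident_at)
    then show ?thesis using 3 by (simp add: DERIV_def flat_exp_def)
  qed
qed

lemma tame_flat_exp: "tame (flat_exp k) UNIV"
proof -
  have bd: "\<bar>flat_exp (k + 2) x - real k * flat_exp (k + 1) x\<bar> \<le> fact (k + 2) + real k * fact (k + 1)" for k x
  proof -
    have "0 \<le> real k * flat_exp (k + 1) x" "real k * flat_exp (k + 1) x \<le> real k * fact (k + 1)"
      using flat_exp_le[of "k + 1" x] flat_exp_nonneg[of "k + 1" x] by (auto intro: mult_left_mono)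
    then show ?thesis
      using flat_exp_le[of "k + 2" x] flat_exp_nonneg[of "k + 2" x] by linarith
  qed
  have "Cconv m (\<lambda>_. flat_exp k) UNIV" for m
  proof (induction m arbitrary: k)
    case 0
    then show ?case
      using bounded_deriv_imp_uniformly_continuous[OF flat_exp_deriv bd] by (simp add: uconv_const)
  next
    case (Suc m)
    have "Cconv m (\<lambda>_ x. flat_exp (k + 2) x - real k * flat_exp (k + 1) x) UNIV"
      by (intro Cconv_diff Suc Cconv_bounded_linear[OF bounded_linear_mult_right])
    then show ?case by (rule Cconv_real_Suc[OF flat_exp_deriv bd])
  qed
  then show ?thesis by (simp add: tame_def)
qed

section \<open>A twist that brings every horizontal circle close to the boundary\<close>

type_synonym plane = "real \<times> real"

text \<open>Time and position: the isotopies are maps from these points to the plane.\<close>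

type_synonym timed = "real \<times> plane"

definition level :: "plane \<Rightarrow> real" where
  "level z = 9 * (fst z)\<^sup>2 + (snd z)\<^sup>2"

definition twist_angle :: "real \<Rightarrow> plane \<Rightarrow> real" where
  "twist_angle C z = C * flat_exp 0 (1 - level z)"

text \<open>
  In the coordinates \<open>(3 * x, y)\<close> this is a rotation of the plane whose angle depends on the distance to
  the origin only. It fixes all points outside the ellipse where \<open>level\<close> is less than 1; the ellipse
  touches the lines \<open>y = 1\<close> and \<open>y = - 1\<close>, and the factor 3 makes it narrow enough for its translates by
  integers to be disjoint.
\<close>

definition disc_twist :: "real \<Rightarrow> plane \<Rightarrow> plane" where
  "disc_twist C z = (let a = twist_angle C z in
     (cos a * fst z - sin a * snd z / 3, sin a * (3 * fst z) + cos a * snd z))"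

definition twist :: "real \<Rightarrow> plane \<Rightarrow> plane" where
  "twist C z = (let n = of_int (round (fst z)) in disc_twist C (fst z - n, snd z) + (n, 0))"

lemma level_disc_twist: "level (disc_twist C z) = level z"
proof -
  define a where "a = twist_angle C z"
  have "level (disc_twist C z) = ((sin a)\<^sup>2 + (cos a)\<^sup>2) * level z"
    unfolding level_def disc_twist_def Let_def a_def[symmetric]
    by (simp add: power2_eq_square algebra_simps
          del: sin_cos_squared_add sin_cos_squared_add2 sin_cos_squared_add3)
  then show ?thesis by simp
qed

lemma disc_twist_ident: "level z \<ge> 1 \<Longrightarrow> disc_twist C z = z"
  by (simp add: disc_twist_def twist_angle_def flat_exp_def)

lemma disc_twist_inverse: "disc_twist (- C) (disc_twist C z) = z"
proof -
  define a where "a = twist_angle C z"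
  have 1: "twist_angle (- C) (disc_twist C z) = - a"
    by (simp add: a_def twist_angle_def level_disc_twist)
  have 2: "disc_twist C z = (cos a * fst z - sin a * snd z / 3, sin a * (3 * fst z) + cos a * snd z)"
    by (simp add: disc_twist_def a_def Let_def)
  have sq: "sin a * sin a = 1 - cos a * cos a"
    using sin_squared_eq[of a] by (simp add: power2_eq_square)
  have "disc_twist (- C) (disc_twist C z) = (cos (-a) * fst (disc_twist C z) - sin (-a) * snd (disc_twist C z) / 3,
     sin (-a) * (3 * fst (disc_twist C z)) + cos (-a) * snd (disc_twist C z))"
    unfolding disc_twist_def[of "- C"] 1 Let_def ..
  also have "\<dots> = z" unfolding 2
    by (rule prod_eqI) (simp add: field_simps, use sq in algebra)+
  finally show ?thesis .
qed

lemma level_ge_one: "\<bar>fst z\<bar> \<ge> 1 / 3 \<Longrightarrow> level z \<ge> 1"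
proof -
  assume "\<bar>fst z\<bar> \<ge> 1 / 3"
  then have "(1 / 3)\<^sup>2 \<le> \<bar>fst z\<bar>\<^sup>2" by (intro power_mono) auto
  then show ?thesis by (simp add: level_def power2_eq_square) (smt (verit) zero_le_square)
qed

text \<open>
  The ellipse around \<open>n\<close> reaches up to distance 1/3, the neighbouring ellipses begin at distance 2/3.
  So around each point one formula holds on a whole neighbourhood, also at the jumps of \<open>round\<close>.
\<close>

lemma twist_eq:
  assumes "\<bar>fst z - of_int n\<bar> < 2 / 3"
  shows "twist C z = disc_twist C (fst z - of_int n, snd z) + (of_int n, 0)"
proof (cases "round (fst z) = n")
  case True
  then show ?thesis by (simp add: twist_def Let_def)
next
  case False
  have r: "\<bar>fst z - of_int (round (fst z))\<bar> \<le> 1 / 2"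
    using of_int_round_abs_le[of "fst z"] by (simp add: abs_minus_commute)
  have "\<bar>real_of_int (round (fst z)) - of_int n\<bar> \<ge> 1"
    using False by linarith
  then have "\<bar>fst z - of_int n\<bar> \<ge> 1 / 3" "\<bar>fst z - of_int (round (fst z))\<bar> \<ge> 1 / 3"
    using assms r by linarith+
  then show ?thesis unfolding twist_def Let_def
    by (subst (1 2) disc_twist_ident) (auto intro!: level_ge_one prod_eqI)
qed

lemma twist_add_int: "twist C (z + (of_int n, 0)) = twist C z + (of_int n, 0)"
proof -
  have "round (fst z + of_int n) = round (fst z) + n"
    unfolding round_def floor_add_int by (simp add: algebra_simps)
  then show ?thesis by (simp add: twist_def Let_def prod_eq_iff)
qed

lemma twist_inverse: "twist (- C) (twist C z) = z"
proof -
  define n where "n = round (fst z)"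
  define w where "w = (fst z - of_int n, snd z)"
  have r: "\<bar>fst w\<bar> \<le> 1 / 2"
    using of_int_round_abs_le[of "fst z"] by (simp add: w_def n_def abs_minus_commute)
  have t: "twist C z = disc_twist C w + (of_int n, 0)"
    by (simp add: twist_def n_def w_def Let_def)
  have "\<bar>fst (disc_twist C w)\<bar> < 2 / 3"
  proof (cases "level w \<ge> 1")
    case True
    then show ?thesis using r by (simp add: disc_twist_ident)
  next
    case False
    then show ?thesis using level_ge_one[of "disc_twist C w"] unfolding level_disc_twist by linarith
  qed
  then have "twist (- C) (twist C z) = disc_twist (- C) (disc_twist C w) + (of_int n, 0)"
    unfolding t by (subst twist_eq[where n=n]) auto
  also have "\<dots> = z" by (simp add: disc_twist_inverse w_def prod_eq_iff)
  finally show ?thesis .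
qed

lemma abs_snd_disc_twist_le:
  assumes "\<bar>snd z\<bar> \<le> 1" shows "\<bar>snd (disc_twist C z)\<bar> \<le> 1"
proof (cases "level z \<ge> 1")
  case True
  then show ?thesis using assms by (simp add: disc_twist_ident)
next
  case False
  then have "(snd (disc_twist C z))\<^sup>2 \<le> 1"
    using level_disc_twist[of C z] unfolding level_def by (smt (verit) zero_le_power2)
  then show ?thesis by (simp add: abs_square_le_1)
qed

lemma twist_strip: "z \<in> strip \<Longrightarrow> twist C z \<in> strip"
  using abs_snd_disc_twist_le[of "(fst z - of_int (round (fst z)), snd z)" C]
  by (auto simp: strip_def twist_def Let_def mem_Times_iff abs_le_iff)

lemma twist_boundary: "\<bar>snd z\<bar> = 1 \<Longrightarrow> twist C z = z"
proof -
  assume "\<bar>snd z\<bar> = 1"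
  then have "(snd z)\<^sup>2 = 1" by (metis power2_abs power_one)
  then have "level (fst z - of_int (round (fst z)), snd z) \<ge> 1" by (simp add: level_def)
  then show ?thesis by (simp add: twist_def disc_twist_ident Let_def prod_eq_iff)
qed

text \<open>
  Points at level \<open>s\<close> on the horizontal line at height \<open>y\<close> lie on the circle of radius \<open>sqrt s\<close> (in the
  coordinates \<open>(3 * x, y)\<close>). As \<open>s\<close> decreases from 1 to \<open>s0\<close>, the twist angle grows from 0 to a full turn
  while the polar angle \<open>arcsin (y / sqrt s)\<close> stays between \<open>- pi / 2\<close> and \<open>pi / 2\<close>; so for some \<open>s\<close> the
  image has polar angle \<open>pi / 2\<close>, which puts it at height \<open>sqrt s\<close>.
\<close>

lemma twist_reaches_boundary:
  assumes "0 < \<epsilon>" "\<epsilon> < 1"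
  obtains C where "\<And>y. \<bar>y\<bar> \<le> 1 \<Longrightarrow> \<exists>x. \<bar>snd (twist C (x, y))\<bar> \<ge> 1 - \<epsilon>"
proof -
  define s0 where "s0 = (1 - \<epsilon>)\<^sup>2"
  have s0: "0 < s0" "s0 < 1"
    using assms unfolding s0_def by (auto simp: power2_eq_square intro: mult_left_le_one_le le_less_trans)
     (smt (verit) mult_less_cancel_left2)
  \<comment> \<open>A full turn at level \<open>s0\<close>.\<close>
  define C where "C = 2 * pi / flat_exp 0 (1 - s0)"
  have pos: "flat_exp 0 (1 - s0) > 0" using s0 by (simp add: flat_exp_def)
  have "\<exists>x. \<bar>snd (twist C (x, y))\<bar> \<ge> 1 - \<epsilon>" if y: "\<bar>y\<bar> \<le> 1" for y
  proof (cases "\<bar>y\<bar> \<ge> 1 - \<epsilon>")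
    case True
    \<comment> \<open>Midway between two ellipses the twist is the identity.\<close>
    have "disc_twist C (1 / 2 - of_int (round (1 / 2 :: real)), y) = (1 / 2 - of_int (round (1 / 2 :: real)), y)"
      by (intro disc_twist_ident level_ge_one) (simp add: round_def)
    then show ?thesis using True by (intro exI[of _ "1 / 2"]) (simp add: twist_def Let_def)
  next
    case False
    have y2: "y\<^sup>2 < s0" using False assms unfolding s0_def
      by (metis abs_le_square_iff abs_of_nonneg diff_ge_0_iff_ge less_eq_real_def not_le)
    define \<psi> where "\<psi> s = C * flat_exp 0 (1 - s) + arcsin (y / sqrt s)" for s
    have frac: "\<bar>y / sqrt s\<bar> \<le> 1" if "s \<ge> s0" for s
    proof -
      have "\<bar>y\<bar> \<le> sqrt s" using y2 that by (metis order.strict_implies_order order_trans real_sqrt_abs real_sqrt_le_iff)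
      then show ?thesis using that s0 by (simp add: field_simps)
    qed
    have "continuous_on UNIV (flat_exp 0)"
      using tame_flat_exp tame_uniformly_continuous uniformly_continuous_imp_continuous by blast
    then have c1: "continuous_on {s0..1} (\<lambda>s. flat_exp 0 (1 - s))"
      by (rule continuous_on_compose2) (auto intro!: continuous_intros)
    have "continuous_on {s0..1} (\<lambda>s. y / sqrt s)"
      using s0 by (intro continuous_on_divide continuous_on_const continuous_on_real_sqrt continuous_on_id) auto
    then have "continuous_on {s0..1} (\<lambda>s. arcsin (y / sqrt s))"
    proof (rule continuous_on_arcsin, intro ballI)
      fix s assume "s \<in> {s0..1}"
      then show "- 1 \<le> y / sqrt s \<and> y / sqrt s \<le> 1" using frac[of s] by (simp only: abs_le_iff) auto
    qed
    then have "continuous_on {s0..1} \<psi>"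
      unfolding \<psi>_def by (intro continuous_on_add continuous_on_mult continuous_on_const c1)
    moreover have "\<psi> 1 \<le> pi / 2" unfolding \<psi>_def using frac[of 1] s0 arcsin_ubound[of "y / sqrt 1"]
      by (auto simp: flat_exp_def abs_le_iff)
    moreover have "pi / 2 \<le> \<psi> s0"
    proof -
      have "- 1 \<le> y / sqrt s0" "y / sqrt s0 \<le> 1" using frac[of s0] by (simp_all only: abs_le_iff) auto
      then have "- (pi / 2) \<le> arcsin (y / sqrt s0)" by (rule arcsin_lbound)
      moreover have "C * flat_exp 0 (1 - s0) = 2 * pi" using pos by (simp add: C_def)
      ultimately show ?thesis unfolding \<psi>_def using pi_gt_zero by linarith
    qed
    ultimately obtain s where s: "s0 \<le> s" "s \<le> 1" "\<psi> s = pi / 2"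
      using IVT2'[of \<psi> 1 "pi / 2" s0] s0 by auto
    define U where "U = sqrt (s - y\<^sup>2)"
    define \<theta> where "\<theta> = arcsin (y / sqrt s)"
    have sp: "s > 0" using s s0 by simp
    have fr: "- 1 \<le> y / sqrt s" "y / sqrt s \<le> 1" using frac[OF s(1)] by (simp_all only: abs_le_iff) auto
    have sin\<theta>: "sqrt s * sin \<theta> = y" using sp by (simp add: \<theta>_def sin_arcsin[OF fr])
    have cos\<theta>: "sqrt s * cos \<theta> = U"
    proof -
      have "cos \<theta> = sqrt (1 - (y / sqrt s)\<^sup>2)" unfolding \<theta>_def
        by (rule cos_arcsin[OF fr])
      also have "1 - (y / sqrt s)\<^sup>2 = (s - y\<^sup>2) / s" using sp by (simp add: field_simps)
      finally show ?thesis using sp by (simp add: U_def real_sqrt_divide)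
    qed
    have U2: "U\<^sup>2 = s - y\<^sup>2" using y2 s by (simp add: U_def)
    have lev: "level (U / 3, y) = s" using U2 by (simp add: level_def power_divide field_simps)
    have U1: "\<bar>U / 3\<bar> \<le> 1 / 3"
    proof -
      have "U\<^sup>2 \<le> 1" using U2 s(2) zero_le_power2[of y] by linarith
      then show ?thesis by (simp add: abs_square_le_1)
    qed
    define a where "a = twist_angle C (U / 3, y)"
    have a: "a + \<theta> = pi / 2" using s(3) by (simp add: a_def twist_angle_def lev \<psi>_def \<theta>_def)
    have "snd (twist C (U / 3, y)) = sin a * U + cos a * y"
      using U1 by (subst twist_eq[where n=0]) (auto simp: disc_twist_def Let_def a_def)
    also have "\<dots> = sqrt s * sin (a + \<theta>)" unfolding sin\<theta>[symmetric] cos\<theta>[symmetric] sin_add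
      by (simp add: algebra_simps)
    also have "\<dots> = sqrt s" by (simp add: a)
    finally have "snd (twist C (U / 3, y)) = sqrt s" .
    moreover have "sqrt s \<ge> 1 - \<epsilon>" using s(1) assms unfolding s0_def by (simp add: real_le_rsqrt)
    ultimately show ?thesis using sp by (intro exI[of _ "U / 3"]) simp
  qed
  then show ?thesis using that by blast
qed

lemma tame_fst: "tame fst S" and tame_snd: "tame snd S"
  by (simp_all add: tame_linear bounded_linear_fst bounded_linear_snd)

text \<open>
  The twist is tame because it is periodic and tame on one period: on the bounded set \<open>cell\<close> it is made of
  bounded tame functions. The cell overlaps its translates, and both it and \<open>wide_strip\<close> are open, so
  that derivatives are unique and can be compared locally.
\<close>

definition cell :: "plane set" where
  "cell = {- 2 / 3<..<2 / 3} \<times> {- 2<..<2}"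

lemma bounded_cell: "bounded cell"
  unfolding cell_def by (intro bounded_Times) auto

lemma tame_disc_twist: "tame (disc_twist C) cell"
proof -
  have b: "bounded (fst ` cell)" "bounded (snd ` cell)"
    using bounded_cell by (auto intro: bounded_linear_image bounded_linear_fst bounded_linear_snd)
  have bc: "bounded ((\<lambda>z. c z * d z) ` cell)" if "bounded (c ` cell)" "bounded (d ` cell)"
    for c d :: "plane \<Rightarrow> real"
    using bounded_scaleR_image[OF that] by simp
  have trig: "bounded ((\<lambda>z. cos (f z)) ` cell)" "bounded ((\<lambda>z. sin (f z)) ` cell)" for f :: "plane \<Rightarrow> real"
    unfolding bounded_iff by (auto intro!: exI[of _ 1])
  have "tame (\<lambda>z. 9 * (fst z * fst z) + snd z * snd z) cell"
    by (intro tame_add tame_bounded_linear[OF bounded_linear_mult_right] tame_mult b tame_fst tame_snd)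
  then have lev: "tame level cell"
    by (rule tame_cong) (simp add: level_def power2_eq_square)
  have "tame (\<lambda>z. flat_exp 0 (1 - level z)) cell"
    by (rule tame_compose[OF tame_flat_exp tame_diff[OF tame_const lev]]) simp
  then have a: "tame (twist_angle C) cell"
    unfolding twist_angle_def by (rule tame_bounded_linear[OF bounded_linear_mult_right])
  have cs: "tame (\<lambda>z. cos (twist_angle C z)) cell" "tame (\<lambda>z. sin (twist_angle C z)) cell"
    by (rule tame_compose[OF tame_cos a] tame_compose[OF tame_sin a]; simp)+
  have "tame (\<lambda>z. (cos (twist_angle C z) * fst z - (1 / 3) * (sin (twist_angle C z) * snd z),
       3 * (sin (twist_angle C z) * fst z) + cos (twist_angle C z) * snd z)) cell"
    by (intro tame_Pair tame_add tame_diff tame_bounded_linear[OF bounded_linear_mult_right] tame_mult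
        b cs trig tame_fst tame_snd)
  then show ?thesis by (rule tame_cong) (simp add: disc_twist_def Let_def)
qed

definition periodize :: "(plane \<Rightarrow> 'b) \<Rightarrow> plane \<Rightarrow> 'b" where
  "periodize f z = f (fst z - of_int (round (fst z)), snd z)"

definition wide_strip :: "plane set" where
  "wide_strip = UNIV \<times> {- 2<..<2}"

lemma in_cell: "z \<in> wide_strip \<Longrightarrow> \<bar>fst z - of_int n\<bar> < 2 / 3 \<Longrightarrow> (fst z - of_int n, snd z) \<in> cell"
proof -
  assume z: "z \<in> wide_strip" "\<bar>fst z - of_int n\<bar> < 2 / 3"
  then have "- 2 / 3 < fst z - of_int n" "fst z - of_int n < 2 / 3" by linarith+
  then show ?thesis using z(1) by (auto simp: cell_def wide_strip_def)
qed

lemma periodize_eq: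
  fixes f :: "plane \<Rightarrow> 'b::zero"
  assumes f: "\<And>z. z \<in> cell \<Longrightarrow> \<bar>fst z\<bar> > 1 / 3 \<Longrightarrow> f z = 0"
    and z: "z \<in> wide_strip" "\<bar>fst z - of_int n\<bar> < 2 / 3"
  shows "periodize f z = f (fst z - of_int n, snd z)"
proof (cases "round (fst z) = n")
  case True
  then show ?thesis by (simp add: periodize_def)
next
  case False
  have r: "\<bar>fst z - of_int (round (fst z))\<bar> \<le> 1 / 2"
    using of_int_round_abs_le[of "fst z"] by (simp add: abs_minus_commute)
  have "\<bar>real_of_int (round (fst z)) - of_int n\<bar> \<ge> 1"
    using False by linarith
  then have "\<bar>fst z - of_int n\<bar> > 1 / 3" "\<bar>fst z - of_int (round (fst z))\<bar> > 1 / 3"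
    using z r by linarith+
  then have "f (fst z - of_int n, snd z) = 0" "f (fst z - of_int (round (fst z)), snd z) = 0"
    using r z in_cell[of z] by (auto intro!: f)
  then show ?thesis by (simp add: periodize_def)
qed

text \<open>
  A function on the cell that vanishes off the middle part extends periodically, and so do its partial
  derivatives, which vanish there as well. Hence the induction on the order goes through.
\<close>

lemma Cconv_periodize:
  fixes f :: "plane \<Rightarrow> 'b::real_normed_vector"
  shows "Cconv m (\<lambda>_. f) cell \<Longrightarrow> (\<And>z. z \<in> cell \<Longrightarrow> \<bar>fst z\<bar> > 1 / 3 \<Longrightarrow> f z = 0) \<Longrightarrow>
    Cconv m (\<lambda>_. periodize f) wide_strip"
proof (induction m arbitrary: f)
  have r: "\<bar>fst z - of_int (round (fst z))\<bar> \<le> 1 / 2" for z :: "plane"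
    using of_int_round_abs_le[of "fst z"] by (simp add: abs_minus_commute)
  have base: "uniformly_continuous_on wide_strip (periodize f)"
    if uc: "uniformly_continuous_on cell f" and f: "\<And>z. z \<in> cell \<Longrightarrow> \<bar>fst z\<bar> > 1 / 3 \<Longrightarrow> f z = 0"
    for f :: "plane \<Rightarrow> 'b"
    unfolding uniformly_continuous_on_def
  proof (intro allI impI)
    fix e :: real assume "e > 0"
    then obtain d where d: "d > 0" "\<And>x y. x \<in> cell \<Longrightarrow> y \<in> cell \<Longrightarrow> dist y x < d \<Longrightarrow> dist (f y) (f x) < e"
      using uc unfolding uniformly_continuous_on_def by metis
    have "dist (periodize f y) (periodize f x) < e"
      if xy: "x \<in> wide_strip" "y \<in> wide_strip" "dist y x < min d (1 / 6)" for x y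
    proof -
      define n where "n = round (fst x)"
      have "dist (fst y) (fst x) \<le> dist y x" by (rule dist_fst_le)
      then have "\<bar>fst y - fst x\<bar> < 1 / 6" using xy(3) by (simp add: dist_real_def)
      then have n: "\<bar>fst x - of_int n\<bar> < 2 / 3" "\<bar>fst y - of_int n\<bar> < 2 / 3"
        using r[of x] unfolding n_def by linarith+
      have "dist (fst y - of_int n, snd y) (fst x - of_int n, snd x) = dist y x"
        by (simp add: dist_prod_def dist_real_def)
      then have "dist (f (fst y - of_int n, snd y)) (f (fst x - of_int n, snd x)) < e"
        using xy n by (intro d(2) in_cell) auto
      then show ?thesis using periodize_eq[OF f xy(1) n(1)] periodize_eq[OF f xy(2) n(2)] by simp
    qed
    then show "\<exists>d>0. \<forall>x\<in>wide_strip. \<forall>x'\<in>wide_strip. dist x' x < d \<longrightarrow>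
        dist (periodize f x') (periodize f x) < e"
      using d(1) by (intro exI[of _ "min d (1 / 6)"]) auto
  qed
  {
    case 0
    then show ?case using base by (simp add: uconv_const)
  next
    case (Suc m)
    note f0 = Suc.prems(2)
    from Suc.prems(1) obtain F' where F': "uniformly_continuous_on cell f"
      "\<forall>i::enat. \<forall>x\<in>cell. (f has_derivative F' i x) (at x within cell)"
      "\<forall>b\<in>Basis. (\<forall>i. bounded ((\<lambda>x. F' i x b) ` cell)) \<and> Cconv m (\<lambda>i x. F' i x b) cell"
      unfolding Cconv.simps uconv_const by blast
    have opc: "open cell" and opw: "open wide_strip"
      unfolding cell_def wide_strip_def by (auto intro: open_Times)
    define f' where "f' = F' \<infinity>"
    have d: "(f has_derivative f' x) (at x)" if "x \<in> cell" for x
      using F'(2)[rule_format, OF that, of \<infinity>] unfolding f'_def at_within_open[OF that opc] .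
    have Cf': "Cconv m (\<lambda>_ x. f' x b) cell" if "b \<in> Basis" for b
      using Cconv_fixed[of m "\<lambda>i x. F' i x b" cell \<infinity>] F'(3) that by (simp add: f'_def)
    have f'0: "f' z = (\<lambda>_. 0)" if z: "z \<in> cell" "\<bar>fst z\<bar> > 1 / 3" for z
    proof -
      define U where "U = cell \<inter> {z. \<bar>fst z\<bar> > 1 / 3}"
      have "open U" unfolding U_def
        by (intro open_Int opc open_Collect_less continuous_intros)
      moreover have "f w = 0" if "w \<in> U" for w using f0 that by (auto simp: U_def)
      ultimately have "(f has_derivative (\<lambda>_. 0)) (at z)"
        using z by (intro has_derivative_transform_within_open[OF has_derivative_const, of U]) (auto simp: U_def)
      then show ?thesis using has_derivative_unique[OF d[OF z(1)]] by metis
    qed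
    have dp: "(periodize f has_derivative periodize f' z) (at z within wide_strip)"
      if z: "z \<in> wide_strip" for z
    proof -
      define n where "n = round (fst z)"
      define w where "w = (fst z - of_int n, snd z)"
      have nz: "\<bar>fst z - of_int n\<bar> < 2 / 3" using r[of z] unfolding n_def by linarith
      then have w: "w \<in> cell" using in_cell[OF z] by (simp add: w_def)
      define U where "U = wide_strip \<inter> {z. \<bar>fst z - of_int n\<bar> < 2 / 3}"
      have oU: "open U" unfolding U_def
        by (intro open_Int opw open_Collect_less continuous_intros)
      have sh: "((\<lambda>z. z - (of_int n, 0)) has_derivative (\<lambda>h. h)) (at z)"
        by (auto intro!: derivative_eq_intros)
      have zw: "z - (of_int n, 0) = w" by (simp add: w_def prod_eq_iff)
      have "((\<lambda>z. f (z - (of_int n, 0))) has_derivative (\<lambda>h. f' w h)) (at z)"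
        by (rule has_derivative_compose[OF sh]) (use d[OF w] zw in simp)
      then have "(periodize f has_derivative (\<lambda>h. f' w h)) (at z)"
      proof (rule has_derivative_transform_within_open[OF _ oU])
        show "z \<in> U" using z nz by (simp add: U_def)
        fix y assume "y \<in> U"
        then have "periodize f y = f (fst y - of_int n, snd y)"
          by (intro periodize_eq f0) (auto simp: U_def)
        moreover have "y - (of_int n, 0) = (fst y - of_int n, snd y)" by (simp add: prod_eq_iff)
        ultimately show "f (y - (of_int n, 0)) = periodize f y" by simp
      qed
      moreover have "periodize f' z = f' w" by (simp add: periodize_def w_def n_def)
      ultimately show ?thesis by (auto intro: has_derivative_at_withinI)
    qed
    have bp: "bounded ((\<lambda>z. periodize f' z b) ` wide_strip)" if "b \<in> Basis" for b
    proof (rule bounded_subset)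
      show "bounded ((\<lambda>x. f' x b) ` cell)" using F'(3) that by (auto simp: f'_def)
      show "(\<lambda>z. periodize f' z b) ` wide_strip \<subseteq> (\<lambda>x. f' x b) ` cell"
      proof (rule image_subsetI)
        fix z assume z: "z \<in> wide_strip"
        have "(fst z - of_int (round (fst z)), snd z) \<in> cell"
          using r[of z] by (intro in_cell[OF z]) linarith
        then show "periodize f' z b \<in> (\<lambda>x. f' x b) ` cell" by (auto simp: periodize_def)
      qed
    qed
    have Cp: "Cconv m (\<lambda>_ z. periodize f' z b) wide_strip" if "b \<in> Basis" for b
      using Suc.IH[OF Cf'[OF that]] f'0 by (simp add: periodize_def[abs_def])
    show ?case unfolding Cconv.simps uconv_const
      using base[OF F'(1) f0] dp bp Cp
      by (intro conjI exI[of _ "\<lambda>_. periodize f'"]) auto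
  }
qed

lemma tame_twist: "tame (twist C) strip"
proof -
  define f where "f z = disc_twist C z - z" for z
  have f0: "f z = 0" if "\<bar>fst z\<bar> > 1 / 3" for z
    using disc_twist_ident[OF level_ge_one[of z]] that by (simp add: f_def)
  have "tame f cell" unfolding f_def
    by (intro tame_diff tame_disc_twist tame_linear bounded_linear_ident)
  then have "tame (periodize f) wide_strip"
    using f0 unfolding tame_def by (auto intro: Cconv_periodize)
  then have "tame (\<lambda>z. z + periodize f z) strip"
    by (intro tame_add[OF tame_linear[OF bounded_linear_ident] tame_subset])
       (auto simp: strip_def wide_strip_def)
  then show ?thesis
    by (rule tame_cong) (simp add: f_def periodize_def twist_def Let_def prod_eq_iff)
qed

section \<open>Rescaling the horizontal direction\<close>

definition slab :: "timed set" where
  "slab = {0..1} \<times> strip"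

definition squeeze :: "real \<Rightarrow> plane \<Rightarrow> plane" where
  "squeeze q z = (q * fst z, snd z)"

definition scaled :: "real \<Rightarrow> real \<Rightarrow> timed \<Rightarrow> timed" where
  "scaled c q z = (c * fst z, squeeze q (snd z))"

lemma bounded_linear_squeeze: "bounded_linear (squeeze q)"
  unfolding squeeze_def[abs_def]
  by (rule bounded_linear_Pair[OF bounded_linear_const_mult[OF bounded_linear_fst] bounded_linear_snd])

lemma bounded_linear_scaled: "bounded_linear (scaled c q)"
  unfolding scaled_def[abs_def]
  by (rule bounded_linear_Pair[OF bounded_linear_const_mult[OF bounded_linear_fst]
        bounded_linear_compose[OF bounded_linear_squeeze bounded_linear_snd]])

text \<open>
  The time of \<open>slab\<close> multiplied by \<open>q * d\<close> may become negative, hence the symmetric interval.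
\<close>

definition thick_slab :: "timed set" where
  "thick_slab = {- 1..1} \<times> strip"

lemma scaled_slab: "\<bar>c\<bar> \<le> 1 \<Longrightarrow> scaled c q ` slab \<subseteq> thick_slab"
proof
  fix w assume c: "\<bar>c\<bar> \<le> 1" and "w \<in> scaled c q ` slab"
  then obtain t x y where z: "w = (c * t, (q * x, y))" "0 \<le> t" "t \<le> 1" "(x, y) \<in> strip"
    unfolding scaled_def slab_def squeeze_def by fastforce
  have "\<bar>c * t\<bar> \<le> 1 * 1" unfolding abs_mult using c z by (intro mult_mono) auto
  then show "w \<in> thick_slab" using z by (auto simp: thick_slab_def strip_def abs_le_iff)
qed

lemma prod3_Basis: "b \<in> (Basis :: timed set) \<longleftrightarrow> b = (1, 0, 0) \<or> b = (0, 1, 0) \<or> b = (0, 0, 1)"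
  by (auto simp: Basis_prod_def zero_prod_def)

text \<open>The basis vectors are eigenvectors of \<open>scaled c q\<close>; these are the eigenvalues.\<close>

definition scale_of :: "real \<Rightarrow> real \<Rightarrow> timed \<Rightarrow> real" where
  "scale_of c q b = (if b = (1, 0, 0) then c else if b = (0, 1, 0) then q else 1)"

lemma scaled_Basis: "b \<in> Basis \<Longrightarrow> scaled c q b = scale_of c q b *\<^sub>R b"
  unfolding prod3_Basis by (elim disjE) (simp_all add: scaled_def scale_of_def squeeze_def)

definition rescaled :: "(nat \<Rightarrow> real) \<Rightarrow> (nat \<Rightarrow> real) \<Rightarrow> (nat \<Rightarrow> real) \<Rightarrow>
    (timed \<Rightarrow> 'b::real_normed_vector) \<Rightarrow> enat \<Rightarrow> timed \<Rightarrow> 'b" where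
  "rescaled A c q e i z = (case i of enat n \<Rightarrow> A n *\<^sub>R e (scaled (c n) (q n) z) | \<infinity> \<Rightarrow> 0)"

lemma rescaled_simps [simp]:
  "rescaled A c q e (enat n) z = A n *\<^sub>R e (scaled (c n) (q n) z)"
  "rescaled A c q e \<infinity> z = 0"
  by (simp_all add: rescaled_def)

lemma uconv_rescaled:
  assumes uc: "uniformly_continuous_on thick_slab e" and c: "\<And>n. \<bar>c n\<bar> \<le> 1"
    and le: "\<And>n z. z \<in> slab \<Longrightarrow> norm (A n *\<^sub>R e (scaled (c n) (q n) z)) \<le> r n" and r: "r \<longlonglongrightarrow> 0"
  shows "uconv (rescaled A c q e) slab"
  unfolding uconv_def
proof (intro conjI allI)
  fix i
  show "uniformly_continuous_on slab (rescaled A c q e i)"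
  proof (cases i)
    case (enat n)
    have "uniformly_continuous_on slab (scaled (c n) (q n))"
      by (rule bounded_linear.uniformly_continuous_on[OF bounded_linear_scaled uniformly_continuous_on_id])
    moreover have "uniformly_continuous_on (scaled (c n) (q n) ` slab) e"
      using uniformly_continuous_on_subset[OF uc scaled_slab[OF c]] .
    ultimately have "uniformly_continuous_on slab (\<lambda>z. e (scaled (c n) (q n) z))"
      by (rule uniformly_continuous_on_compose)
    then have "uniformly_continuous_on slab (\<lambda>z. A n *\<^sub>R e (scaled (c n) (q n) z))"
      by (rule bounded_linear.uniformly_continuous_on[OF bounded_linear_scaleR_right])
    then show ?thesis using enat by (simp add: rescaled_def[abs_def])
  next
    case infinity
    then show ?thesis by (simp add: rescaled_def[abs_def] uniformly_continuous_on_const)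
  qed
next
  show "uniform_limit slab (\<lambda>n. rescaled A c q e (enat n)) (rescaled A c q e \<infinity>) sequentially"
    unfolding uniform_limit_iff
  proof (intro allI impI)
    fix \<epsilon> :: real assume "\<epsilon> > 0"
    then have "\<forall>\<^sub>F n in sequentially. r n < \<epsilon>" using r by (rule order_tendstoD(2)[rotated])
    then show "\<forall>\<^sub>F n in sequentially. \<forall>x\<in>slab.
        dist (rescaled A c q e (enat n) x) (rescaled A c q e \<infinity> x) < \<epsilon>"
    proof eventually_elim
      case (elim n)
      then show ?case using le[of _ n] by (force simp: dist_norm)
    qed
  qed
qed

lemma rescaled_has_derivative:
  assumes d: "\<And>x. x \<in> thick_slab \<Longrightarrow> (e has_derivative e' x) (at x within thick_slab)"
    and c: "\<And>n. \<bar>c n\<bar> \<le> 1" and z: "z \<in> slab"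
  shows "(rescaled A c q e i has_derivative
     (\<lambda>h. case i of enat n \<Rightarrow> A n *\<^sub>R e' (scaled (c n) (q n) z) (scaled (c n) (q n) h) | \<infinity> \<Rightarrow> 0)) (at z within slab)"
proof (cases i)
  case (enat n)
  have "((\<lambda>z. e (scaled (c n) (q n) z)) has_derivative
      (\<lambda>h. e' (scaled (c n) (q n) z) (scaled (c n) (q n) h))) (at z within slab)"
    by (rule has_derivative_in_compose2[OF d scaled_slab[OF c] z
          bounded_linear_imp_has_derivative[OF bounded_linear_scaled]])
  from has_derivative_scaleR_right[OF this] show ?thesis using enat
    by (simp add: rescaled_def[abs_def])
next
  case infinity
  then show ?thesis by (simp add: rescaled_def[abs_def])
qed

lemma tendsto_zero_dominated:
  fixes f g :: "nat \<Rightarrow> real"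
  assumes "g \<longlonglongrightarrow> 0" "\<And>n. \<bar>f n\<bar> \<le> \<bar>g n\<bar>" shows "f \<longlonglongrightarrow> 0"
  by (rule tendsto_0_le[OF assms(1), where K=1]) (use assms(2) in \<open>simp add: always_eventually\<close>)

text \<open>
  A partial derivative of a rescaled family is the rescaled family of a partial derivative, with the
  amplitude multiplied by an eigenvalue.
\<close>

lemma Cconv_rescaled_step:
  fixes e :: "timed \<Rightarrow> 'b::real_normed_vector"
  assumes u: "uconv (rescaled A c q e) slab"
    and d: "\<And>x. x \<in> thick_slab \<Longrightarrow> (e has_derivative e' x) (at x within thick_slab)"
    and b: "\<And>b. b \<in> Basis \<Longrightarrow> bounded ((\<lambda>x. e' x b) ` thick_slab)"
    and c: "\<And>n. \<bar>c n\<bar> \<le> 1"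
    and C: "\<And>b. b \<in> Basis \<Longrightarrow>
      Cconv m (rescaled (\<lambda>n. A n * scale_of (c n) (q n) b) c q (\<lambda>x. e' x b)) slab"
  shows "Cconv (Suc m) (rescaled A c q e) slab"
proof -
  let ?D = "\<lambda>i z h. case i of enat n \<Rightarrow> A n *\<^sub>R e' (scaled (c n) (q n) z) (scaled (c n) (q n) h) | \<infinity> \<Rightarrow> 0"
  have eq: "?D i z b = rescaled (\<lambda>n. A n * scale_of (c n) (q n) b) c q (\<lambda>x. e' x b) i z"
    if "b \<in> Basis" "z \<in> slab" for i z b
  proof (cases i)
    case (enat n)
    have "scaled (c n) (q n) z \<in> thick_slab" using scaled_slab[OF c] that(2) by blast
    from has_derivative_linear[OF d[OF this]] interpret linear "e' (scaled (c n) (q n) z)" .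
    show ?thesis using enat scaled_Basis[OF that(1)] by (simp add: scale)
  qed simp
  have bd: "bounded ((\<lambda>z. rescaled (\<lambda>n. A n * scale_of (c n) (q n) b) c q (\<lambda>x. e' x b) i z) ` slab)"
    if "b \<in> Basis" for i b
  proof (cases i)
    case (enat n)
    have "bounded ((\<lambda>x. e' x b) ` scaled (c n) (q n) ` slab)"
      using bounded_subset[OF b[OF that] image_mono[OF scaled_slab[OF c]]] .
    then have "bounded ((\<lambda>v. (A n * scale_of (c n) (q n) b) *\<^sub>R v) ` (\<lambda>x. e' x b) ` scaled (c n) (q n) ` slab)"
      by (rule bounded_scaling)
    then show ?thesis using enat by (simp add: image_image)
  qed (simp add: bounded_const_image)
  show ?thesis unfolding Cconv.simps
  proof (intro conjI exI[of _ ?D] allI ballI)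
    show "uconv (rescaled A c q e) slab" by (rule u)
  next
    fix i z assume "z \<in> slab"
    then show "(rescaled A c q e i has_derivative ?D i z) (at z within slab)"
      by (intro rescaled_has_derivative d c)
  next
    fix b :: "timed" and i assume bb: "b \<in> Basis"
    have "(\<lambda>x. ?D i x b) ` slab = (\<lambda>z. rescaled (\<lambda>n. A n * scale_of (c n) (q n) b) c q (\<lambda>x. e' x b) i z) ` slab"
      using eq[OF bb] by (intro image_cong) auto
    then show "bounded ((\<lambda>x. ?D i x b) ` slab)" using bd[OF bb] by simp
  next
    fix b :: "timed" assume bb: "b \<in> Basis"
    show "Cconv m (\<lambda>i x. ?D i x b) slab"
      by (rule Cconv_cong[OF _ C[OF bb]]) (simp only: eq[OF bb])
  qed
qed

text \<open>
  Each differentiation costs a factor of at most \<open>q n\<close>, so \<open>m\<close> derivatives of a bounded tame map are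
  controlled by an amplitude that beats \<open>q n ^ m\<close>.
\<close>

lemma Cconv_rescaled_bounded:
  fixes e :: "timed \<Rightarrow> 'b::real_normed_vector"
  assumes c: "\<And>n. \<bar>c n\<bar> \<le> 1" and q: "\<And>n. q n \<ge> 1"
  shows "Cconv m (\<lambda>_. e) thick_slab \<Longrightarrow> bounded (e ` thick_slab) \<Longrightarrow>
    (\<lambda>n. A n * q n ^ m) \<longlonglongrightarrow> 0 \<Longrightarrow> Cconv m (rescaled A c q e) slab"
proof (induction m arbitrary: e A)
  have base: "uconv (rescaled A c q e) slab"
    if e: "uniformly_continuous_on thick_slab e" "bounded (e ` thick_slab)" and A: "A \<longlonglongrightarrow> 0"
    for e :: "timed \<Rightarrow> 'b" and A
  proof -
    obtain B where B: "B > 0" "\<And>x. x \<in> thick_slab \<Longrightarrow> norm (e x) \<le> B"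
      using e(2) unfolding bounded_pos by auto
    have "norm (A n *\<^sub>R e (scaled (c n) (q n) z)) \<le> \<bar>A n\<bar> * B" if "z \<in> slab" for n z
      unfolding norm_scaleR using that by (intro mult_left_mono B(2) subsetD[OF scaled_slab[OF c]]) auto
    moreover have "(\<lambda>n. \<bar>A n\<bar> * B) \<longlonglongrightarrow> 0"
      using tendsto_mult[OF tendsto_rabs[OF A] tendsto_const[of B]] by simp
    ultimately show ?thesis by (rule uconv_rescaled[OF e(1) c])
  qed
  {
    case 0
    then show ?case using base[of e A] by (simp add: uconv_const)
  next
    case (Suc m)
    from Suc.prems(1) obtain F' where F': "uniformly_continuous_on thick_slab e"
      "\<forall>i::enat. \<forall>x\<in>thick_slab. (e has_derivative F' i x) (at x within thick_slab)"
      "\<forall>b\<in>Basis. (\<forall>i. bounded ((\<lambda>x. F' i x b) ` thick_slab)) \<and> Cconv m (\<lambda>i x. F' i x b) thick_slab"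
      unfolding Cconv.simps uconv_const by blast
    have C: "Cconv m (\<lambda>_ x. F' \<infinity> x b) thick_slab" if "b \<in> Basis" for b
      using Cconv_fixed[of m "\<lambda>i x. F' i x b" thick_slab \<infinity>] F'(3) that by simp
    have A: "A \<longlonglongrightarrow> 0"
    proof (rule tendsto_zero_dominated[OF Suc.prems(3)])
      fix n
      have "\<bar>A n\<bar> * 1 \<le> \<bar>A n\<bar> * \<bar>q n ^ Suc m\<bar>"
        using q[of n] by (intro mult_left_mono) (auto simp: power_abs intro!: one_le_power simp del: power_Suc)
      then show "\<bar>A n\<bar> \<le> \<bar>A n * q n ^ Suc m\<bar>" by (simp add: abs_mult)
    qed
    have sc: "\<bar>scale_of (c n) (q n) b\<bar> \<le> q n" for n b
      using c[of n] q[of n] by (auto simp: scale_of_def)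
    show ?case
    proof (rule Cconv_rescaled_step[OF base[OF F'(1) Suc.prems(2) A], where e'="F' \<infinity>"])
      show "\<And>x. x \<in> thick_slab \<Longrightarrow> (e has_derivative F' \<infinity> x) (at x within thick_slab)"
        using F'(2) by blast
      show "\<And>b. b \<in> Basis \<Longrightarrow> bounded ((\<lambda>x. F' \<infinity> x b) ` thick_slab)" using F'(3) by blast
      show "\<bar>c n\<bar> \<le> 1" for n by (rule c)
      fix b :: "timed" assume b: "b \<in> Basis"
      have "(\<lambda>n. A n * scale_of (c n) (q n) b * q n ^ m) \<longlonglongrightarrow> 0"
      proof (rule tendsto_zero_dominated[OF Suc.prems(3)])
        fix n
        have "\<bar>A n\<bar> * \<bar>scale_of (c n) (q n) b\<bar> * \<bar>q n ^ m\<bar> \<le> \<bar>A n\<bar> * q n * \<bar>q n ^ m\<bar>"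
          using sc[of n b] by (intro mult_right_mono mult_left_mono) auto
        then show "\<bar>A n * scale_of (c n) (q n) b * q n ^ m\<bar> \<le> \<bar>A n * q n ^ Suc m\<bar>"
          using q[of n] by (simp add: abs_mult)
      qed
      then show "Cconv m (rescaled (\<lambda>n. A n * scale_of (c n) (q n) b) c q (\<lambda>x. F' \<infinity> x b)) slab"
        using C[OF b] F'(3) b by (intro Suc.IH) auto
    qed
  }
qed

text \<open>
  Stated for segments that leave the point in one direction only, because it is applied at points of the
  boundary of the strip.
\<close>

lemma derivative_zero_along_segment:
  fixes f :: "'a::real_normed_vector \<Rightarrow> 'b::real_normed_vector"
  assumes d: "(f has_derivative f') (at z within T)"
    and seg: "\<And>t. 0 \<le> t \<Longrightarrow> t \<le> 1 \<Longrightarrow> z + t *\<^sub>R v \<in> T \<and> f (z + t *\<^sub>R v) = 0"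
  shows "f' v = 0"
proof -
  have l: "((\<lambda>t. z + t *\<^sub>R v) has_derivative (\<lambda>h. h *\<^sub>R v)) (at 0 within {0..1::real})"
    by (auto intro!: derivative_eq_intros)
  have "(f has_derivative f') (at (z + 0 *\<^sub>R v) within (\<lambda>t. z + t *\<^sub>R v) ` {0..1::real})"
    using d seg by (auto intro: has_derivative_subset)
  from has_derivative_in_compose[OF l this]
  have "((\<lambda>t. f (z + t *\<^sub>R v)) has_derivative (\<lambda>h. f' (h *\<^sub>R v))) (at 0 within {0..1::real})" .
  then have "((\<lambda>t. 0) has_derivative (\<lambda>h. f' (h *\<^sub>R v))) (at 0 within {0..1::real})"
    by (rule has_derivative_transform[rotated 2]) (use seg in auto)
  then have "((\<lambda>t. 0) has_vector_derivative f' v) (at 0 within {0..1::real})"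
    unfolding has_vector_derivative_def
    using linear_scale[OF has_derivative_linear[OF d]] by simp
  moreover have "((\<lambda>t. 0) has_vector_derivative 0) (at 0 within {0..1::real})" by simp
  ultimately show ?thesis
    by (rule vector_derivative_unique_within[rotated]) (simp add: at_within_Icc_at_right)
qed

text \<open>
  If \<open>e\<close> vanishes at time 0, then it is \<open>O(c n)\<close> at the rescaled times, which gains the factor \<open>c n\<close>. The
  partial derivatives in the space directions vanish at time 0 too, so the gain persists for them by
  induction; a derivative in the time direction loses this property but produces the factor \<open>c n\<close> itself.
\<close>

lemma Cconv_rescaled_vanishing:
  fixes e :: "timed \<Rightarrow> 'b::real_normed_vector"
  assumes c: "\<And>n. \<bar>c n\<bar> \<le> 1" and q: "\<And>n. q n \<ge> 1"
  shows "Cconv (Suc m) (\<lambda>_. e) thick_slab \<Longrightarrow> (\<And>w. w \<in> strip \<Longrightarrow> e (0, w) = 0) \<Longrightarrow>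
    (\<lambda>n. A n * c n * q n ^ m) \<longlonglongrightarrow> 0 \<Longrightarrow> Cconv m (rescaled A c q e) slab"
proof (induction m arbitrary: e A)
  have base: "uconv (rescaled A c q e) slab"
    if C: "Cconv (Suc 0) (\<lambda>_. e) thick_slab" and z: "\<And>w. w \<in> strip \<Longrightarrow> e (0, w) = 0"
      and A: "(\<lambda>n. A n * c n) \<longlonglongrightarrow> 0"
    for e :: "timed \<Rightarrow> 'b" and A
  proof -
    from C obtain F' where F': "uniformly_continuous_on thick_slab e"
      "\<forall>i::enat. \<forall>x\<in>thick_slab. (e has_derivative F' i x) (at x within thick_slab)"
      "\<forall>b\<in>Basis. (\<forall>i. bounded ((\<lambda>x. F' i x b) ` thick_slab))"
      unfolding Cconv.simps uconv_const by blast
    define e' where "e' = F' \<infinity>"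
    have "bounded ((\<lambda>x. e' x (1, 0, 0)) ` thick_slab)"
      using F'(3) prod3_Basis unfolding e'_def by blast
    then obtain B where B: "B > 0" "\<And>x. x \<in> thick_slab \<Longrightarrow> norm (e' x (1, 0, 0)) \<le> B"
      unfolding bounded_pos by auto
    have lip: "norm (e (s, w)) \<le> \<bar>s\<bar> * B" if s: "\<bar>s\<bar> \<le> 1" and w: "w \<in> strip" for s w
    proof -
      have in_slab: "(t * s, w) \<in> thick_slab" if "t \<in> {0..1}" for t
      proof -
        have "\<bar>t * s\<bar> \<le> 1 * 1" unfolding abs_mult using s that by (intro mult_mono) auto
        then show ?thesis using w by (simp add: thick_slab_def abs_le_iff)
      qed
      have d: "((\<lambda>t. e (t * s, w)) has_derivative (\<lambda>h. h *\<^sub>R (s *\<^sub>R e' (t * s, w) (1, 0, 0)))) (at t within {0..1})"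
        if t: "t \<in> {0..1}" for t
      proof -
        interpret linear "e' (t * s, w)"
          unfolding e'_def by (rule has_derivative_linear[OF F'(2)[rule_format, OF in_slab[OF t]]])
        have "((\<lambda>t. (t * s, w)) has_derivative (\<lambda>h. (h * s, 0))) (at t within {0..1})"
          by (auto intro!: derivative_eq_intros)
        then have "((\<lambda>t. e (t * s, w)) has_derivative (\<lambda>h. e' (t * s, w) (h * s, 0))) (at t within {0..1})"
          using has_derivative_in_compose2[where t=thick_slab and g=e and g'=e' and f="\<lambda>t. (t * s, w)" and s="{0..1}" and f'="\<lambda>h. (h * s, 0)" and x=t]
            F'(2) in_slab t unfolding e'_def by blast
        moreover have "e' (t * s, w) (h * s, 0) = h *\<^sub>R (s *\<^sub>R e' (t * s, w) (1, 0, 0))" for h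
          using scale[of "h * s" "(1, 0, 0)"] by (simp add: zero_prod_def)
        ultimately show ?thesis by simp
      qed
      have "norm (e (1 * s, w) - e (0 * s, w)) \<le> (\<bar>s\<bar> * B) * norm (1 - 0 :: real)"
      proof (rule differentiable_bound[of "{0..1}"])
        show "convex {0..1::real}" by simp
        fix t :: real assume t: "t \<in> {0..1}"
        show "((\<lambda>t. e (t * s, w)) has_derivative (\<lambda>h. h *\<^sub>R (s *\<^sub>R e' (t * s, w) (1, 0, 0)))) (at t within {0..1})"
          by (rule d[OF t])
        show "onorm (\<lambda>h. h *\<^sub>R (s *\<^sub>R e' (t * s, w) (1, 0, 0))) \<le> \<bar>s\<bar> * B"
        proof (rule onorm_bound)
          fix h :: real
          have "\<bar>h\<bar> * (\<bar>s\<bar> * norm (e' (t * s, w) (1, 0, 0))) \<le> \<bar>h\<bar> * (\<bar>s\<bar> * B)"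
            using B(2)[OF in_slab[OF t]] by (intro mult_left_mono) auto
          then show "norm (h *\<^sub>R (s *\<^sub>R e' (t * s, w) (1, 0, 0))) \<le> \<bar>s\<bar> * B * norm h"
            by (simp add: abs_mult mult_ac)
        qed (use B(1) in simp)
      qed auto
      then show ?thesis using z[OF w] by simp
    qed
    have "norm (A n *\<^sub>R e (scaled (c n) (q n) z)) \<le> \<bar>A n * c n\<bar> * B" if zs: "z \<in> slab" for n z
    proof -
      obtain t w where zz: "z = (t, w)" "0 \<le> t" "t \<le> 1" "w \<in> strip"
        using zs by (auto simp: slab_def)
      have "\<bar>c n * t\<bar> \<le> \<bar>c n\<bar> * 1" unfolding abs_mult using zz by (intro mult_left_mono) auto
      moreover have "squeeze (q n) w \<in> strip" using zz by (auto simp: squeeze_def strip_def)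
      ultimately have "norm (e (c n * t, squeeze (q n) w)) \<le> \<bar>c n * t\<bar> * B"
        using c[of n] by (intro lip) linarith+
      also have "\<dots> \<le> \<bar>c n\<bar> * B" using \<open>\<bar>c n * t\<bar> \<le> \<bar>c n\<bar> * 1\<close> B(1) by (intro mult_right_mono) auto
      finally have "norm (e (scaled (c n) (q n) z)) \<le> \<bar>c n\<bar> * B" by (simp add: zz scaled_def)
      then have "\<bar>A n\<bar> * norm (e (scaled (c n) (q n) z)) \<le> \<bar>A n\<bar> * (\<bar>c n\<bar> * B)"
        by (rule mult_left_mono) simp
      then show ?thesis by (simp add: abs_mult mult.assoc)
    qed
    moreover have "(\<lambda>n. \<bar>A n * c n\<bar> * B) \<longlonglongrightarrow> 0"
      using tendsto_mult[OF tendsto_rabs[OF A] tendsto_const[of B]] by simp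
    ultimately show ?thesis by (rule uconv_rescaled[OF F'(1) c])
  qed
  {
    case 0
    then show ?case using base[of e A] by simp
  next
    case (Suc m)
    from Suc.prems(1) obtain F' where F': "uniformly_continuous_on thick_slab e"
      "\<forall>i::enat. \<forall>x\<in>thick_slab. (e has_derivative F' i x) (at x within thick_slab)"
      "\<forall>b\<in>Basis. (\<forall>i. bounded ((\<lambda>x. F' i x b) ` thick_slab)) \<and> Cconv (Suc m) (\<lambda>i x. F' i x b) thick_slab"
      unfolding Cconv.simps(2)[of "Suc m"] uconv_const by blast
    have C: "Cconv (Suc m) (\<lambda>_ x. F' \<infinity> x b) thick_slab" if "b \<in> Basis" for b
      using Cconv_fixed[of "Suc m" "\<lambda>i x. F' i x b" thick_slab \<infinity>] F'(3) that by blast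
    have d: "(e has_derivative F' \<infinity> x) (at x within thick_slab)" if "x \<in> thick_slab" for x
      using F'(2) that by blast
    have Ac: "(\<lambda>n. A n * c n) \<longlonglongrightarrow> 0"
    proof (rule tendsto_zero_dominated[OF Suc.prems(3)])
      fix n
      have "\<bar>A n * c n\<bar> * 1 \<le> \<bar>A n * c n\<bar> * \<bar>q n ^ Suc m\<bar>"
        using q[of n] by (intro mult_left_mono) (auto simp: power_abs intro!: one_le_power simp del: power_Suc)
      then show "\<bar>A n * c n\<bar> \<le> \<bar>A n * c n * q n ^ Suc m\<bar>" by (simp add: abs_mult)
    qed
    have vanish: "F' \<infinity> (0, w) b = 0" if w: "w \<in> strip" and b: "b = (0, 1, 0) \<or> b = (0, 0, 1)" for w b
    proof -
      obtain x y where xy: "w = (x, y)" "- 1 \<le> y" "y \<le> 1" using w by (auto simp: strip_def)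
      have dw: "(e has_derivative F' \<infinity> (0, w)) (at (0, w) within thick_slab)"
        using d w by (auto simp: thick_slab_def)
      \<comment> \<open>At height \<open>y\<close> there is room in the strip for a unit step downwards or upwards.\<close>
      define v :: "timed" where "v = (if y > 0 then - b else b)"
      have "F' \<infinity> (0, w) v = 0"
        by (rule derivative_zero_along_segment[OF dw])
           (use b xy Suc.prems(2) in \<open>auto simp: v_def thick_slab_def strip_def\<close>)
      then show ?thesis using linear_neg[OF has_derivative_linear[OF dw], of b]
        by (auto simp: v_def split: if_splits)
    qed
    show ?case
    proof (rule Cconv_rescaled_step[where e'="F' \<infinity>"])
      show "uconv (rescaled A c q e) slab"
        using base[of e A] Cconv_antimono[OF Suc.prems(1), of "Suc 0"] Suc.prems(2) Ac by simp
      show "\<And>x. x \<in> thick_slab \<Longrightarrow> (e has_derivative F' \<infinity> x) (at x within thick_slab)" by (rule d)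
      show "\<And>b. b \<in> Basis \<Longrightarrow> bounded ((\<lambda>x. F' \<infinity> x b) ` thick_slab)" using F'(3) by blast
      show "\<bar>c n\<bar> \<le> 1" for n by (rule c)
      fix b :: "timed" assume b: "b \<in> Basis"
      then consider "b = (1, 0, 0)" | "b = (0, 1, 0) \<or> b = (0, 0, 1)" by (auto simp: prod3_Basis)
      then show "Cconv m (rescaled (\<lambda>n. A n * scale_of (c n) (q n) b) c q (\<lambda>x. F' \<infinity> x b)) slab"
      proof cases
        case 1
        have "(\<lambda>n. A n * c n * q n ^ m) \<longlonglongrightarrow> 0"
        proof (rule tendsto_zero_dominated[OF Suc.prems(3)])
          fix n
          have "\<bar>A n * c n\<bar> * \<bar>q n ^ m\<bar> * 1 \<le> \<bar>A n * c n\<bar> * \<bar>q n ^ m\<bar> * q n"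
            using q[of n] by (intro mult_left_mono) auto
          then show "\<bar>A n * c n * q n ^ m\<bar> \<le> \<bar>A n * c n * q n ^ Suc m\<bar>"
            using q[of n] by (simp add: abs_mult mult_ac)
        qed
        then have "(\<lambda>n. A n * scale_of (c n) (q n) b * q n ^ m) \<longlonglongrightarrow> 0"
          by (simp add: 1 scale_of_def)
        then show ?thesis using F'(3) b
          by (intro Cconv_rescaled_bounded[OF c q Cconv_SucD[OF C[OF b]]]) auto
      next
        case 2
        have sc: "\<bar>scale_of (c n) (q n) b\<bar> \<le> q n" for n
          using 2 q[of n] by (auto simp: scale_of_def)
        have "(\<lambda>n. A n * scale_of (c n) (q n) b * c n * q n ^ m) \<longlonglongrightarrow> 0"
        proof (rule tendsto_zero_dominated[OF Suc.prems(3)])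
          fix n
          have "\<bar>A n * c n * q n ^ m\<bar> * \<bar>scale_of (c n) (q n) b\<bar> \<le> \<bar>A n * c n * q n ^ m\<bar> * q n"
            using sc[of n] by (intro mult_left_mono) auto
          then show "\<bar>A n * scale_of (c n) (q n) b * c n * q n ^ m\<bar> \<le> \<bar>A n * c n * q n ^ Suc m\<bar>"
            using q[of n] by (simp add: abs_mult mult_ac)
        qed
        then show ?thesis using vanish 2 by (intro Suc.IH[OF C[OF b]]) auto
      qed
    qed
  }
qed

section \<open>Commutators of thin twists with small shifts\<close>

text \<open>
  The commutator \<open>k \<circ> R s \<circ> k' \<circ> R (- s)\<close> for the shift \<open>R s\<close>, where \<open>k'\<close> stands for the inverse of \<open>k\<close>, and
  below its inverse \<open>R s \<circ> k \<circ> R (- s) \<circ> k'\<close>.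
\<close>

definition shift_commutator ::
  "(plane \<Rightarrow> plane) \<Rightarrow> (plane \<Rightarrow> plane) \<Rightarrow> real \<Rightarrow> plane \<Rightarrow> plane" where
  "shift_commutator k k' s z = k (k' (z - (s, 0)) + (s, 0))"

definition shift_commutator' ::
  "(plane \<Rightarrow> plane) \<Rightarrow> (plane \<Rightarrow> plane) \<Rightarrow> real \<Rightarrow> plane \<Rightarrow> plane" where
  "shift_commutator' k k' s z = k (k' z - (s, 0)) + (s, 0)"

lemma strip_shift [simp]: "z + (s, 0) \<in> strip \<longleftrightarrow> z \<in> strip" "z - (s, 0) \<in> strip \<longleftrightarrow> z \<in> strip"
  by (auto simp: strip_def mem_Times_iff)

lemma squeeze_strip [simp]: "squeeze q z \<in> strip \<longleftrightarrow> z \<in> strip"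
  by (auto simp: strip_def mem_Times_iff squeeze_def)

lemma thick_slab_mem: "z \<in> thick_slab \<longleftrightarrow> \<bar>fst z\<bar> \<le> 1 \<and> snd z \<in> strip"
  by (auto simp: thick_slab_def mem_Times_iff)

lemma tame_commutator:
  fixes S :: "timed set"
  assumes k: "tame k strip" "tame k' strip" "\<And>z. z \<in> strip \<Longrightarrow> k z \<in> strip" "\<And>z. z \<in> strip \<Longrightarrow> k' z \<in> strip"
    and S: "\<And>z. z \<in> S \<Longrightarrow> snd z \<in> strip"
  shows "tame (\<lambda>z. shift_commutator k k' (fst z * d) (snd z)) S" (is ?A)
    and "tame (\<lambda>z. shift_commutator' k k' (fst z * d) (snd z)) S" (is ?B)
proof -
  have shift: "tame (\<lambda>z :: timed. (fst z * d, 0) :: plane) S"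
    by (intro tame_Pair tame_const tame_linear bounded_linear_mult_const bounded_linear_fst)
  have w: "tame (snd :: timed \<Rightarrow> plane) S"
    by (intro tame_linear bounded_linear_snd)
  have 1: "tame (\<lambda>z. k' (snd z - (fst z * d, 0))) S"
    by (rule tame_compose[OF k(2) tame_diff[OF w shift]]) (intro image_subsetI, simp add: S)
  show ?A unfolding shift_commutator_def
    by (rule tame_compose[OF k(1) tame_add[OF 1 shift]]) (intro image_subsetI, simp add: S k(4))
  have 2: "tame (\<lambda>z. k' (snd z)) S"
    by (rule tame_compose[OF k(2) w]) (intro image_subsetI, simp add: S)
  have "tame (\<lambda>z. k (k' (snd z) - (fst z * d, 0))) S"
    by (rule tame_compose[OF k(1) tame_diff[OF 2 shift]]) (intro image_subsetI, simp add: S k(4))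
  then show ?B unfolding shift_commutator'_def by (rule tame_add[OF _ shift])
qed

definition narrow_twist :: "real \<Rightarrow> real \<Rightarrow> plane \<Rightarrow> plane" where
  "narrow_twist q C z = squeeze (1 / q) (twist C (squeeze q z))"

lemma squeeze_squeeze: "q \<noteq> 0 \<Longrightarrow> squeeze q (squeeze (1 / q) z) = z" "q \<noteq> 0 \<Longrightarrow> squeeze (1 / q) (squeeze q z) = z"
  by (simp_all add: squeeze_def)

lemma squeeze_add: "squeeze q (z + w) = squeeze q z + squeeze q w"
  and squeeze_diff: "squeeze q (z - w) = squeeze q z - squeeze q w"
  and squeeze_shift: "squeeze q (s, 0) = (q * s, 0)"
  by (simp_all add: squeeze_def algebra_simps)

text \<open>Squeezing turns the shift by \<open>s\<close> into the shift by \<open>q * s\<close>, so the twist itself is the same for all \<open>q\<close>.\<close>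

lemma commutator_narrow_twist:
  assumes "q \<noteq> 0"
  shows "shift_commutator (narrow_twist q C) (narrow_twist q C') s z =
      squeeze (1 / q) (shift_commutator (twist C) (twist C') (q * s) (squeeze q z))"
    "shift_commutator' (narrow_twist q C) (narrow_twist q C') s z =
      squeeze (1 / q) (shift_commutator' (twist C) (twist C') (q * s) (squeeze q z))"
  using assms
  by (simp_all add: shift_commutator_def shift_commutator'_def narrow_twist_def
      squeeze_squeeze squeeze_add squeeze_diff squeeze_shift)

text \<open>
  The two components of the correction are rescaled families with amplitudes \<open>1 / q n\<close> and 1, which come
  from squeezing back, and they vanish at time 0 because \<open>e 0\<close> is the identity.
\<close>

lemma Cconv_squeezed_family:
  assumes fam: "tame (\<lambda>z. e (fst z) (snd z)) thick_slab" "\<And>w. w \<in> strip \<Longrightarrow> e 0 w = w"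
    and c: "\<And>n. \<bar>c n\<bar> \<le> 1" and q: "\<And>n. q n \<ge> 1" and lim: "(\<lambda>n. c n * q n ^ m) \<longlonglongrightarrow> 0"
  shows "Cconv m (\<lambda>i z. case i of enat n \<Rightarrow> squeeze (1 / q n) (e (c n * fst z) (squeeze (q n) (snd z)))
           | \<infinity> \<Rightarrow> snd z) slab"
proof -
  define u where "u z = e (fst z) (snd z) - snd z" for z
  have u: "tame u thick_slab" unfolding u_def
    by (intro tame_diff fam(1) tame_linear bounded_linear_snd)
  have u1: "Cconv (Suc m) (\<lambda>_ z. fst (u z)) thick_slab" and u2: "Cconv (Suc m) (\<lambda>_ z. snd (u z)) thick_slab"
    using u tame_bounded_linear[OF bounded_linear_fst u] tame_bounded_linear[OF bounded_linear_snd u]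
    unfolding tame_def by blast+
  have v1: "Cconv m (rescaled (\<lambda>n. 1 / q n) c q (\<lambda>z. fst (u z))) slab"
  proof (rule Cconv_rescaled_vanishing[OF c q u1])
    show "(\<lambda>n. 1 / q n * c n * q n ^ m) \<longlonglongrightarrow> 0"
    proof (rule tendsto_zero_dominated[OF lim])
      fix n
      have "1 / q n * \<bar>c n * q n ^ m\<bar> \<le> 1 * \<bar>c n * q n ^ m\<bar>"
        using q[of n] by (intro mult_right_mono) auto
      then show "\<bar>1 / q n * c n * q n ^ m\<bar> \<le> \<bar>c n * q n ^ m\<bar>"
        using q[of n] by (simp add: abs_mult)
    qed
  qed (simp add: u_def fam(2))
  have v2: "Cconv m (rescaled (\<lambda>n. 1) c q (\<lambda>z. snd (u z))) slab"
    by (rule Cconv_rescaled_vanishing[OF c q u2]) (use lim in \<open>simp_all add: u_def fam(2)\<close>)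
  have "Cconv m (\<lambda>i z. snd z + (rescaled (\<lambda>n. 1 / q n) c q (\<lambda>z. fst (u z)) i z,
      rescaled (\<lambda>n. 1) c q (\<lambda>z. snd (u z)) i z)) slab"
    by (intro Cconv_add Cconv_Pair v1 v2 Cconv_linear bounded_linear_snd)
  then show ?thesis
  proof (rule Cconv_cong[rotated])
    fix i :: enat and z :: "timed"
    show "snd z + (rescaled (\<lambda>n. 1 / q n) c q (\<lambda>z. fst (u z)) i z, rescaled (\<lambda>n. 1) c q (\<lambda>z. snd (u z)) i z)
      = (case i of enat n \<Rightarrow> squeeze (1 / q n) (e (c n * fst z) (squeeze (q n) (snd z))) | \<infinity> \<Rightarrow> snd z)"
    proof (cases i)
      case (enat n)
      have "q n \<noteq> 0" using q[of n] by simp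
      then show ?thesis using enat
        by (simp add: u_def scaled_def squeeze_def prod_eq_iff divide_simps)
    qed (simp add: zero_prod_def[symmetric])
  qed
qed

lemma commutators_conv:
  assumes q: "\<And>n. q n \<ge> 1" and d: "\<And>n. \<bar>q n * d n\<bar> \<le> 1" and lim: "(\<lambda>n. q n ^ Suc m * d n) \<longlonglongrightarrow> 0"
  shows "Cconv m (\<lambda>i z. case i of
        enat n \<Rightarrow> shift_commutator (narrow_twist (q n) C) (narrow_twist (q n) (- C)) (fst z * d n) (snd z)
      | \<infinity> \<Rightarrow> snd z) slab" (is ?A)
    and "Cconv m (\<lambda>i z. case i of
        enat n \<Rightarrow> shift_commutator' (narrow_twist (q n) C) (narrow_twist (q n) (- C)) (fst z * d n) (snd z)
      | \<infinity> \<Rightarrow> snd z) slab" (is ?B)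
proof -
  have q0: "q n \<noteq> 0" for n using q[of n] by simp
  have lim': "(\<lambda>n. (q n * d n) * q n ^ m) \<longlonglongrightarrow> 0" using lim by (simp add: mult_ac)
  have inv: "twist C (twist (- C) w) = w" for w using twist_inverse[of "- C" w] by simp
  have tc: "tame (\<lambda>z. shift_commutator (twist C) (twist (- C)) (fst z) (snd z)) thick_slab"
    "tame (\<lambda>z. shift_commutator' (twist C) (twist (- C)) (fst z) (snd z)) thick_slab"
    using tame_commutator[OF tame_twist tame_twist twist_strip twist_strip, of thick_slab C "- C" 1]
    by (simp_all add: thick_slab_mem)
  have "Cconv m (\<lambda>i z. case i of enat n \<Rightarrow> squeeze (1 / q n)
      (shift_commutator (twist C) (twist (- C)) (q n * d n * fst z) (squeeze (q n) (snd z)))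
           | \<infinity> \<Rightarrow> snd z) slab"
    by (rule Cconv_squeezed_family[OF tc(1) _ d q lim'])
       (simp add: shift_commutator_def zero_prod_def[symmetric] inv)
  then show ?A by (rule Cconv_cong[rotated]) (auto simp: commutator_narrow_twist q0 mult_ac split: enat.split)
  have "Cconv m (\<lambda>i z. case i of enat n \<Rightarrow> squeeze (1 / q n)
      (shift_commutator' (twist C) (twist (- C)) (q n * d n * fst z) (squeeze (q n) (snd z)))
           | \<infinity> \<Rightarrow> snd z) slab"
    by (rule Cconv_squeezed_family[OF tc(2) _ d q lim'])
       (simp add: shift_commutator'_def zero_prod_def[symmetric] inv)
  then show ?B by (rule Cconv_cong[rotated]) (auto simp: commutator_narrow_twist q0 mult_ac split: enat.split)
qed

section \<open>Maps of the annulus and their lifts\<close>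

text \<open>The lift with first coordinate in \<open>{0..<1}\<close>.\<close>

definition base_point :: "complex \<times> real \<Rightarrow> plane" where
  "base_point a = (Arg2pi (fst a) / (2 * pi), snd a)"

text \<open>
  All maps of the annulus are obtained from maps of the strip. Defining them through \<open>base_point\<close> avoids
  quotients; for equivariant \<open>F\<close> the choice of the lift is irrelevant (\<open>descend_cover\<close>).
\<close>

definition descend :: "(plane \<Rightarrow> plane) \<Rightarrow> complex \<times> real \<Rightarrow> complex \<times> real" where
  "descend F a = cover (F (base_point a))"

lemma cover_add_int [simp]: "cover (z + (of_int n, 0)) = cover z"
  by (simp add: cover_def cis_mult[symmetric] distrib_left cis_multiple_2pi)

lemma cover_in_annulus: "z \<in> strip \<Longrightarrow> cover z \<in> annulus"
  by (auto simp: cover_def annulus_def strip_def mem_Times_iff)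

lemma base_point_cover: "base_point (cover z) = z - (of_int \<lfloor>fst z\<rfloor>, 0)"
proof -
  let ?x = "frac (fst z)"
  have "of_real 1 * exp (\<i> * of_real (2 * pi * ?x)) = cis (2 * pi * fst z)"
  proof -
    have "cis (2 * pi * fst z) = cis (2 * pi * ?x) * cis (2 * pi * of_int \<lfloor>fst z\<rfloor>)"
      by (simp add: cis_mult frac_def algebra_simps)
    moreover have "cis (2 * pi * of_int \<lfloor>fst z\<rfloor>) = 1" by (rule cis_multiple_2pi) simp
    ultimately show ?thesis by (simp add: cis_conv_exp)
  qed
  moreover have "0 \<le> 2 * pi * ?x" "2 * pi * ?x < 2 * pi"
    using frac_ge_0[of "fst z"] frac_lt_1[of "fst z"] by simp_all
  ultimately have "Arg2pi (cis (2 * pi * fst z)) = 2 * pi * ?x"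
    by (intro Arg2pi_unique[of 1]) auto
  then show ?thesis by (simp add: base_point_def cover_def prod_eq_iff frac_def)
qed

lemma cover_base_point: "a \<in> annulus \<Longrightarrow> cover (base_point a) = a"
proof -
  assume a: "a \<in> annulus"
  then have "norm (fst a) = 1" by (auto simp: annulus_def)
  then have "cis (Arg2pi (fst a)) = fst a"
    using Arg2pi_eq[of "fst a"] by (simp add: cis_conv_exp)
  then show ?thesis by (simp add: cover_def base_point_def prod_eq_iff)
qed

lemma base_point_in_strip: "a \<in> annulus \<Longrightarrow> base_point a \<in> strip"
  by (auto simp: base_point_def annulus_def strip_def)

lemma base_point_bounds: "0 \<le> fst (base_point a)" "fst (base_point a) < 1"
  using Arg2pi_ge_0[of "fst a"] Arg2pi_lt_2pi[of "fst a"] by (simp_all add: base_point_def)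

definition equivariant :: "(plane \<Rightarrow> plane) \<Rightarrow> bool" where
  "equivariant F \<longleftrightarrow> (\<forall>z\<in>strip. F z \<in> strip \<and> F (z + (1, 0)) = F z + (1, 0))"

lemma equivariant_strip: "equivariant F \<Longrightarrow> z \<in> strip \<Longrightarrow> F z \<in> strip"
  by (simp add: equivariant_def)

lemma periodic_add_int:
  fixes F :: "plane \<Rightarrow> 'b::ab_group_add"
  assumes "\<And>z. z \<in> strip \<Longrightarrow> F (z + (1, 0)) = F z" "z \<in> strip"
  shows "F (z + (of_int n, 0)) = F z"
proof -
  have 1: "F (z + (real k, 0)) = F z" if "z \<in> strip" for k :: nat and z
  proof (induction k)
    case 0
    then show ?case by (simp add: zero_prod_def[symmetric])
  next
    case (Suc k)
    have "z + (real (Suc k), 0) = (z + (real k, 0)) + (1, 0)" by (simp add: prod_eq_iff)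
    then show ?case using assms(1)[of "z + (real k, 0)"] Suc that by (simp only: strip_shift)
  qed
  show ?thesis
  proof (cases n)
    case (nonneg k)
    then show ?thesis using 1[OF assms(2)] by simp
  next
    case (neg k)
    have "F (z + (of_int n, 0)) = F (z + (of_int n, 0) + (real (Suc k), 0))"
      using 1[of "z + (of_int n, 0)" "Suc k"] assms(2) by simp
    also have "z + (of_int n, 0) + (real (Suc k), 0) = z" using neg by (simp add: prod_eq_iff)
    finally show ?thesis .
  qed
qed

lemma equivariant_add_int:
  assumes "equivariant F" "z \<in> strip" shows "F (z + (of_int n, 0)) = F z + (of_int n, 0)"
proof -
  have "F (z + (of_int n, 0)) - (z + (of_int n, 0)) = F z - z"
    by (rule periodic_add_int[where F="\<lambda>z. F z - z"]) (use assms in \<open>auto simp: equivariant_def\<close>)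
  then show ?thesis by (simp add: algebra_simps)
qed

lemma equivariant_compose: "equivariant F \<Longrightarrow> equivariant G \<Longrightarrow> equivariant (\<lambda>z. F (G z))"
  by (simp add: equivariant_def)

lemma equivariant_shift: "equivariant (\<lambda>z. z + (s, 0))"
  by (simp add: equivariant_def algebra_simps)

lemma equivariant_funpow: "equivariant F \<Longrightarrow> equivariant (F ^^ n)"
proof (induction n)
  case 0
  then show ?case by (simp add: equivariant_def)
next
  case (Suc n)
  then show ?case using equivariant_compose[of F "F ^^ n"] by (simp add: comp_def)
qed

lemma descend_cover:
  assumes "equivariant F" "z \<in> strip" shows "descend F (cover z) = cover (F z)"
proof -
  have "z = base_point (cover z) + (of_int \<lfloor>fst z\<rfloor>, 0)" by (simp add: base_point_cover prod_eq_iff)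
  then have "F z = F (base_point (cover z)) + (of_int \<lfloor>fst z\<rfloor>, 0)"
    using equivariant_add_int[OF assms(1), of "base_point (cover z)" "\<lfloor>fst z\<rfloor>"]
      base_point_in_strip[OF cover_in_annulus[OF assms(2)]] by simp
  then show ?thesis by (simp add: descend_def)
qed

lemma descend_in_annulus: "equivariant F \<Longrightarrow> a \<in> annulus \<Longrightarrow> descend F a \<in> annulus"
  by (simp add: descend_def cover_in_annulus equivariant_strip base_point_in_strip)

lemma descend_compose:
  assumes "equivariant F" "equivariant G" "a \<in> annulus"
  shows "descend F (descend G a) = descend (\<lambda>z. F (G z)) a"
  using assms by (simp add: descend_def[of G] descend_def[of "\<lambda>z. F (G z)"] descend_cover equivariant_strip base_point_in_strip)

text \<open>
  The function \<open>base_point\<close> jumps, but \<open>cover\<close> restricted to the compact set \<open>D\<close> is a closed map onto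
  the annulus, so preimages of closed sets are images of compact sets.
\<close>

lemma continuous_on_annulus:
  fixes g :: "plane \<Rightarrow> 'b::topological_space"
  assumes c: "continuous_on strip g" and p: "\<And>z. z \<in> strip \<Longrightarrow> g (base_point (cover z)) = g z"
  shows "continuous_on annulus (\<lambda>a. g (base_point a))"
proof -
  define D where "D = {0..1 :: real} \<times> {- 1..1 :: real}"
  have D: "compact D" "D \<subseteq> strip" unfolding D_def strip_def by (auto intro: compact_Times)
  have cc: "continuous_on D cover"
    unfolding cover_def[abs_def] by (intro continuous_intros)
  have im: "annulus = cover ` D"
  proof
    show "annulus \<subseteq> cover ` D"
    proof
      fix a assume a: "a \<in> annulus"
      then have "base_point a \<in> D" using base_point_bounds[of a] base_point_in_strip[OF a]
        by (auto simp: D_def strip_def mem_Times_iff)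
      then show "a \<in> cover ` D" using cover_base_point[OF a] by (metis image_eqI)
    qed
  qed (use D cover_in_annulus in auto)
  show ?thesis
  proof (subst continuous_on_closed_vimage)
    show "closed annulus" unfolding im using compact_continuous_image[OF cc D(1)] compact_imp_closed by blast
    show "\<forall>B. closed B \<longrightarrow> closed ((\<lambda>a. g (base_point a)) -` B \<inter> annulus)"
    proof (intro allI impI)
      fix B :: "'b set" assume B: "closed B"
      have eq: "(\<lambda>a. g (base_point a)) -` B \<inter> annulus = cover ` (g -` B \<inter> D)"
      proof -
        have "g (base_point (cover z)) = g z" if "z \<in> D" for z using p D that by blast
        then show ?thesis unfolding im by auto
      qed
      have "closed (g -` B \<inter> D)"
        using continuous_closed_preimage[OF continuous_on_subset[OF c D(2)] compact_imp_closed[OF D(1)] B]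
        by (simp add: Int_commute)
      then have "compact (g -` B \<inter> D)" using D(1) by (metis Int_lower2 compact_Int_closed inf.absorb_iff2 inf_commute)
      moreover have "continuous_on (g -` B \<inter> D) cover" using cc continuous_on_subset by blast
      ultimately show "closed ((\<lambda>a. g (base_point a)) -` B \<inter> annulus)"
        unfolding eq using compact_continuous_image compact_imp_closed by blast
    qed
  qed
qed

lemma continuous_on_cover: "continuous_on S cover"
  unfolding cover_def[abs_def] by (intro continuous_intros)

lemma continuous_on_descend:
  assumes F: "equivariant F" and c: "continuous_on strip F"
  shows "continuous_on annulus (descend F)"
  unfolding descend_def[abs_def]
proof (rule continuous_on_annulus)
  show "continuous_on strip (\<lambda>z. cover (F z))"
    by (rule continuous_on_compose2[OF continuous_on_cover[of UNIV] c]) simp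
  show "\<And>z. z \<in> strip \<Longrightarrow> cover (F (base_point (cover z))) = cover (F z)"
    using descend_cover[OF F] by (simp add: descend_def)
qed

lemma tame_cover: "tame cover S"
proof -
  have "tame (\<lambda>z. 2 * pi * fst z) S" 
    by (rule tame_linear[OF bounded_linear_const_mult[OF bounded_linear_fst]])
  then have "tame (\<lambda>z. cos (2 * pi * fst z)) S" "tame (\<lambda>z. sin (2 * pi * fst z)) S"
    using tame_compose[OF tame_cos] tame_compose[OF tame_sin] by blast+
  then have "tame (\<lambda>z. (complex_of_real (cos (2 * pi * fst z)) + \<i> * complex_of_real (sin (2 * pi * fst z)), snd z)) S"
    by (intro tame_Pair tame_add tame_snd tame_bounded_linear[OF bounded_linear_of_real]
        tame_bounded_linear[OF bounded_linear_const_mult[OF bounded_linear_of_real]])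
  then show ?thesis by (rule tame_cong) (simp add: cover_def prod_eq_iff complex_eq_iff)
qed

text \<open>
  Smoothness of order \<open>r\<close> in the uniform sense; for \<open>r = \<infinity>\<close> this is \<open>tame\<close>. The limit maps have it only for
  the \<open>r\<close> in question.
\<close>

definition smooth :: "enat \<Rightarrow> ('a::euclidean_space \<Rightarrow> 'b::real_normed_vector) \<Rightarrow> 'a set \<Rightarrow> bool" where
  "smooth r f S \<longleftrightarrow> (\<forall>m. enat m \<le> r \<longrightarrow> Cconv m (\<lambda>_. f) S)"

lemma tame_imp_smooth: "tame f S \<Longrightarrow> smooth r f S"
  by (simp add: tame_def smooth_def)

lemma smooth_continuous: "smooth r f S \<Longrightarrow> uniformly_continuous_on S f"
  unfolding smooth_def using uconv_const by (metis Cconv.simps(1) enat_0_iff(2) zero_le i0_lb zero_enat_def)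

lemma smooth_compose:
  fixes f :: "'b::euclidean_space \<Rightarrow> 'c::real_normed_vector" and g :: "'a::euclidean_space \<Rightarrow> 'b"
  assumes "smooth r f T" "smooth r g S" "g ` S \<subseteq> T" shows "smooth r (\<lambda>x. f (g x)) S"
  using Cconv_compose[of _ "\<lambda>_. f" T "\<lambda>_. g" S] assms by (auto simp: smooth_def)

lemma C_nat_on_cong:
  assumes "\<And>x. x \<in> S \<Longrightarrow> f x = g x" "C_nat_on n f S" shows "C_nat_on n g S"
proof (cases n)
  case 0
  then show ?thesis using assms by (simp cong: continuous_on_cong)
next
  case (Suc k)
  with assms(2) obtain f' where f': "\<forall>x\<in>S. (f has_derivative f' x) (at x within S)"
     "\<forall>v. C_nat_on k (\<lambda>x. f' x v) S" by auto
  have "(g has_derivative f' x) (at x within S)" if "x \<in> S" for x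
    by (rule has_derivative_transform[OF that _ f'(1)[rule_format, OF that]]) (simp add: assms(1))
  then show ?thesis using f' Suc by auto
qed

lemma smooth_imp_C_on: "smooth r f S \<Longrightarrow> C_on r f S"
  unfolding smooth_def C_on_def using Cconv_imp_C_nat_on by blast

lemma C_on_cong: "(\<And>x. x \<in> S \<Longrightarrow> f x = g x) \<Longrightarrow> C_on r f S \<Longrightarrow> C_on r g S"
  unfolding C_on_def using C_nat_on_cong by blast

lemma smooth_descend:
  assumes "equivariant F" "smooth r F strip" shows "C_on r (descend F \<circ> cover) strip"
proof (rule C_on_cong)
  show "C_on r (\<lambda>z. cover (F z)) strip"
    by (rule smooth_imp_C_on[OF smooth_compose[OF tame_imp_smooth[OF tame_cover[of UNIV]] assms(2)]]) simp
  show "z \<in> strip \<Longrightarrow> cover (F z) = (descend F \<circ> cover) z" for z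
    by (simp add: descend_cover[OF assms(1)])
qed

definition strip_inverses :: "(plane \<Rightarrow> plane) \<Rightarrow> (plane \<Rightarrow> plane) \<Rightarrow> bool" where
  "strip_inverses F F' \<longleftrightarrow> equivariant F \<and> equivariant F' \<and> (\<forall>z\<in>strip. F' (F z) = z \<and> F (F' z) = z)"

lemma annulus_diffeo_descend:
  assumes inv: "strip_inverses F F'" and s: "smooth r F strip" "smooth r F' strip"
  shows "annulus_diffeo r (descend F)"
proof -
  have e: "equivariant F" "equivariant F'" using inv by (auto simp: strip_inverses_def)
  have c: "continuous_on strip F" "continuous_on strip F'"
    using s smooth_continuous uniformly_continuous_imp_continuous by blast+
  have 1: "descend F' (descend F a) = a" "descend F (descend F' a) = a" if "a \<in> annulus" for a
    unfolding descend_compose[OF e(2,1) that] descend_compose[OF e that] unfolding descend_def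
    using that inv base_point_in_strip[OF that] cover_base_point[OF that]
    by (auto simp: strip_inverses_def)
  have "homeomorphism annulus annulus (descend F) (descend F')"
    using 1 descend_in_annulus[OF e(1)] descend_in_annulus[OF e(2)]
    by (intro homeomorphismI continuous_on_descend e c) auto
  then show ?thesis unfolding annulus_diffeo_def
    using smooth_descend[OF e(1) s(1)] smooth_descend[OF e(2) s(2)] by blast
qed

section \<open>Compact invariant sets and rotation numbers of lifted maps\<close>

text \<open>
  A compact set in the interior keeps a positive distance from the boundary, which the orbits of its points
  do not respect.
\<close>

lemma NICIS_descend:
  assumes F: "equivariant F"
    and esc: "\<And>n z. n > 0 \<Longrightarrow> z \<in> strip \<Longrightarrow> \<exists>j. \<bar>snd ((F ^^ j) z)\<bar> > 1 - 1 / real n"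
  shows "NICIS (descend F)"
  unfolding NICIS_def
proof (rule notI, elim exE conjE)
  fix K assume K: "K \<noteq> {}" "compact K" "K \<subseteq> annulus_interior" "descend F ` K = K"
  have "continuous_on K (\<lambda>a. \<bar>snd a\<bar>)" by (intro continuous_intros)
  from continuous_attains_sup[OF K(2,1) this]
  obtain a0 where a0: "a0 \<in> K" "\<And>a. a \<in> K \<Longrightarrow> \<bar>snd a\<bar> \<le> \<bar>snd a0\<bar>" by blast
  have "\<bar>snd a0\<bar> < 1" using subsetD[OF K(3) a0(1)] by (auto simp: annulus_interior_def)
  then obtain n where n: "n > 0" "1 / real n < 1 - \<bar>snd a0\<bar>"
    by (metis diff_gt_0_iff_gt nat_approx_posE of_nat_0_less_iff zero_less_Suc)
  have sub: "K \<subseteq> annulus" using K(3) by (auto simp: annulus_def annulus_interior_def)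
  define z where "z = base_point a0"
  have z: "z \<in> strip" "cover z = a0" using base_point_in_strip cover_base_point subsetD[OF sub a0(1)] unfolding z_def by blast+
  have orb: "cover ((F ^^ j) z) \<in> K" for j
  proof (induction j)
    case 0
    then show ?case using z a0 by simp
  next
    case (Suc j)
    have "(F ^^ j) z \<in> strip" using equivariant_funpow[OF F] z(1) equivariant_strip by blast
    then have "cover ((F ^^ Suc j) z) = descend F (cover ((F ^^ j) z))"
      by (simp add: descend_cover[OF F])
    then show ?case using Suc K(4) by blast
  qed
  obtain j where "\<bar>snd ((F ^^ j) z)\<bar> > 1 - 1 / real n" using esc[OF n(1) z(1)] by blast
  moreover have "\<bar>snd (cover ((F ^^ j) z))\<bar> \<le> \<bar>snd a0\<bar>" using a0(2)[OF orb] .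
  ultimately show False using n(2) by (simp add: cover_def)
qed

lemma displacement_cover:
  assumes F: "equivariant F" and z: "z \<in> strip"
  shows "displacement F (cover z) = fst (F z) - fst z"
  unfolding displacement_def
proof (rule the_equality)
  have *: "fst (F w) - fst w = fst (F z) - fst z" if w: "w \<in> strip" "cover w = cover z" for w
  proof -
    have "z = w + (of_int (\<lfloor>fst z\<rfloor> - \<lfloor>fst w\<rfloor>), 0)"
      using base_point_cover[of z] base_point_cover[of w] w(2) by (auto simp: prod_eq_iff)
    then show ?thesis using equivariant_add_int[OF F w(1)] by (metis add_diff_cancel_left' fst_add fst_conv add_diff_cancel_right)
  qed
  then show "\<forall>w\<in>strip. cover w = cover z \<longrightarrow> fst (F w) - fst w = fst (F z) - fst z" by blast
  show "d = fst (F z) - fst z" if "\<forall>w\<in>strip. cover w = cover z \<longrightarrow> fst (F w) - fst w = d" for d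
    using that z by auto
qed

lemma space_annulus_borel: "space annulus_borel = annulus"
  by (simp add: annulus_borel_def space_restrict_space)

text \<open>
  The displacement of \<open>F ^^ J\<close> is a Birkhoff sum of the displacement of \<open>F\<close>. Its integral is \<open>J\<close> times the mean
  displacement by invariance, and it is uniformly close to \<open>J * \<alpha>\<close>.
\<close>

lemma has_rotation_number_descend:
  assumes F: "equivariant F" and c: "continuous_on strip F"
    and rot: "\<And>n. n > 0 \<Longrightarrow> \<exists>J::nat. J > 0 \<and>
       (\<forall>z\<in>strip. \<bar>fst ((F ^^ J) z) - fst z - real J * \<alpha>\<bar> \<le> real J / real n)"
  shows "has_rotation_number (descend F) F \<alpha>"
  unfolding has_rotation_number_def
proof (intro allI impI)
  fix \<mu> assume "invariant_prob (descend F) \<mu>"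
  then interpret prob_space \<mu> by (simp add: invariant_prob_def)
  let ?f = "descend F"
  have sets: "sets \<mu> = sets annulus_borel" and mf: "?f \<in> measurable \<mu> \<mu>" and df: "distr \<mu> \<mu> ?f = \<mu>"
    using \<open>invariant_prob (descend F) \<mu>\<close> by (auto simp: invariant_prob_def measure_preserving_def)
  have space: "space \<mu> = annulus" using sets_eq_imp_space_eq[OF sets] by (simp add: space_annulus_borel)
  define d where "d = displacement F"
  have d: "d a = (\<lambda>z. fst (F z) - fst z) (base_point a)" if "a \<in> annulus" for a
    using displacement_cover[OF F base_point_in_strip[OF that]] cover_base_point[OF that] by (simp add: d_def)
  have "continuous_on annulus (\<lambda>a. (\<lambda>z. fst (F z) - fst z) (base_point a))"
  proof (rule continuous_on_annulus)
    show "continuous_on strip (\<lambda>z. fst (F z) - fst z)" by (intro continuous_intros c)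
    show "fst (F (base_point (cover z))) - fst (base_point (cover z)) = fst (F z) - fst z" if "z \<in> strip" for z
      using d[OF cover_in_annulus[OF that]] displacement_cover[OF F that] by (simp add: d_def)
  qed
  then have cd: "continuous_on annulus d" by (rule continuous_on_eq) (simp add: d)
  have md: "d \<in> borel_measurable \<mu>"
    using borel_measurable_continuous_on_restrict[OF cd]
    by (simp add: measurable_cong_sets[OF sets refl] annulus_borel_def)
  have comp: "compact annulus" unfolding annulus_def by (intro compact_Times compact_sphere) auto
  obtain B where B: "\<And>a. a \<in> annulus \<Longrightarrow> \<bar>d a\<bar> \<le> B"
    using compact_imp_bounded[OF compact_continuous_image[OF cd comp]] unfolding bounded_iff by auto
  have mfn: "(?f ^^ j) \<in> measurable \<mu> \<mu>" for j
  proof (induction j)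
    case (Suc j)
    then show ?case using measurable_comp[OF Suc mf] by (simp add: comp_def)
  qed (simp add: measurable_ident_sets id_def)
  have space_fn: "(?f ^^ j) a \<in> annulus" if "a \<in> annulus" for j a
    using measurable_space[OF mfn[of j]] that by (simp add: space)
  have int: "integrable \<mu> (\<lambda>a. d ((?f ^^ j) a))" for j
  proof (rule integrable_const_bound[of _ B])
    show "AE a in \<mu>. norm (d ((?f ^^ j) a)) \<le> B"
      by (rule AE_I2) (use B[OF space_fn] space in simp)
    show "(\<lambda>a. d ((?f ^^ j) a)) \<in> borel_measurable \<mu>" by (rule measurable_compose[OF mfn md])
  qed
  have eq: "(\<integral>a. d ((?f ^^ j) a) \<partial>\<mu>) = (\<integral>a. d a \<partial>\<mu>)" for j
  proof (induction j)
    case (Suc j)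
    have "(\<integral>a. d ((?f ^^ j) a) \<partial>\<mu>) = (\<integral>a. d ((?f ^^ j) a) \<partial>(distr \<mu> \<mu> ?f))" by (simp add: df)
    also have "\<dots> = (\<integral>a. d ((?f ^^ j) (?f a)) \<partial>\<mu>)"
      by (rule integral_distr[OF mf]) (rule measurable_compose[OF mfn md])
    finally show ?case using Suc by (simp add: funpow_swap1)
  qed simp
  have telescope: "(\<Sum>j<J. d ((?f ^^ j) (cover z))) = fst ((F ^^ J) z) - fst z" if z: "z \<in> strip" for z J
  proof (induction J)
    case (Suc J)
    have orb: "(?f ^^ j) (cover z) = cover ((F ^^ j) z) \<and> (F ^^ j) z \<in> strip" for j
      by (induction j) (auto simp: z descend_cover[OF F] equivariant_strip[OF F])
    show ?case using Suc orb[of J] displacement_cover[OF F, of "(F ^^ J) z"] by (simp add: d_def)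
  qed simp
  have bound: "\<bar>(\<integral>a. d a \<partial>\<mu>) - \<alpha>\<bar> \<le> 1 / real n" if n: "n > 0" for n
  proof -
    obtain J where J: "J > 0" "\<And>z. z \<in> strip \<Longrightarrow> \<bar>fst ((F ^^ J) z) - fst z - real J * \<alpha>\<bar> \<le> real J / real n"
      using rot[OF n] by blast
    have le: "\<bar>(\<Sum>j<J. d ((?f ^^ j) a)) - real J * \<alpha>\<bar> \<le> real J / real n" if "a \<in> annulus" for a
      using telescope[OF base_point_in_strip[OF that], of J] J(2)[OF base_point_in_strip[OF that]]
      by (simp add: cover_base_point[OF that])
    have "(\<integral>a. (\<Sum>j<J. d ((?f ^^ j) a)) - real J * \<alpha> \<partial>\<mu>) = real J * (\<integral>a. d a \<partial>\<mu>) - real J * \<alpha>"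
      by (simp add: int eq prob_space)
    moreover have "\<bar>\<integral>a. (\<Sum>j<J. d ((?f ^^ j) a)) - real J * \<alpha> \<partial>\<mu>\<bar> \<le> (\<integral>a. real J / real n \<partial>\<mu>)"
    proof (rule order_trans[OF integral_abs_bound integral_mono])
      show "integrable \<mu> (\<lambda>a. \<bar>(\<Sum>j<J. d ((?f ^^ j) a)) - real J * \<alpha>\<bar>)"
        by (intro integrable_abs Bochner_Integration.integrable_diff Bochner_Integration.integrable_sum int) simp
    qed (use le space in auto)
    ultimately have "\<bar>real J * (\<integral>a. d a \<partial>\<mu>) - real J * \<alpha>\<bar> \<le> real J / real n" by (simp add: prob_space)
    moreover have "real J * (\<integral>a. d a \<partial>\<mu>) - real J * \<alpha> = real J * ((\<integral>a. d a \<partial>\<mu>) - \<alpha>)" by (simp add: algebra_simps)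
    ultimately have "real J * \<bar>(\<integral>a. d a \<partial>\<mu>) - \<alpha>\<bar> \<le> real J * (1 / real n)" by (simp add: abs_mult)
    then show ?thesis using J(1) by (simp only: mult_le_cancel_left_pos of_nat_0_less_iff)
  qed
  have "\<bar>(\<integral>a. d a \<partial>\<mu>) - \<alpha>\<bar> \<le> 0"
  proof (rule ccontr)
    assume "\<not> ?thesis"
    then have "0 < \<bar>(\<integral>a. d a \<partial>\<mu>) - \<alpha>\<bar>" by linarith
    then obtain n where "1 / real (Suc n) < \<bar>(\<integral>a. d a \<partial>\<mu>) - \<alpha>\<bar>"
      by (rule nat_approx_posE)
    then show False using bound[of "Suc n"] by linarith
  qed
  then show "(\<integral>a. displacement F a \<partial>\<mu>) = \<alpha>" by (simp add: d_def)
qed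

lemma is_lift_descend: "equivariant F \<Longrightarrow> continuous_on strip F \<Longrightarrow> is_lift (descend F) F"
  unfolding is_lift_def using descend_cover equivariant_strip by (metis image_subsetI)

section \<open>Preservation of area\<close>

text \<open>
  The change of variables theorem is about \<open>real ^ 2\<close>; the following identification carries it over to
  the product type.
\<close>

definition vec2 :: "plane \<Rightarrow> real ^ 2" where
  "vec2 z = (\<chi> i. if i = 1 then fst z else snd z)"

definition pair2 :: "real ^ 2 \<Rightarrow> plane" where
  "pair2 v = (v $ 1, v $ 2)"

lemma vec2_nth [simp]: "vec2 z $ 1 = fst z" "vec2 z $ 2 = snd z"
  by (simp_all add: vec2_def)

lemma pair2_vec2 [simp]: "pair2 (vec2 z) = z" and vec2_pair2 [simp]: "vec2 (pair2 v) = v"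
  by (simp_all add: pair2_def vec_eq_iff forall_2)

lemma bounded_linear_pair2: "bounded_linear pair2"
  unfolding pair2_def[abs_def] by (intro bounded_linear_Pair bounded_linear_vec_nth)

lemma bounded_linear_vec2: "bounded_linear vec2"
  by (rule linear_conv_bounded_linear[THEN iffD1], rule linearI)
     (simp_all add: vec_eq_iff forall_2)

lemma Basis_vec2: "(Basis :: (real ^ 2) set) = {axis 1 1, axis 2 1}"
  by (auto simp: Basis_vec_def UNIV_2)

lemma Basis_pair: "(Basis :: plane set) = {(1, 0), (0, 1)}"
  by (auto simp: Basis_prod_def)

lemma inner_pair [simp]: "z \<bullet> (1, 0) = fst z" "z \<bullet> (0, 1) = snd z" for z :: "plane"
  by (cases z; simp)+

lemma vimage_pair2_box: "pair2 -` box l u = box (vec2 l) (vec2 u)"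
  by (auto simp: mem_box Basis_vec2 Basis_pair pair2_def inner_axis)

lemma pair2_measurable: "pair2 \<in> borel_measurable borel"
  by (rule borel_measurable_continuous_onI)
     (rule linear_continuous_on[OF bounded_linear_pair2])

lemma lborel_pair2: "distr lborel borel pair2 = lborel"
proof (rule lborel_eqI[symmetric])
  fix l u :: "plane" assume le: "\<And>b. b \<in> Basis \<Longrightarrow> l \<bullet> b \<le> u \<bullet> b"
  have "emeasure (distr lborel borel pair2) (box l u) = emeasure lborel (box (vec2 l) (vec2 u))"
    by (subst emeasure_distr) (simp_all add: pair2_measurable vimage_pair2_box)
  also have "\<dots> = (\<Prod>b\<in>Basis. (vec2 u - vec2 l) \<bullet> b)"
    using le[of "(1, 0)"] le[of "(0, 1)"]
    by (intro emeasure_lborel_box) (auto simp: Basis_vec2 Basis_pair inner_axis)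
  also have "(\<Prod>b\<in>Basis. (vec2 u - vec2 l) \<bullet> b) = (\<Prod>b\<in>Basis. (u - l) \<bullet> b)"
    by (simp add: Basis_vec2 Basis_pair inner_axis axis_eq_axis)
  finally show "emeasure (distr lborel borel pair2) (box l u) = (\<Prod>b\<in>Basis. (u - l) \<bullet> b)" .
qed simp

text \<open>Differentiable with Jacobian determinant 1; the existential quantifiers name the partial derivatives.\<close>

definition unimodular :: "(plane \<Rightarrow> plane) \<Rightarrow> bool" where
  "unimodular K \<longleftrightarrow> (\<forall>z. \<exists>a b c d.
     (K has_derivative (\<lambda>h. (a * fst h + b * snd h, c * fst h + d * snd h))) (at z) \<and> a * d - b * c = 1)"

lemma emeasure_image_unimodular:
  assumes K: "unimodular K" "inj K" and m: "K ` box l u \<in> sets borel"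
  shows "emeasure lborel (K ` box l u) = emeasure lborel (box l u)"
proof -
  define T where "T v = vec2 (K (pair2 v))" for v
  from K(1)[unfolded unimodular_def, THEN choice] obtain a where
    "\<forall>z. \<exists>b c d. (K has_derivative (\<lambda>h. (a z * fst h + b * snd h, c * fst h + d * snd h))) (at z) \<and> a z * d - b * c = 1" ..
  from this[THEN choice] obtain b where
    "\<forall>z. \<exists>c d. (K has_derivative (\<lambda>h. (a z * fst h + b z * snd h, c * fst h + d * snd h))) (at z) \<and> a z * d - b z * c = 1" ..
  from this[THEN choice] obtain c where
    "\<forall>z. \<exists>d. (K has_derivative (\<lambda>h. (a z * fst h + b z * snd h, c z * fst h + d * snd h))) (at z) \<and> a z * d - b z * c z = 1" ..
  from this[THEN choice] obtain d where
    "\<forall>z. (K has_derivative (\<lambda>h. (a z * fst h + b z * snd h, c z * fst h + d z * snd h))) (at z) \<and> a z * d z - b z * c z = 1" ..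
  then have D: "\<And>z. (K has_derivative (\<lambda>h. (a z * fst h + b z * snd h, c z * fst h + d z * snd h))) (at z)"
    "\<And>z. a z * d z - b z * c z = 1" by blast+
  define T' where "T' v h = vec2 (a (pair2 v) * h $ 1 + b (pair2 v) * h $ 2, c (pair2 v) * h $ 1 + d (pair2 v) * h $ 2)" for v and h :: "real ^ 2"
  have dT: "(T has_derivative T' v) (at v)" for v
  proof -
    have "((\<lambda>v. K (pair2 v)) has_derivative
       (\<lambda>h. (\<lambda>h. (a (pair2 v) * fst h + b (pair2 v) * snd h, c (pair2 v) * fst h + d (pair2 v) * snd h)) (pair2 h))) (at v)"
      by (rule has_derivative_compose[OF bounded_linear_imp_has_derivative[OF bounded_linear_pair2] D(1)])
    from bounded_linear.has_derivative[OF bounded_linear_vec2 this] show ?thesis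
      by (simp add: T_def[abs_def] T'_def[abs_def] pair2_def)
  qed
  have det: "det (matrix (T' v)) = 1" for v
    using D(2)[of "pair2 v"] by (simp add: det_2 matrix_def T'_def axis_def)
  have inj: "inj_on T S" for S
  proof (rule inj_onI)
    fix v w assume "T v = T w"
    then have "K (pair2 v) = K (pair2 w)" by (metis T_def pair2_vec2)
    then have "pair2 v = pair2 w" by (rule injD[OF K(2)])
    then show "v = w" by (metis vec2_pair2)
  qed
  let ?S = "box (vec2 l) (vec2 u)"
  have S: "pair2 -` box l u = ?S" by (rule vimage_pair2_box)
  have TS: "T ` ?S = pair2 -` (K ` box l u)"
  proof -
    have "v \<in> T ` ?S \<longleftrightarrow> pair2 v \<in> K ` box l u" for v
    proof
      assume "v \<in> T ` ?S"
      then show "pair2 v \<in> K ` box l u" by (auto simp: S[symmetric] T_def)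
    next
      assume "pair2 v \<in> K ` box l u"
      then obtain z where z: "z \<in> box l u" "pair2 v = K z" by blast
      then have "v = T (vec2 z)" by (simp add: T_def flip: z(2))
      then show "v \<in> T ` ?S" using z(1) by (auto simp: S[symmetric])
    qed
    then show ?thesis by blast
  qed
  have lm: "?S \<in> lmeasurable" by simp
  have "((\<lambda>x. 1 :: real) has_integral measure lebesgue ?S) ?S"
    unfolding lmeasure_integral[OF lm]
    by (rule integrable_integral) (use lm in \<open>simp only: lmeasurable_iff_integrable_on\<close>)
  then have "T ` ?S \<in> lmeasurable \<and> measure lebesgue (T ` ?S) = measure lebesgue ?S"
    by (subst has_measure_differentiable_image[OF _ _ inj, where f'=T'])
       (auto simp: det intro: has_derivative_at_withinI dT)
  then have "emeasure lebesgue (T ` ?S) = emeasure lebesgue ?S"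
    using lm by (simp add: emeasure_eq_measure2)
  moreover have "T ` ?S \<in> sets borel"
    unfolding TS using measurable_sets[OF pair2_measurable m] by simp
  ultimately have 1: "emeasure lborel (T ` ?S) = emeasure lborel ?S" by simp
  have tr: "emeasure lborel A = emeasure lborel (pair2 -` A)" if "A \<in> sets borel" for A
    by (subst lborel_pair2[symmetric], subst emeasure_distr) (use that pair2_measurable in simp_all)
  show ?thesis using 1 tr[OF m] tr[of "box l u"] by (simp add: TS S)
qed

lemma unimodular_imp_lborel:
  assumes inv: "\<And>z. K (K' z) = z" "\<And>z. K' (K z) = z" and K': "unimodular K'" and K: "continuous_on UNIV K"
  shows "distr lborel borel K = lborel"
proof (rule lborel_eqI[symmetric])
  have m: "K \<in> borel_measurable borel" by (rule borel_measurable_continuous_onI[OF K])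
  fix l u :: "plane" assume le: "\<And>b. b \<in> Basis \<Longrightarrow> l \<bullet> b \<le> u \<bullet> b"
  have eq: "K -` box l u = K' ` box l u" using inv by (auto simp: image_iff) metis
  have "inj K'" using inv(1) by (metis injI)
  moreover have "K' ` box l u \<in> sets borel"
    using measurable_sets[OF m, of "box l u"] by (simp add: eq)
  ultimately have "emeasure lborel (K' ` box l u) = emeasure lborel (box l u)"
    by (intro emeasure_image_unimodular K')
  then show "emeasure (distr lborel borel K) (box l u) = (\<Prod>b\<in>Basis. (u - l) \<bullet> b)"
    using le m by (simp add: emeasure_distr eq)
qed simp

lemma unimodular_imp_continuous: "unimodular K \<Longrightarrow> continuous_on UNIV K"
proof (rule continuous_at_imp_continuous_on, rule ballI)
  fix z assume "unimodular K"
  from this[unfolded unimodular_def, THEN spec, of z]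
  show "isCont K z" using has_derivative_continuous by blast
qed

text \<open>
  The derivative of the twist is that of a rotation plus the rotated tangent vector of the level curves
  times the gradient of the angle. The angle being a function of the level, this gradient is orthogonal to
  the tangent vector, which leaves the determinant 1.
\<close>

lemma unimodular_twist: "unimodular (twist C)"
  unfolding unimodular_def
proof
  fix z :: "plane"
  define n where "n = round (fst z)"
  define x where "x = fst z - of_int n"
  define y where "y = snd z"
  define t where "t = twist_angle C (x, y)"
  define g where "g = flat_exp 2 (1 - level (x, y))"
  define ax where "ax = - C * g * 18 * x"
  define ay where "ay = - C * g * 2 * y"
  let ?D = "\<lambda>h. ((cos t + ax * (- sin t * x - cos t * y / 3)) * fst h + (- sin t / 3 + ay * (- sin t * x - cos t * y / 3)) * snd h,
      (3 * sin t + ax * (3 * cos t * x - sin t * y)) * fst h + (cos t + ay * (3 * cos t * x - sin t * y)) * snd h)"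
  have r: "\<bar>fst z - of_int n\<bar> < 2 / 3"
    using of_int_round_abs_le[of "fst z"] by (simp add: n_def abs_minus_commute)
  have dg: "(flat_exp 0 has_derivative (\<lambda>h. g * h)) (at (1 - level (x, y)))"
    using flat_exp_deriv[of 0 "1 - level (x, y)"] by (simp add: has_field_derivative_def g_def numeral_2_eq_2)
  have sh: "((\<lambda>w. (fst w - of_int n, snd w)) has_derivative (\<lambda>h. h)) (at z)"
    by (auto intro!: derivative_eq_intros)
  have "((\<lambda>w. 1 - level w) has_derivative (\<lambda>h. - (18 * x * fst h + 2 * y * snd h))) (at (x, y))"
    unfolding level_def by (auto intro!: derivative_eq_intros simp: algebra_simps)
  from has_derivative_compose[OF this dg]
  have "((\<lambda>w. flat_exp 0 (1 - level w)) has_derivative (\<lambda>h. g * - (18 * x * fst h + 2 * y * snd h))) (at (x, y))" .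
  from has_derivative_mult_right[OF this, of C]
  have da: "(twist_angle C has_derivative (\<lambda>h. ax * fst h + ay * snd h)) (at (x, y))"
    unfolding twist_angle_def[abs_def] ax_def ay_def by (rule has_derivative_eq_rhs) (auto simp: algebra_simps)
  have "(disc_twist C has_derivative ?D) (at (x, y))"
    unfolding disc_twist_def[abs_def] Let_def
    by (rule derivative_eq_intros da refl | simp)+ (auto simp: t_def[symmetric] algebra_simps)
  then have "((\<lambda>w. disc_twist C (fst w - of_int n, snd w)) has_derivative (\<lambda>h. ?D h)) (at z)"
    by (intro has_derivative_compose[OF sh]) (simp add: x_def y_def)
  then have "((\<lambda>w. disc_twist C (fst w - of_int n, snd w) + (of_int n, 0)) has_derivative ?D) (at z)"
    by (auto intro!: derivative_eq_intros)
  then have D: "(twist C has_derivative ?D) (at z)"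
  proof (rule has_derivative_transform_within_open)
    show "open {w :: plane. \<bar>fst w - of_int n\<bar> < 2 / 3}"
      by (intro open_Collect_less continuous_intros)
  qed (use r twist_eq[of _ n C] in auto)
  have sc: "cos t * cos t = 1 - sin t * sin t"
    using sin_cos_squared_add[of t] by (simp add: power2_eq_square)
  have "3 * x * ay = ax * y / 3" by (simp add: ax_def ay_def)
  then have "(cos t + ax * (- sin t * x - cos t * y / 3)) * (cos t + ay * (3 * cos t * x - sin t * y)) -
      (- sin t / 3 + ay * (- sin t * x - cos t * y / 3)) * (3 * sin t + ax * (3 * cos t * x - sin t * y)) = 1"
    using sc by algebra
  with D show "\<exists>a b c d. (twist C has_derivative (\<lambda>h. (a * fst h + b * snd h, c * fst h + d * snd h))) (at z) \<and>
      a * d - b * c = 1" by blast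
qed

lemma unimodular_narrow_twist:
  assumes q: "q \<noteq> 0" shows "unimodular (narrow_twist q C)"
  unfolding unimodular_def
proof
  fix z :: "plane"
  from unimodular_twist[unfolded unimodular_def, THEN spec, of C "squeeze q z"]
  obtain a b c d where D: "(twist C has_derivative (\<lambda>h. (a * fst h + b * snd h, c * fst h + d * snd h))) (at (squeeze q z))"
    "a * d - b * c = 1" by blast
  have "((\<lambda>z. twist C (squeeze q z)) has_derivative
     (\<lambda>h. (a * fst (squeeze q h) + b * snd (squeeze q h), c * fst (squeeze q h) + d * snd (squeeze q h)))) (at z)"
    by (rule has_derivative_compose[OF bounded_linear_imp_has_derivative[OF bounded_linear_squeeze] D(1)])
  from bounded_linear.has_derivative[OF bounded_linear_squeeze this, of "1 / q"]
  have "(narrow_twist q C has_derivative (\<lambda>h. (a * fst h + (b / q) * snd h, (c * q) * fst h + d * snd h))) (at z)"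
    unfolding narrow_twist_def[abs_def]
    by (rule has_derivative_eq_rhs) (use q in \<open>auto simp: squeeze_def field_simps\<close>)
  moreover have "a * d - (b / q) * (c * q) = 1" using D(2) q by simp
  ultimately show "\<exists>a b c d. (narrow_twist q C has_derivative (\<lambda>h. (a * fst h + b * snd h, c * fst h + d * snd h))) (at z) \<and>
      a * d - b * c = 1" by blast
qed

lemma narrow_twist_inverse: "q \<noteq> 0 \<Longrightarrow> narrow_twist q (- C) (narrow_twist q C z) = z"
  by (simp add: narrow_twist_def squeeze_squeeze twist_inverse)

lemma lborel_narrow_twist:
  assumes "q \<noteq> 0" shows "distr lborel borel (narrow_twist q C) = lborel"
proof (rule unimodular_imp_lborel[where K'="narrow_twist q (- C)"])
  show "narrow_twist q C (narrow_twist q (- C) z) = z" for z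
    using narrow_twist_inverse[OF assms, of "- C" z] by simp
qed (use assms in \<open>auto simp: narrow_twist_inverse unimodular_narrow_twist unimodular_imp_continuous\<close>)

lemma lborel_shift: "distr lborel borel (\<lambda>z :: plane. z + v) = lborel"
proof (rule unimodular_imp_lborel[where K'="\<lambda>z. z - v"])
  show "unimodular (\<lambda>z. z - v)"
    unfolding unimodular_def
  proof
    fix z
    have "((\<lambda>z. z - v) has_derivative (\<lambda>h. (1 * fst h + 0 * snd h, 0 * fst h + 1 * snd h))) (at z)"
      by (auto intro!: derivative_eq_intros)
    then show "\<exists>a b c d. ((\<lambda>z. z - v) has_derivative (\<lambda>h. (a * fst h + b * snd h, c * fst h + d * snd h))) (at z) \<and>
      a * d - b * c = 1"
      by - (rule exI[of _ 1], rule exI[of _ 0], rule exI[of _ 0], rule exI[of _ 1], simp)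
  qed
qed (auto intro!: continuous_intros)

text \<open>
  Both sets meet every orbit of the integer translations in \<open>E\<close> exactly once. Cut \<open>E \<inter> F1\<close> into the
  countably many pieces that are moved into \<open>F2\<close> by a given translation, and move them.
\<close>

lemma emeasure_fundamental_domains:
  fixes E F1 F2 :: "plane set"
  assumes E: "E \<in> sets borel" "\<And>z n. z \<in> E \<Longrightarrow> z + (of_int n, 0) \<in> E"
    and F1: "F1 \<in> sets borel" "\<And>z. z \<in> E \<Longrightarrow> \<exists>!n::int. z + (of_int n, 0) \<in> F1"
    and F2: "F2 \<in> sets borel" "\<And>z. z \<in> E \<Longrightarrow> \<exists>!n::int. z + (of_int n, 0) \<in> F2"
  shows "emeasure lborel (E \<inter> F1) = emeasure lborel (E \<inter> F2)"
proof -
  define \<tau> where "\<tau> n z = z + (of_int n, 0)" for n :: int and z :: "plane"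
  have \<tau>m: "\<tau> n \<in> borel_measurable borel" for n
    unfolding \<tau>_def[abs_def] by (intro borel_measurable_continuous_onI continuous_intros)
  have vm: "\<tau> n -` A \<in> sets borel" if "A \<in> sets borel" for n A
    using measurable_sets[OF \<tau>m that] by simp
  have \<tau>l: "emeasure lborel (\<tau> n -` A) = emeasure lborel A" if "A \<in> sets borel" for n A
    by (subst (2) lborel_shift[of "(of_int n, 0)", symmetric])
       (use \<tau>m[of n] that in \<open>simp add: emeasure_distr \<tau>_def[abs_def]\<close>)
  define X where "X n = E \<inter> F1 \<inter> \<tau> n -` F2" for n
  define Y where "Y n = E \<inter> F2 \<inter> \<tau> (- n) -` F1" for n
  have inv: "\<tau> n z \<in> E \<longleftrightarrow> z \<in> E" for n z
  proof
    have "\<tau> n z + (of_int (- n), 0) = z" by (simp add: \<tau>_def prod_eq_iff)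
    then show "\<tau> n z \<in> E \<Longrightarrow> z \<in> E" using E(2)[of "\<tau> n z" "- n"] by simp
  qed (auto simp: \<tau>_def intro: E(2))
  have XY: "X n = \<tau> n -` Y n" for n
  proof -
    have "\<tau> (- n) (\<tau> n z) = z" for z by (simp add: \<tau>_def prod_eq_iff)
    then have "z \<in> X n \<longleftrightarrow> \<tau> n z \<in> Y n" for z by (simp add: X_def Y_def inv) blast
    then show ?thesis by blast
  qed
  have ex: "\<exists>n. \<tau> n z \<in> F" and uniq: "\<tau> m z \<in> F \<Longrightarrow> \<tau> n z \<in> F \<Longrightarrow> m = n"
    if "z \<in> E" "F = F1 \<or> F = F2" for z m n F
    using F1(2)[OF that(1)] F2(2)[OF that(1)] that(2) unfolding \<tau>_def by auto
  have X: "E \<inter> F1 = (\<Union>n. X n)"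
    using ex[of _ F2] by (auto simp: X_def)
  have Y: "E \<inter> F2 = (\<Union>n. Y n)"
  proof -
    have "\<exists>n. \<tau> (- n) z \<in> F1" if "z \<in> E" for z
      using ex[OF that, of F1] by (metis minus_minus)
    then show ?thesis by (auto simp: Y_def)
  qed
  have dX: "disjoint_family X"
    unfolding disjoint_family_on_def X_def using uniq[of _ F2] by auto
  have dY: "disjoint_family Y"
    unfolding disjoint_family_on_def
  proof (intro ballI impI equals0I)
    fix m n :: int and z assume "m \<noteq> n" "z \<in> Y m \<inter> Y n"
    then have "- m = - n" by (intro uniq[of z F1]) (auto simp: Y_def)
    then show False using \<open>m \<noteq> n\<close> by simp
  qed
  have mX: "X n \<in> sets lborel" and mY: "Y n \<in> sets lborel" for n
    unfolding X_def Y_def using E F1 F2 vm by auto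
  have "emeasure lborel (E \<inter> F1) = (\<integral>\<^sup>+n. emeasure lborel (X n) \<partial>count_space UNIV)"
    unfolding X by (rule emeasure_UN_countable) (use mX dX in auto)
  also have "\<dots> = (\<integral>\<^sup>+n. emeasure lborel (Y n) \<partial>count_space UNIV)"
    using \<tau>l mY by (simp add: XY)
  also have "\<dots> = emeasure lborel (E \<inter> F2)"
    unfolding Y by (rule emeasure_UN_countable[symmetric]) (use mY dY in auto)
  finally show ?thesis .
qed

text \<open>The fundamental domain in the definition of \<open>area\<close>.\<close>

definition unit_cell :: "plane set" where
  "unit_cell = {0..<1} \<times> {- 1..1}"

lemma unit_cell_borel [measurable]: "unit_cell \<in> sets borel"
  unfolding unit_cell_def borel_prod[symmetric] by (intro pair_measureI) auto

lemma strip_borel [measurable]: "strip \<in> sets borel"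
  unfolding strip_def by (intro borel_closed closed_Times) auto

lemma closed_annulus: "closed annulus"
  unfolding annulus_def by (intro closed_Times) auto

lemma cover_measurable: "cover \<in> borel_measurable borel"
  by (rule borel_measurable_continuous_onI[OF continuous_on_cover])

lemma sets_area: "sets area = sets annulus_borel" and space_area: "space area = annulus"
  by (simp_all add: area_def space_annulus_borel)

lemma sets_annulus_borel: "A \<in> sets annulus_borel \<longleftrightarrow> A \<in> sets borel \<and> A \<subseteq> annulus"
  unfolding annulus_borel_def using closed_annulus by (subst sets_restrict_space_iff) auto

lemma unit_cell_subset_strip: "unit_cell \<subseteq> strip"
  by (auto simp: unit_cell_def strip_def)

lemma emeasure_area:
  assumes "A \<in> sets annulus_borel"
  shows "emeasure area A = emeasure lborel (strip \<inter> cover -` A \<inter> unit_cell)"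
proof -
  have A: "A \<in> sets borel" using assms by (simp add: sets_annulus_borel)
  have "cover \<in> restrict_space lborel unit_cell \<rightarrow>\<^sub>M annulus_borel"
    unfolding annulus_borel_def using unit_cell_subset_strip cover_in_annulus cover_measurable
    by (intro measurable_restrict_space2 measurable_restrict_space1) (auto simp: space_restrict_space)
  then have "emeasure area A = emeasure (restrict_space lborel unit_cell) (cover -` A \<inter> unit_cell)"
    unfolding area_def unit_cell_def[symmetric] using assms
    by (subst emeasure_distr) (auto simp: space_restrict_space)
  also have "\<dots> = emeasure lborel (cover -` A \<inter> unit_cell)"
    by (rule emeasure_restrict_space) auto
  also have "cover -` A \<inter> unit_cell = strip \<inter> cover -` A \<inter> unit_cell" using unit_cell_subset_strip by auto
  finally show ?thesis .
qed

lemma finite_measure_area: "finite_measure area"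
proof (rule finite_measureI)
  have "emeasure lborel unit_cell \<le> emeasure lborel (cbox (0 :: real, - 1 :: real) (1, 1))"
    by (intro emeasure_mono borel_closed[THEN sets_lborel[THEN equalityD2, THEN subsetD]] closed_cbox)
       (auto simp: unit_cell_def cbox_Pair_eq)
  also have "\<dots> < \<infinity>" by (rule emeasure_lborel_cbox_finite)
  finally have "emeasure lborel unit_cell \<noteq> \<infinity>" by simp
  moreover have "emeasure area annulus \<le> emeasure lborel unit_cell"
    using closed_annulus by (subst emeasure_area) (auto simp: sets_annulus_borel intro!: emeasure_mono)
  ultimately show "emeasure area (space area) \<noteq> \<infinity>"
    by (simp add: space_area) (metis infinity_ennreal_def neq_top_trans)
qed

lemma measurable_annulus:
  assumes "continuous_on annulus f" "\<And>a. a \<in> annulus \<Longrightarrow> f a \<in> annulus"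
  shows "f \<in> measurable area area"
proof -
  have "f \<in> measurable annulus_borel annulus_borel"
    unfolding annulus_borel_def
    by (intro measurable_restrict_space2 borel_measurable_continuous_on_restrict assms)
       (use assms in \<open>auto simp: space_restrict_space\<close>)
  then show ?thesis by (simp add: measurable_cong_sets[OF sets_area sets_area])
qed

lemma measure_preserving_compose:
  assumes "measure_preserving M f" "measure_preserving M g" shows "measure_preserving M (\<lambda>x. f (g x))"
proof -
  have f: "f \<in> measurable M M" "distr M M f = M" and g: "g \<in> measurable M M" "distr M M g = M"
    using assms by (auto simp: measure_preserving_def)
  have "distr M M (\<lambda>x. f (g x)) = distr (distr M M g) M f"
    by (subst distr_distr[OF f(1) g(1)]) (simp add: comp_def)
  then show ?thesis using f g by (auto simp: measure_preserving_def intro: measurable_compose)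
qed

lemma measure_preserving_cong:
  assumes "\<And>x. x \<in> space M \<Longrightarrow> f x = g x" "measure_preserving M f" shows "measure_preserving M g"
  using assms measurable_cong[of M f g M] distr_cong[of M M M M f g] by (auto simp: measure_preserving_def)

text \<open>
  The preimage of the fundamental domain under an equivariant bijection is again a fundamental domain, so it
  may replace the original one when the area of a preimage is computed.
\<close>

lemma measure_preserving_descend:
  assumes K: "distr lborel borel K = lborel" "continuous_on UNIV K"
    and eq: "\<And>z. K (z + (1, 0)) = K z + (1, 0)" and st: "\<And>z. K z \<in> strip \<longleftrightarrow> z \<in> strip"
  shows "measure_preserving area (descend K)"
proof -
  have e: "equivariant K" using eq st by (simp add: equivariant_def)
  have m: "descend K \<in> measurable area area"
    by (intro measurable_annulus continuous_on_descend e descend_in_annulus continuous_on_subset[OF K(2)]) auto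
  have mK: "K \<in> borel_measurable borel" by (rule borel_measurable_continuous_onI[OF K(2)])
  have "distr area area (descend K) = area"
  proof (rule measure_eqI)
    fix A assume "A \<in> sets (distr area area (descend K))"
    then have A: "A \<in> sets annulus_borel" by (simp add: sets_area)
    then have Ab: "A \<in> sets borel" by (simp add: sets_annulus_borel)
    have A': "descend K -` A \<inter> annulus \<in> sets annulus_borel"
      using measurable_sets[OF m, of A] A by (simp add: sets_area space_area)
    define E where "E = strip \<inter> cover -` A"
    have E: "E \<in> sets borel" unfolding E_def
      using measurable_sets[OF cover_measurable Ab] by auto
    have E': "strip \<inter> cover -` (descend K -` A \<inter> annulus) = K -` E"
    proof (intro set_eqI)
      fix z
      show "z \<in> strip \<inter> cover -` (descend K -` A \<inter> annulus) \<longleftrightarrow> z \<in> K -` E"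
        using descend_cover[OF e, of z] cover_in_annulus[of z] st[of z] by (simp add: E_def) metis
    qed
    have KE: "K -` E \<in> sets borel" using measurable_sets[OF mK E] by simp
    have unit_cell_unique: "\<exists>!n::int. z + (of_int n, 0) \<in> unit_cell" if "z \<in> strip" for z
    proof (rule ex1I[of _ "- \<lfloor>fst z\<rfloor>"])
      show "z + (of_int (- \<lfloor>fst z\<rfloor>), 0) \<in> unit_cell"
        using that frac_ge_0[of "fst z"] frac_lt_1[of "fst z"]
        by (auto simp: unit_cell_def strip_def mem_Times_iff frac_def)
      fix n :: int assume "z + (of_int n, 0) \<in> unit_cell"
      then have "0 \<le> fst z + of_int n" "fst z + of_int n < 1" by (auto simp: unit_cell_def mem_Times_iff)
      then have "\<lfloor>fst z\<rfloor> = - n" by (intro floor_unique) auto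
      then show "n = - \<lfloor>fst z\<rfloor>" by simp
    qed
    have "emeasure (distr area area (descend K)) A = emeasure area (descend K -` A \<inter> annulus)"
      using A m by (subst emeasure_distr) (auto simp: sets_area space_area)
    also have "\<dots> = emeasure lborel (K -` E \<inter> unit_cell)"
      unfolding emeasure_area[OF A'] E' ..
    also have "\<dots> = emeasure lborel (K -` E \<inter> K -` unit_cell)"
    proof (rule emeasure_fundamental_domains[OF KE _ unit_cell_borel])
      fix z n assume z: "z \<in> K -` E"
      then have zs: "z \<in> strip" using st by (auto simp: E_def)
      have Kn: "K (z + (of_int n, 0)) = K z + (of_int n, 0)" for n by (rule equivariant_add_int[OF e zs])
      show "z + (of_int n, 0) \<in> K -` E" using z unfolding vimage_def E_def by (simp add: Kn)
      show "\<exists>!n::int. z + (of_int n, 0) \<in> unit_cell" by (rule unit_cell_unique[OF zs])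
      show "\<exists>!n::int. z + (of_int n, 0) \<in> K -` unit_cell"
        using unit_cell_unique[of "K z"] zs st by (simp add: Kn)
    qed (use measurable_sets[OF mK unit_cell_borel] in simp)
    also have "\<dots> = emeasure lborel (K -` (E \<inter> unit_cell))" by (simp add: vimage_Int)
    also have "\<dots> = emeasure lborel (E \<inter> unit_cell)"
      by (subst (2) K(1)[symmetric]) (use mK E in \<open>simp add: emeasure_distr\<close>)
    also have "\<dots> = emeasure area A" by (simp add: emeasure_area[OF A] E_def)
    finally show "emeasure (distr area area (descend K)) A = emeasure area A" .
  qed simp
  with m show ?thesis by (simp add: measure_preserving_def)
qed

text \<open>
  Let \<open>g\<close> be an area preserving map close to \<open>f\<close>, \<open>C\<close> a closed set and \<open>U\<close> a small neighbourhood of it. Then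
  the preimage of \<open>C\<close> under \<open>f\<close> lies in the preimage of \<open>U\<close> under \<open>g\<close>, and vice versa. Shrinking \<open>U\<close> to \<open>C\<close> gives
  both inequalities for \<open>C\<close>, and closed sets generate the Borel sets.
\<close>

lemma measure_preserving_uniform_limit:
  assumes lim: "\<And>\<epsilon>. \<epsilon> > 0 \<Longrightarrow> \<exists>g. measure_preserving area g \<and> (\<forall>a\<in>annulus. dist (g a) (f a) < \<epsilon>)"
    and f: "f \<in> measurable area area"
  shows "measure_preserving area f"
proof -
  interpret finite_measure area by (rule finite_measure_area)
  have idm: "(\<lambda>a. a) \<in> borel_measurable area"
    by (simp add: measurable_cong_sets[OF sets_area refl] annulus_borel_def measurable_restrict_space1)
  have fm: "f \<in> borel_measurable area" using measurable_compose[OF f idm] .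
  have in_sets: "A \<inter> annulus \<in> sets area" if "A \<in> sets borel" for A
    using that closed_annulus by (simp add: sets_area sets_annulus_borel)
  have f_in: "f a \<in> annulus" if "a \<in> annulus" for a
    using measurable_space[OF f] that by (simp add: space_area)
  have closed_eq: "measure area (f -` C \<inter> annulus) = measure area (C \<inter> annulus)" if C: "closed C" for C
  proof (cases "C = {}")
    case False
    define U where "U j = {a. infdist a C < 1 / real (Suc j)}" for j
    have oU: "open (U j)" for j unfolding U_def by (intro open_Collect_less continuous_intros)
    have CU: "C = (\<Inter>j. U j)"
    proof (intro equalityI subsetI)
      fix a assume a: "a \<in> (\<Inter>j. U j)"
      have "infdist a C \<le> 0"
      proof (rule ccontr)
        assume "\<not> ?thesis"
        then obtain j where "1 / real (Suc j) < infdist a C" by (meson nat_approx_posE not_le)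
        moreover have "a \<in> U j" using a by blast
        ultimately show False by (simp add: U_def)
      qed
      then show "a \<in> C" using in_closed_iff_infdist_zero[OF C False] infdist_nonneg[of a C] by simp
    qed (auto simp: U_def)
    have decU: "U (Suc j) \<subseteq> U j" for j
      unfolding U_def by (auto elim!: less_le_trans intro!: frac_le)
    have near: "a \<in> U j" if "b \<in> C" "dist b a < 1 / real (Suc j)" for a b j
      using infdist_le[OF that(1), of a] that(2) by (simp add: U_def dist_commute)
    have 1: "measure area (f -` C \<inter> annulus) \<le> measure area (U j \<inter> annulus)"
      and 2: "measure area (C \<inter> annulus) \<le> measure area (f -` U j \<inter> annulus)" for j
    proof -
      obtain g where g: "measure_preserving area g" "\<And>a. a \<in> annulus \<Longrightarrow> dist (g a) (f a) < 1 / real (Suc j)"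
        using lim[of "1 / real (Suc j)"] by auto
      have gm: "g \<in> measurable area area" and gd: "distr area area g = area"
        using g(1) by (auto simp: measure_preserving_def)
      have g_in: "g a \<in> annulus" if "a \<in> annulus" for a
        using measurable_space[OF gm] that by (simp add: space_area)
      have gA: "measure area (g -` A \<inter> annulus) = measure area (A \<inter> annulus)"
        and gS: "g -` A \<inter> annulus \<in> sets area" if "A \<in> sets borel" for A
      proof -
        have eq: "g -` (A \<inter> annulus) \<inter> space area = g -` A \<inter> annulus" using g_in by (auto simp: space_area)
        have "measure (distr area area g) (A \<inter> annulus) = measure area (g -` (A \<inter> annulus) \<inter> space area)"
          by (rule measure_distr[OF gm in_sets[OF that]])
        then show "measure area (g -` A \<inter> annulus) = measure area (A \<inter> annulus)" by (simp only: gd eq)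
        show "g -` A \<inter> annulus \<in> sets area"
          using measurable_sets[OF gm in_sets[OF that]] by (simp only: eq)
      qed
      have "measure area (f -` C \<inter> annulus) \<le> measure area (g -` U j \<inter> annulus)"
      proof (intro finite_measure_mono gS borel_open oU subsetI IntI vimageI2)
        fix a assume a: "a \<in> f -` C \<inter> annulus"
        then show "g a \<in> U j" using g(2)[of a] by (intro near[of "f a"]) (simp_all add: dist_commute)
      qed auto
      then show "measure area (f -` C \<inter> annulus) \<le> measure area (U j \<inter> annulus)"
        using gA[of "U j"] oU by simp
      have "measure area (g -` C \<inter> annulus) \<le> measure area (f -` U j \<inter> annulus)"
      proof (intro finite_measure_mono subsetI IntI vimageI2)
        fix a assume a: "a \<in> g -` C \<inter> annulus"
        then show "f a \<in> U j" using g(2)[of a] by (intro near[of "g a"]) simp_all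
        show "a \<in> annulus" using a by simp
      next
        show "f -` U j \<inter> annulus \<in> sets area"
          using measurable_sets[OF fm borel_open[OF oU]] by (simp only: space_area)
      qed
      then show "measure area (C \<inter> annulus) \<le> measure area (f -` U j \<inter> annulus)"
        using gA[of C] C by simp
    qed
    have "(\<lambda>j. measure area (U j \<inter> annulus)) \<longlonglongrightarrow> measure area (\<Inter>j. U j \<inter> annulus)"
      by (rule finite_Lim_measure_decseq) (use in_sets oU decU in \<open>auto simp: decseq_Suc_iff\<close>)
    also have "(\<Inter>j. U j \<inter> annulus) = C \<inter> annulus" unfolding CU by auto
    finally have l1: "(\<lambda>j. measure area (U j \<inter> annulus)) \<longlonglongrightarrow> measure area (C \<inter> annulus)" .
    have "(\<lambda>j. measure area (f -` U j \<inter> annulus)) \<longlonglongrightarrow> measure area (\<Inter>j. f -` U j \<inter> annulus)"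
    proof (rule finite_Lim_measure_decseq)
      show "range (\<lambda>j. f -` U j \<inter> annulus) \<subseteq> sets area"
        using measurable_sets[OF fm] oU by (auto simp: space_area)
      show "decseq (\<lambda>j. f -` U j \<inter> annulus)" using decU by (auto simp: decseq_Suc_iff)
    qed
    also have "(\<Inter>j. f -` U j \<inter> annulus) = f -` C \<inter> annulus" unfolding CU by auto
    finally have l2: "(\<lambda>j. measure area (f -` U j \<inter> annulus)) \<longlonglongrightarrow> measure area (f -` C \<inter> annulus)" .
    show ?thesis
      using LIMSEQ_le_const[OF l1, of "measure area (f -` C \<inter> annulus)"]
        LIMSEQ_le_const[OF l2, of "measure area (C \<inter> annulus)"] 1 2 by (intro antisym) auto
  qed simp
  have "distr area borel f = distr area borel (\<lambda>a. a)"
  proof (rule measure_eqI_generator_eq[where E="Collect closed" and \<Omega>=UNIV and A="\<lambda>_. UNIV"])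
    show "Int_stable (Collect closed)" by (auto simp: Int_stable_def)
    show "sets (distr area borel f) = sigma_sets UNIV (Collect closed)"
      "sets (distr area borel (\<lambda>a. a)) = sigma_sets UNIV (Collect closed)"
      by (simp_all add: borel_eq_closed)
    show "emeasure (distr area borel f) C = emeasure (distr area borel (\<lambda>a. a)) C" if "C \<in> Collect closed" for C
      using that fm idm closed_eq[of C]
      by (simp add: emeasure_distr space_area emeasure_eq_measure vimage_def Int_def)
    show "emeasure (distr area borel f) UNIV \<noteq> \<infinity>" for i :: nat
      using fm by (simp add: emeasure_distr emeasure_eq_measure)
  qed auto
  then have eq: "emeasure (distr area borel f) A = emeasure (distr area borel (\<lambda>a. a)) A" for A by simp
  have "distr area area f = area"
  proof (rule measure_eqI)
    fix A assume "A \<in> sets (distr area area f)"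
    then have A: "A \<in> sets area" by simp
    then have Ab: "A \<in> sets borel" "A \<subseteq> annulus" by (simp_all add: sets_area sets_annulus_borel)
    have "emeasure (distr area area f) A = emeasure area (f -` A \<inter> annulus)"
      using emeasure_distr[OF f A] by (simp add: space_area)
    also have "\<dots> = emeasure area ((\<lambda>a. a) -` A \<inter> annulus)"
      using eq[of A] emeasure_distr[OF fm Ab(1)] emeasure_distr[OF idm Ab(1)] by (simp add: space_area)
    also have "(\<lambda>a. a) -` A \<inter> annulus = A" using Ab(2) by auto
    finally show "emeasure (distr area area f) A = emeasure area A" .
  qed simp
  with f show ?thesis by (simp add: measure_preserving_def)
qed

lemma narrow_twist_strip: "narrow_twist q C z \<in> strip \<longleftrightarrow> z \<in> strip" if "q \<noteq> 0"
proof -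
  have "twist C w \<in> strip \<longleftrightarrow> w \<in> strip" for w
    using twist_strip[of w C] twist_strip[of "twist C w" "- C"] by (auto simp: twist_inverse)
  then show ?thesis by (simp add: narrow_twist_def)
qed

section \<open>Conjugated rotations\<close>

text \<open>This is the commutation with the rotation by \<open>p / q\<close> on which the method rests.\<close>

lemma narrow_twist_add_fraction:
  assumes "q \<noteq> 0"
  shows "narrow_twist (of_int q) C (z + (of_int p / of_int q, 0)) = narrow_twist (of_int q) C z + (of_int p / of_int q, 0)"
proof -
  have "squeeze (of_int q) (z + (of_int p / of_int q, 0)) = squeeze (of_int q) z + (of_int p, 0)"
    using assms by (simp add: squeeze_def prod_eq_iff field_simps)
  then show ?thesis unfolding narrow_twist_def
    by (simp add: twist_add_int squeeze_add squeeze_shift)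
qed

lemma narrow_twist_add_one:
  assumes "q \<noteq> 0" shows "narrow_twist (of_int q) C (z + (1, 0)) = narrow_twist (of_int q) C z + (1, 0)"
  using narrow_twist_add_fraction[OF assms, of C z q] assms by simp

lemma tame_narrow_twist: "tame (narrow_twist q C) strip"
proof -
  have "tame (\<lambda>z. twist C (squeeze q z)) strip"
    by (rule tame_compose[OF tame_twist tame_linear[OF bounded_linear_squeeze]]) (intro image_subsetI, simp)
  then show ?thesis unfolding narrow_twist_def[abs_def] by (rule tame_bounded_linear[OF bounded_linear_squeeze])
qed

lemma narrow_twist_boundary: "q \<noteq> 0 \<Longrightarrow> \<bar>snd z\<bar> = 1 \<Longrightarrow> narrow_twist q C z = z"
  unfolding narrow_twist_def by (subst twist_boundary) (simp_all add: squeeze_squeeze, simp add: squeeze_def)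

text \<open>
  The lifts of an area preserving diffeomorphism and of its inverse. The diffeomorphisms used for conjugation
  are finite compositions of twists and fix the boundary pointwise.
\<close>

definition conj_pair :: "(plane \<Rightarrow> plane) \<Rightarrow> (plane \<Rightarrow> plane) \<Rightarrow> bool" where
  "conj_pair h h' \<longleftrightarrow> strip_inverses h h' \<and> tame h strip \<and> tame h' strip \<and>
     (\<forall>z. \<bar>snd z\<bar> = 1 \<longrightarrow> h z = z) \<and>
     measure_preserving area (descend h) \<and> measure_preserving area (descend h')"

lemma conj_pairD:
  assumes "conj_pair h h'"
  shows "equivariant h" "equivariant h'" "\<And>z. z \<in> strip \<Longrightarrow> h' (h z) = z" "\<And>z. z \<in> strip \<Longrightarrow> h (h' z) = z"
    "tame h strip" "tame h' strip" "\<And>z. \<bar>snd z\<bar> = 1 \<Longrightarrow> h z = z"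
    "measure_preserving area (descend h)" "measure_preserving area (descend h')"
    "\<And>z. z \<in> strip \<Longrightarrow> h z \<in> strip" "\<And>z. z \<in> strip \<Longrightarrow> h' z \<in> strip"
  using assms by (auto simp: conj_pair_def strip_inverses_def equivariant_def)

lemma equivariant_id: "equivariant (\<lambda>z. z)"
  by (simp add: equivariant_def)

lemma measure_preserving_id: "measure_preserving area (descend (\<lambda>z. z))"
proof (rule measure_preserving_cong)
  show "measure_preserving area (\<lambda>a. a)" by (simp add: measure_preserving_def distr_id2)
  show "a = descend (\<lambda>z. z) a" if "a \<in> space area" for a
    using that by (simp add: space_area descend_def cover_base_point)
qed

lemma tame_ident: "tame (\<lambda>z. z) S"
  by (rule tame_linear[OF bounded_linear_ident])

lemma conj_pair_id: "conj_pair (\<lambda>z. z) (\<lambda>z. z)"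
  by (simp add: conj_pair_def strip_inverses_def equivariant_id tame_ident measure_preserving_id)

lemma measure_preserving_descend_compose:
  assumes "equivariant F" "equivariant G" "measure_preserving area (descend F)" "measure_preserving area (descend G)"
  shows "measure_preserving area (descend (\<lambda>z. F (G z)))"
  by (rule measure_preserving_cong[OF _ measure_preserving_compose[OF assms(3,4)]])
     (simp add: descend_compose[OF assms(1,2)] space_area)

lemma conj_pair_narrow_twist:
  fixes q :: int
  assumes q: "q \<noteq> 0" shows "conj_pair (narrow_twist q C) (narrow_twist q (- C))"
proof -
  have q': "real_of_int q \<noteq> 0" using q by simp
  have e: "equivariant (narrow_twist q C)" for C
    by (simp add: equivariant_def narrow_twist_strip[OF q'] narrow_twist_add_one[OF q])
  have mp: "measure_preserving area (descend (narrow_twist q C))" for C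
    by (rule measure_preserving_descend[OF lborel_narrow_twist[OF q']
          unimodular_imp_continuous[OF unimodular_narrow_twist[OF q']]
          narrow_twist_add_one[OF q] narrow_twist_strip[OF q']])
  show ?thesis
    using narrow_twist_inverse[OF q', of C] narrow_twist_inverse[OF q', of "- C"]
    by (simp add: conj_pair_def strip_inverses_def e mp tame_narrow_twist narrow_twist_boundary[OF q'])
qed

lemma conj_pair_compose:
  assumes 1: "conj_pair h h'" and 2: "conj_pair k k'"
  shows "conj_pair (\<lambda>z. h (k z)) (\<lambda>z. k' (h' z))"
proof -
  note h = conj_pairD[OF 1] and k = conj_pairD[OF 2]
  have t: "tame (\<lambda>z. h (k z)) strip" "tame (\<lambda>z. k' (h' z)) strip"
    using tame_compose[OF h(5) k(5)] tame_compose[OF k(6) h(6)] h(11) k(10) by blast+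
  have e: "equivariant (\<lambda>z. h (k z))" "equivariant (\<lambda>z. k' (h' z))"
    by (rule equivariant_compose[OF h(1) k(1)], rule equivariant_compose[OF k(2) h(2)])
  have m: "measure_preserving area (descend (\<lambda>z. h (k z)))" "measure_preserving area (descend (\<lambda>z. k' (h' z)))"
    by (rule measure_preserving_descend_compose[OF h(1) k(1) h(8) k(8)],
        rule measure_preserving_descend_compose[OF k(2) h(2) k(9) h(9)])
  have b: "h (k z) = z" if "\<bar>snd z\<bar> = 1" for z
    using k(7)[OF that] h(7)[OF that] by metis
  have i: "k' (h' (h (k z))) = z \<and> h (k (k' (h' z))) = z" if "z \<in> strip" for z
    using h(3)[OF k(10)[OF that]] k(3)[OF that] k(4)[OF h(11)[OF that]] h(4)[OF that] by metis
  show ?thesis unfolding conj_pair_def strip_inverses_def using t e m b i by blast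
qed

definition conj_rotation :: "real \<Rightarrow> (plane \<Rightarrow> plane) \<Rightarrow> (plane \<Rightarrow> plane) \<Rightarrow> plane \<Rightarrow> plane" where
  "conj_rotation \<alpha> h h' z = h (h' z + (\<alpha>, 0))"

lemma equivariant_conj_rotation:
  assumes "conj_pair h h'" shows "equivariant (conj_rotation \<alpha> h h')"
  unfolding conj_rotation_def[abs_def]
  by (rule equivariant_compose[OF conj_pairD(1)[OF assms] equivariant_compose[OF equivariant_shift conj_pairD(2)[OF assms]]])

lemma measure_preserving_conj_rotation:
  assumes "conj_pair h h'" shows "measure_preserving area (descend (conj_rotation \<alpha> h h'))"
proof -
  have s: "measure_preserving area (descend (\<lambda>z. z + (\<alpha>, 0)))"
    by (rule measure_preserving_descend[OF lborel_shift]) (auto intro!: continuous_intros simp: algebra_simps)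
  note h = conj_pairD[OF assms]
  show ?thesis unfolding conj_rotation_def[abs_def]
    by (rule measure_preserving_descend_compose[OF h(1) equivariant_compose[OF equivariant_shift h(2)] h(8)
          measure_preserving_descend_compose[OF equivariant_shift h(2) s h(9)]])
qed

lemma conj_rotation_funpow:
  assumes "conj_pair h h'" "z \<in> strip"
  shows "(conj_rotation \<alpha> h h' ^^ j) z = h (h' z + (real j * \<alpha>, 0))"
proof (induction j)
  case 0
  then show ?case using conj_pairD(4)[OF assms] by (simp add: zero_prod_def[symmetric])
next
  case (Suc j)
  have "h' (h (h' z + (real j * \<alpha>, 0))) = h' z + (real j * \<alpha>, 0)"
    using conj_pairD(3,11)[OF assms(1)] assms(2) by simp
  then have "conj_rotation \<alpha> h h' (h (h' z + (real j * \<alpha>, 0))) = h (h' z + (real (Suc j) * \<alpha>, 0))"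
    by (simp add: conj_rotation_def algebra_simps)
  then show ?case by (simp add: Suc)
qed

text \<open>
  By Dirichlet's theorem some multiple \<open>q * \<alpha>\<close> differs from an integer by a nonzero \<open>b\<close> smaller than \<open>\<theta>\<close>.
  The multiples of \<open>b\<close> advance around the circle in steps smaller than \<open>\<theta>\<close>, and after \<open>1 / \<bar>b\<bar>\<close> steps they have
  gone around it; this bounds the time independently of the points.
\<close>

lemma orbit_dense_uniformly:
  fixes \<alpha> \<theta> :: real
  assumes irr: "\<alpha> \<notin> \<rat>" and \<theta>: "\<theta> > 0"
  obtains N :: nat where "\<And>x y. \<exists>j\<le>N. \<exists>l::int. \<bar>x + real j * \<alpha> - (y + of_int l)\<bar> < \<theta>"
proof -
  obtain M :: nat where M: "M > 0" "1 / real M < \<theta>"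
    using nat_approx_posE[OF \<theta>] by (metis zero_less_Suc)
  obtain p q where pq: "0 < q" "q \<le> int M" "\<bar>of_int q * \<alpha> - of_int p\<bar> < 1 / real M"
    using Dirichlet_approx_coprime[OF M(1), of \<alpha>] by metis
  define b where "b = of_int q * \<alpha> - of_int p"
  have b0: "b \<noteq> 0"
  proof
    assume "b = 0"
    then have "\<alpha> = of_int p / of_int q" using pq(1) by (simp add: b_def field_simps)
    then show False using irr by (metis Rats_divide Rats_of_int)
  qed
  have b: "\<bar>b\<bar> < \<theta>" using pq(3) M(2) by (simp add: b_def)
  define N where "N = nat q * nat \<lceil>1 / \<bar>b\<bar>\<rceil>"
  have "\<exists>j\<le>N. \<exists>l::int. \<bar>x + real j * \<alpha> - (y + of_int l)\<bar> < \<theta>" for x y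
  proof -
    \<comment> \<open>The representative of \<open>y - x\<close> modulo 1 that the nonnegative multiples of \<open>b\<close> reach first.\<close>
    define d where "d = sgn b * frac (sgn b * (y - x))"
    define i where "i = nat \<lfloor>d / b\<rfloor>"
    have sgn2: "sgn b * sgn b = 1" using b0 by (auto simp: sgn_if)
    have db: "d / b = frac (sgn b * (y - x)) / \<bar>b\<bar>"
      using b0 by (auto simp: d_def sgn_if abs_if field_simps)
    have f: "0 \<le> frac (sgn b * (y - x))" "frac (sgn b * (y - x)) < 1"
      by (simp_all add: frac_lt_1)
    have i0: "0 \<le> d / b" unfolding db using f by simp
    have ile: "d / b \<le> 1 / \<bar>b\<bar>" unfolding db using f by (intro divide_right_mono) auto
    then have "\<lfloor>d / b\<rfloor> \<le> \<lceil>1 / \<bar>b\<bar>\<rceil>" by linarith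
    then have iN: "nat q * i \<le> N" unfolding i_def N_def by (intro mult_left_mono nat_mono) auto
    have ri: "real i = of_int \<lfloor>d / b\<rfloor>" using i0 by (simp add: i_def)
    have "\<bar>real i * b - d\<bar> < \<theta>"
    proof -
      have "real i * b - d = - (frac (d / b) * b)" using b0 by (simp add: ri frac_def algebra_simps)
      also have "\<bar>\<dots>\<bar> \<le> 1 * \<bar>b\<bar>" unfolding abs_minus_cancel abs_mult
        using frac_lt_1[of "d / b"] frac_ge_0[of "d / b"] by (intro mult_right_mono) auto
      finally show ?thesis using b by simp
    qed
    moreover have "d = y - x + of_int (- sgn (if b > 0 then 1 else -1) * \<lfloor>sgn b * (y - x)\<rfloor>)"
      using b0 by (auto simp: d_def frac_def sgn_if algebra_simps)
    then obtain m :: int where "d = y - x + of_int m" by blast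
    moreover have "x + real (nat q * i) * \<alpha> - (y + of_int (m + int i * p)) = real i * b - (y - x + of_int m)"
      using pq(1) by (simp add: b_def algebra_simps)
    ultimately show ?thesis using iN by metis
  qed
  then show thesis by (rule that)
qed

text \<open>
  The two properties to be inherited by the limit: orbits come within \<open>1 / n\<close> of the boundary, and some number
  of iterations determines the mean displacement up to \<open>1 / n\<close>.
\<close>

definition escaping :: "real \<Rightarrow> nat \<Rightarrow> (plane \<Rightarrow> plane) \<Rightarrow> bool" where
  "escaping \<alpha> n F \<longleftrightarrow> (\<forall>z\<in>strip. \<exists>j. \<bar>snd ((F ^^ j) z)\<bar> > 1 - 1 / real n) \<and>
     (\<exists>J::nat. J > 0 \<and> (\<forall>z\<in>strip. \<bar>fst ((F ^^ J) z) - fst z - real J * \<alpha>\<bar> \<le> real J / real n))"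

lemma iterates_stable:
  fixes R :: "plane \<Rightarrow> plane"
  assumes R: "uniformly_continuous_on strip R" "\<And>z. z \<in> strip \<Longrightarrow> R z \<in> strip" and \<epsilon>: "\<epsilon> > 0"
  shows "\<exists>\<eta>>0. \<forall>F. (\<forall>z\<in>strip. F z \<in> strip \<and> dist (F z) (R z) \<le> \<eta>) \<longrightarrow>
     (\<forall>j\<le>J. \<forall>z\<in>strip. dist ((F ^^ j) z) ((R ^^ j) z) < \<epsilon>)"
  using \<epsilon>
proof (induction J arbitrary: \<epsilon>)
  case 0
  then show ?case by (intro exI[of _ 1]) auto
next
  case (Suc J)
  obtain d where d: "d > 0" "\<And>x y. x \<in> strip \<Longrightarrow> y \<in> strip \<Longrightarrow> dist y x < d \<Longrightarrow> dist (R y) (R x) < \<epsilon> / 2"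
    using R(1) Suc.prems unfolding uniformly_continuous_on_def by (metis half_gt_zero)
  have "min d \<epsilon> > 0" using d(1) Suc.prems by simp
  from Suc.IH[OF this] obtain \<eta> where \<eta>: "\<eta> > 0" "\<And>F j z. \<forall>z\<in>strip. F z \<in> strip \<and> dist (F z) (R z) \<le> \<eta> \<Longrightarrow>
     j \<le> J \<Longrightarrow> z \<in> strip \<Longrightarrow> dist ((F ^^ j) z) ((R ^^ j) z) < min d \<epsilon>" by blast
  show ?case
  proof (intro exI[of _ "min \<eta> (\<epsilon> / 2)"] conjI allI impI ballI)
    fix F j z assume F: "\<forall>z\<in>strip. F z \<in> strip \<and> dist (F z) (R z) \<le> min \<eta> (\<epsilon> / 2)"
      and j: "j \<le> Suc J" and z: "z \<in> strip"
    have close: "i \<le> J \<Longrightarrow> dist ((F ^^ i) z) ((R ^^ i) z) < min d \<epsilon>" for i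
      using F z by (intro \<eta>(2)) auto
    show "dist ((F ^^ j) z) ((R ^^ j) z) < \<epsilon>"
    proof (cases "j = Suc J")
      case True
      have S: "(F ^^ i) z \<in> strip" "(R ^^ i) z \<in> strip" for i
        by (induction i) (use F R z in auto)
      have "dist (F ((F ^^ J) z)) (R ((F ^^ J) z)) \<le> \<epsilon> / 2" using F S by auto
      moreover have "dist (R ((F ^^ J) z)) (R ((R ^^ J) z)) < \<epsilon> / 2"
        using close[of J] S by (intro d(2)) auto
      ultimately have "dist (F ((F ^^ J) z)) (R ((R ^^ J) z)) < \<epsilon>"
        using dist_triangle[of "F ((F ^^ J) z)" "R ((R ^^ J) z)" "R ((F ^^ J) z)"] by linarith
      then show ?thesis using True by simp
    next
      case False
      then show ?thesis using close[of j] j by simp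
    qed
  qed (use \<eta> Suc.prems in auto)
qed

lemma equivariant_bounded_displacement:
  assumes F: "equivariant F" "continuous_on strip F"
  shows "\<exists>B\<ge>0. \<forall>z\<in>strip. \<bar>fst (F z) - fst z\<bar> \<le> B"
proof -
  define D where "D = {0..1 :: real} \<times> {- 1..1 :: real}"
  have "compact D" "D \<subseteq> strip" unfolding D_def strip_def by (auto intro: compact_Times)
  then have "bounded ((\<lambda>z. fst (F z) - fst z) ` D)"
    by (intro compact_imp_bounded compact_continuous_image continuous_intros continuous_on_subset[OF F(2)])
  then obtain B where B: "\<And>z. z \<in> D \<Longrightarrow> \<bar>fst (F z) - fst z\<bar> \<le> B" unfolding bounded_iff by auto
  have "\<bar>fst (F z) - fst z\<bar> \<le> B" if z: "z \<in> strip" for z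
  proof -
    define w where "w = base_point (cover z)"
    have w: "w = z - (of_int \<lfloor>fst z\<rfloor>, 0)" unfolding w_def by (rule base_point_cover)
    then have zw: "z = w + (of_int \<lfloor>fst z\<rfloor>, 0)" by simp
    have ws: "w \<in> strip" using z by (simp add: w)
    have "w \<in> D" using ws base_point_bounds[of "cover z"] by (auto simp: D_def strip_def mem_Times_iff w_def)
    moreover have "F z = F w + (of_int \<lfloor>fst z\<rfloor>, 0)" using equivariant_add_int[OF F(1) ws] zw by metis
    moreover have "fst z = fst w + of_int \<lfloor>fst z\<rfloor>" using w by simp
    ultimately show ?thesis using B[of w] by simp
  qed
  then show ?thesis by (intro exI[of _ "max B 0"]) (auto simp: le_max_iff_disj)
qed

text \<open>
  Along an orbit of the conjugated rotation, the orbit of the rotation passes close to a point that \<open>h\<close> sends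
  near the boundary; the bound on the waiting time makes this stable. The displacement after \<open>J\<close> steps is
  \<open>J * \<alpha>\<close> up to the displacements of \<open>h\<close> and \<open>h'\<close>, an error that a large \<open>J\<close> absorbs.
\<close>

lemma escaping_stable:
  assumes h: "conj_pair h h'" and irr: "\<alpha> \<notin> \<rat>" and n: "n > 0"
    and reach: "\<And>y. \<bar>y\<bar> \<le> 1 \<Longrightarrow> \<exists>x. \<bar>snd (h (x, y))\<bar> \<ge> 1 - 1 / (2 * real n)"
  shows "\<exists>\<eta>>0. \<forall>F. (\<forall>z\<in>strip. F z \<in> strip \<and> dist (F z) (conj_rotation \<alpha> h h' z) \<le> \<eta>) \<longrightarrow> escaping \<alpha> n F"
proof -
  note hD = conj_pairD[OF h]
  let ?R = "conj_rotation \<alpha> h h'"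
  have uc: "uniformly_continuous_on strip h" "uniformly_continuous_on strip h'"
    using hD(5,6) tame_uniformly_continuous by blast+
  have Rs: "?R z \<in> strip" if "z \<in> strip" for z using equivariant_strip[OF equivariant_conj_rotation[OF h] that] .
  have "tame (\<lambda>z. h' z + (\<alpha>, 0)) strip" by (intro tame_add hD tame_const)
  then have "tame (\<lambda>z. h (h' z + (\<alpha>, 0))) strip"
    by (rule tame_compose[OF hD(5)]) (intro image_subsetI, simp add: hD(11))
  then have Ruc: "uniformly_continuous_on strip ?R"
    unfolding conj_rotation_def[abs_def] by (rule tame_uniformly_continuous)
  obtain \<theta> where \<theta>: "\<theta> > 0" "\<And>x y. x \<in> strip \<Longrightarrow> y \<in> strip \<Longrightarrow> dist y x < \<theta> \<Longrightarrow> dist (h y) (h x) < 1 / (4 * real n)"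
    using uc(1) n unfolding uniformly_continuous_on_def by (metis divide_pos_pos mult_pos_pos of_nat_0_less_iff zero_less_numeral zero_less_one)
  obtain N :: nat where N: "\<And>x y. \<exists>j\<le>N. \<exists>l::int. \<bar>x + real j * \<alpha> - (y + of_int l)\<bar> < \<theta>"
    using orbit_dense_uniformly[OF irr \<theta>(1)] by blast
  obtain B where B: "B \<ge> 0" "\<And>z. z \<in> strip \<Longrightarrow> \<bar>fst (h z) - fst z\<bar> \<le> B"
    using equivariant_bounded_displacement[OF hD(1)] uc uniformly_continuous_imp_continuous by blast
  obtain B' where B': "B' \<ge> 0" "\<And>z. z \<in> strip \<Longrightarrow> \<bar>fst (h' z) - fst z\<bar> \<le> B'"
    using equivariant_bounded_displacement[OF hD(2)] uc uniformly_continuous_imp_continuous by blast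
  \<comment> \<open>The summand 1 absorbs the distance between \<open>F ^^ J\<close> and the iterate of the rotation.\<close>
  define J where "J = n * (nat \<lceil>B + B'\<rceil> + 1)"
  have J: "J > 0" "B + B' + 1 \<le> real J / real n"
  proof -
    show "J > 0" using n by (simp add: J_def)
    have "B + B' \<le> real (nat \<lceil>B + B'\<rceil>)" by linarith
    moreover have "real J / real n = real (nat \<lceil>B + B'\<rceil>) + 1" using n by (simp add: J_def field_simps)
    ultimately show "B + B' + 1 \<le> real J / real n" by linarith
  qed
  define \<epsilon> where "\<epsilon> = min 1 (1 / (4 * real n))"
  have \<epsilon>: "\<epsilon> > 0" using n by (simp add: \<epsilon>_def)
  obtain \<eta> where \<eta>: "\<eta> > 0" "\<And>F j z. \<forall>z\<in>strip. F z \<in> strip \<and> dist (F z) (?R z) \<le> \<eta> \<Longrightarrow>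
     j \<le> max N J \<Longrightarrow> z \<in> strip \<Longrightarrow> dist ((F ^^ j) z) ((?R ^^ j) z) < \<epsilon>"
    using iterates_stable[OF Ruc Rs \<epsilon>, of "max N J"] by blast
  show ?thesis
  proof (intro exI[of _ \<eta>] conjI allI impI \<eta>(1))
    fix F assume F: "\<forall>z\<in>strip. F z \<in> strip \<and> dist (F z) (?R z) \<le> \<eta>"
    have esc: "\<exists>j. \<bar>snd ((F ^^ j) z)\<bar> > 1 - 1 / real n" if z: "z \<in> strip" for z
    proof -
      obtain x y where w: "h' z = (x, y)" by fastforce
      have y: "\<bar>y\<bar> \<le> 1" using hD(11)[OF z] by (auto simp: w strip_def abs_le_iff)
      obtain x0 where x0: "\<bar>snd (h (x0, y))\<bar> \<ge> 1 - 1 / (2 * real n)" using reach[OF y] by blast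
      obtain j and l :: int where j: "j \<le> N" "\<bar>x + real j * \<alpha> - (x0 + of_int l)\<bar> < \<theta>" using N by blast
      have st: "(s, y) \<in> strip" for s using y by (auto simp: strip_def abs_le_iff)
      have "dist (h (x + real j * \<alpha>, y)) (h (x0 + of_int l, y)) < 1 / (4 * real n)"
        using j(2) by (intro \<theta>(2) st) (simp add: dist_prod_def dist_real_def)
      then have "dist ((?R ^^ j) z) (h (x0 + of_int l, y)) < 1 / (4 * real n)"
        by (simp add: conj_rotation_funpow[OF h z] w)
      moreover have "dist ((F ^^ j) z) ((?R ^^ j) z) < 1 / (4 * real n)"
        using \<eta>(2)[OF F _ z, of j] j(1) by (simp add: \<epsilon>_def)
      ultimately have "dist ((F ^^ j) z) (h (x0 + of_int l, y)) < 1 / (4 * real n) + 1 / (4 * real n)"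
        using dist_triangle[of "(F ^^ j) z" "h (x0 + of_int l, y)" "(?R ^^ j) z"] by linarith
      moreover have "snd (h (x0 + of_int l, y)) = snd (h (x0, y))"
        using equivariant_add_int[OF hD(1) st, of x0 l] by simp
      ultimately have "\<bar>snd ((F ^^ j) z) - snd (h (x0, y))\<bar> < 1 / (2 * real n)"
        using dist_snd_le[of "(F ^^ j) z" "h (x0 + of_int l, y)"] by (simp add: dist_real_def field_simps)
      then have "\<bar>snd ((F ^^ j) z)\<bar> > 1 - 1 / (2 * real n) - 1 / (2 * real n)" using x0 by linarith
      then show ?thesis by (intro exI[of _ j]) (simp add: field_simps)
    qed
    have rot: "\<bar>fst ((F ^^ J) z) - fst z - real J * \<alpha>\<bar> \<le> real J / real n" if z: "z \<in> strip" for z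
    proof -
      have "dist (fst ((F ^^ J) z)) (fst ((?R ^^ J) z)) < 1"
        using \<eta>(2)[OF F _ z, of J] dist_fst_le[of "(F ^^ J) z" "(?R ^^ J) z"] by (simp add: \<epsilon>_def)
      then have 1: "\<bar>fst ((F ^^ J) z) - fst (h (h' z + (real J * \<alpha>, 0)))\<bar> < 1"
        by (simp add: dist_real_def conj_rotation_funpow[OF h z])
      have 2: "\<bar>fst (h (h' z + (real J * \<alpha>, 0))) - (fst (h' z) + real J * \<alpha>)\<bar> \<le> B"
        using B(2)[of "h' z + (real J * \<alpha>, 0)"] hD(11)[OF z] by simp
      show ?thesis using 1 2 B'(2)[OF z] J(2) by linarith
    qed
    show "escaping \<alpha> n F" unfolding escaping_def
      by (intro conjI exI[of _ J] J(1)) (use esc rot in simp_all)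
  qed
qed

section \<open>Rational approximation\<close>

text \<open>The quality of approximation that makes the corrections small in the \<open>C\<^sup>m\<close> sense for all \<open>m \<le> r\<close>.\<close>

definition approximable :: "enat \<Rightarrow> real \<Rightarrow> bool" where
  "approximable r \<alpha> \<longleftrightarrow> (\<exists>p q :: nat \<Rightarrow> int. (\<forall>n. q n \<ge> 1) \<and>
     (\<forall>n. \<bar>of_int (q n) * (\<alpha> - of_int (p n) / of_int (q n))\<bar> \<le> 1) \<and>
     (\<forall>m. enat m \<le> r \<longrightarrow> (\<lambda>n. of_int (q n) ^ Suc m * (\<alpha> - of_int (p n) / of_int (q n))) \<longlonglongrightarrow> 0))"

lemma irrational_approximable:
  assumes "\<alpha> \<notin> \<rat>" shows "approximable 0 \<alpha>"
proof -
  have "\<exists>p q. q \<ge> 1 \<and> \<bar>of_int q * (\<alpha> - of_int p / of_int q)\<bar> \<le> 1 / real (Suc n)" for n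
  proof -
    obtain p q where pq: "0 < q" "\<bar>of_int q * \<alpha> - of_int p\<bar> < 1 / real (Suc n)"
      using Dirichlet_approx_coprime[of "Suc n" \<alpha>] by (metis zero_less_Suc)
    have "of_int q * (\<alpha> - of_int p / of_int q) = of_int q * \<alpha> - of_int p"
      using pq(1) by (simp add: field_simps)
    then show ?thesis using pq by (intro exI[of _ p] exI[of _ q]) auto
  qed
  then obtain p q :: "nat \<Rightarrow> int" where pq: "\<And>n. q n \<ge> 1"
    "\<And>n. \<bar>of_int (q n) * (\<alpha> - of_int (p n) / of_int (q n))\<bar> \<le> 1 / real (Suc n)" by metis
  have "1 / real (Suc n) \<le> 1" for n by simp
  then have "\<bar>of_int (q n) * (\<alpha> - of_int (p n) / of_int (q n))\<bar> \<le> 1" for n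
    using pq(2)[of n] order_trans by blast
  moreover have "(\<lambda>n. of_int (q n) * (\<alpha> - of_int (p n) / of_int (q n))) \<longlonglongrightarrow> 0"
    by (rule tendsto_zero_dominated[OF LIMSEQ_inverse_real_of_nat]) (use pq(2) in \<open>simp add: inverse_eq_divide\<close>)
  ultimately show ?thesis unfolding approximable_def
    using pq(1) by (intro exI[of _ p] exI[of _ q]) (auto simp: zero_enat_def)
qed

text \<open>
  One sequence serves all orders \<open>m\<close>: the \<open>n\<close>-th fraction is chosen for the exponent \<open>n + 1\<close>, which is good
  enough for \<open>m\<close> as soon as \<open>n \<ge> m\<close>.
\<close>

lemma liouville_approximable:
  assumes "liouville \<alpha>" shows "approximable r \<alpha>"
proof -
  have "\<exists>p q. q \<ge> 1 \<and> \<bar>\<alpha> - of_int p / of_int q\<bar> < (1 / real (Suc n)) / of_int q ^ Suc n" for n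
  proof -
    have "\<exists>p q :: int. q \<ge> 1 \<and> coprime p q \<and>
        \<bar>\<alpha> - real_of_int p / real_of_int q\<bar> < (1 / real (Suc n)) / real_of_int q powr real (Suc n)"
      using assms unfolding liouville_def by (metis of_nat_0_less_iff zero_less_Suc zero_less_divide_1_iff)
    then obtain p q :: int where "q \<ge> 1"
      "\<bar>\<alpha> - real_of_int p / real_of_int q\<bar> < (1 / real (Suc n)) / real_of_int q powr real (Suc n)" by blast
    then show ?thesis by (intro exI[of _ p] exI[of _ q]) (simp add: powr_realpow del: power_Suc of_nat_Suc)
  qed
  then obtain p q :: "nat \<Rightarrow> int" where q: "\<And>n. q n \<ge> 1"
    and pq: "\<And>n. \<bar>\<alpha> - of_int (p n) / of_int (q n)\<bar> < (1 / real (Suc n)) / of_int (q n) ^ Suc n" by metis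
  have q1: "1 \<le> real_of_int (q n)" for n using q[of n] by simp
  have le: "\<bar>of_int (q n) ^ Suc m * (\<alpha> - of_int (p n) / of_int (q n))\<bar> \<le> 1 / real (Suc n)" if "m \<le> n" for m n
  proof -
    have qp: "real_of_int (q n) ^ Suc m \<le> of_int (q n) ^ Suc n" "real_of_int (q n) ^ Suc n > 0"
      using q1[of n] that by (auto intro: power_increasing simp del: power_Suc)
    have "\<bar>of_int (q n) ^ Suc m * (\<alpha> - of_int (p n) / of_int (q n))\<bar>
        = of_int (q n) ^ Suc m * \<bar>\<alpha> - of_int (p n) / of_int (q n)\<bar>"
      using q1[of n] by (simp add: abs_mult del: power_Suc)
    also have "\<dots> \<le> of_int (q n) ^ Suc n * ((1 / real (Suc n)) / of_int (q n) ^ Suc n)"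
      using qp pq[of n] q1[of n] by (intro mult_mono) auto
    also have "\<dots> = 1 / real (Suc n)" using qp(2) by (metis less_irrefl nonzero_mult_div_cancel_left times_divide_eq_right)
    finally show ?thesis .
  qed
  have "(\<lambda>n. of_int (q n) ^ Suc m * (\<alpha> - of_int (p n) / of_int (q n))) \<longlonglongrightarrow> 0" for m
  proof (rule tendsto_0_le[OF LIMSEQ_inverse_real_of_nat, where K=1])
    show "\<forall>\<^sub>F n in sequentially. norm (of_int (q n) ^ Suc m * (\<alpha> - of_int (p n) / of_int (q n))) \<le>
        norm (inverse (real (Suc n))) * 1"
      using eventually_ge_at_top[of m] 
    proof eventually_elim
      case (elim n)
      then show ?case using le[of m n] by (simp add: inverse_eq_divide del: power_Suc)
    qed
  qed
  moreover have "\<bar>of_int (q n) * (\<alpha> - of_int (p n) / of_int (q n))\<bar> \<le> 1" for n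
  proof -
    have "\<bar>of_int (q n) * (\<alpha> - of_int (p n) / of_int (q n))\<bar> \<le> 1 / real (Suc n)"
      using le[of 0 n] by simp
    also have "\<dots> \<le> 1" by simp
    finally show ?thesis .
  qed
  ultimately show ?thesis unfolding approximable_def
    using q by (intro exI[of _ p] exI[of _ q]) auto
qed

section \<open>Correcting an isotopy\<close>

text \<open>The map \<open>G\<close> of time and position is the lift of an isotopy that starts at the identity, \<open>G'\<close> gives the inverses.\<close>

definition isotopy_pair ::
  "(timed \<Rightarrow> plane) \<Rightarrow> (timed \<Rightarrow> plane) \<Rightarrow> bool" where
  "isotopy_pair G G' \<longleftrightarrow> tame G slab \<and> tame G' slab \<and>
     (\<forall>t\<in>{0..1}. strip_inverses (\<lambda>z. G (t, z)) (\<lambda>z. G' (t, z))) \<and> (\<forall>z\<in>strip. G (0, z) = z)"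

lemma isotopy_pairD:
  assumes "isotopy_pair G G'"
  shows "tame G slab" "tame G' slab" "\<And>t. t \<in> {0..1} \<Longrightarrow> equivariant (\<lambda>z. G (t, z))"
    "\<And>t. t \<in> {0..1} \<Longrightarrow> equivariant (\<lambda>z. G' (t, z))"
    "\<And>t z. t \<in> {0..1} \<Longrightarrow> z \<in> strip \<Longrightarrow> G' (t, G (t, z)) = z"
    "\<And>t z. t \<in> {0..1} \<Longrightarrow> z \<in> strip \<Longrightarrow> G (t, G' (t, z)) = z"
    "\<And>z. z \<in> strip \<Longrightarrow> G (0, z) = z"
    "\<And>z. z \<in> slab \<Longrightarrow> G z \<in> strip" "\<And>z. z \<in> slab \<Longrightarrow> G' z \<in> strip"
  using assms by (auto simp: isotopy_pair_def strip_inverses_def equivariant_def slab_def)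

lemma slab_mem: "z \<in> slab \<longleftrightarrow> fst z \<in> {0..1} \<and> snd z \<in> strip"
  by (auto simp: slab_def mem_Times_iff)

lemma isotopy_pair_shift: "isotopy_pair (\<lambda>z. snd z + (fst z * \<alpha>, 0)) (\<lambda>z. snd z + (- (fst z * \<alpha>), 0))"
proof -
  have s: "tame (\<lambda>z :: timed. (fst z * \<alpha>, 0 :: real)) S" 
    "tame (\<lambda>z :: timed. (- (fst z * \<alpha>), 0 :: real)) S" for S
    by (intro tame_Pair tame_const tame_linear bounded_linear_mult_const bounded_linear_minus bounded_linear_fst)+
  have "tame (\<lambda>z :: timed. snd z + (fst z * \<alpha>, 0)) slab"
    "tame (\<lambda>z :: timed. snd z + (- (fst z * \<alpha>), 0)) slab"
    by (rule tame_add[OF tame_snd s(1)], rule tame_add[OF tame_snd s(2)])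
  then show ?thesis unfolding isotopy_pair_def strip_inverses_def
    by (auto intro!: equivariant_shift simp: prod_eq_iff)
qed

lemma commutator_strip:
  assumes "\<And>z. z \<in> strip \<Longrightarrow> k z \<in> strip" "\<And>z. z \<in> strip \<Longrightarrow> k' z \<in> strip" "z \<in> strip"
  shows "shift_commutator k k' s z \<in> strip" "shift_commutator' k k' s z \<in> strip"
  using assms by (simp_all add: shift_commutator_def shift_commutator'_def)

lemma equivariant_commutator:
  assumes "equivariant k" "equivariant k'"
  shows "equivariant (shift_commutator k k' s)" "equivariant (shift_commutator' k k' s)"
proof -
  have minus: "z - (s, 0) = z + (- s, 0)" for z :: "plane" by (simp add: prod_eq_iff)
  show "equivariant (shift_commutator k k' s)"
    unfolding shift_commutator_def[abs_def] minus
    by (rule equivariant_compose[OF assms(1) equivariant_compose[OF equivariant_shift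
          equivariant_compose[OF assms(2) equivariant_shift]]])
  show "equivariant (shift_commutator' k k' s)"
    unfolding shift_commutator'_def[abs_def] minus
    by (rule equivariant_compose[OF equivariant_shift equivariant_compose[OF assms(1)
          equivariant_compose[OF equivariant_shift assms(2)]]])
qed

lemma isotopy_pair_step:
  assumes G: "isotopy_pair G G'" and h: "conj_pair h h'" and k: "conj_pair k k'"
  shows "isotopy_pair (\<lambda>z. h (shift_commutator k k' (fst z * d) (h' (G z))))
    (\<lambda>z. G' (fst z, h (shift_commutator' k k' (fst z * d) (h' (snd z)))))" (is "isotopy_pair ?G ?G'")
proof -
  note GD = isotopy_pairD[OF G] and hD = conj_pairD[OF h] and kD = conj_pairD[OF k]
  let ?c = "shift_commutator k k'" and ?c' = "shift_commutator' k k'"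
  have tf: "tame (fst :: timed \<Rightarrow> real) slab" by (rule tame_fst)
  have ts: "tame (snd :: timed \<Rightarrow> plane) slab" by (rule tame_snd)
  note cs = commutator_strip[OF kD(10,11)]
  have tc: "tame (\<lambda>z. ?c (fst z * d) (snd z)) slab" "tame (\<lambda>z. ?c' (fst z * d) (snd z)) slab"
    using tame_commutator[OF kD(5,6,10,11), of slab] by (simp_all add: slab_mem)
  have "tame (\<lambda>z. (fst z, h' (G z))) slab"
    by (intro tame_Pair tf tame_compose[OF hD(6) GD(1)]) (use GD(8) in auto)
  then have "tame (\<lambda>z. ?c (fst (fst z, h' (G z)) * d) (snd (fst z, h' (G z)))) slab"
    by (rule tame_compose[OF tc(1)]) (intro image_subsetI, simp add: slab_mem hD(11) GD(8))
  then have "tame (\<lambda>z. ?c (fst z * d) (h' (G z))) slab" by simp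
  then have t1: "tame ?G slab"
    by (rule tame_compose[OF hD(5)]) (intro image_subsetI cs(1) hD(11) GD(8))
  have "tame (\<lambda>z. (fst z, h' (snd z))) slab"
    by (intro tame_Pair tf tame_compose[OF hD(6) ts]) (auto simp: slab_mem)
  then have "tame (\<lambda>z. ?c' (fst (fst z, h' (snd z)) * d) (snd (fst z, h' (snd z)))) slab"
    by (rule tame_compose[OF tc(2)]) (intro image_subsetI, simp add: slab_mem hD(11))
  then have "tame (\<lambda>z. ?c' (fst z * d) (h' (snd z))) slab" by simp
  then have "tame (\<lambda>z. h (?c' (fst z * d) (h' (snd z)))) slab"
    by (rule tame_compose[OF hD(5)]) (intro image_subsetI cs(2) hD(11), simp_all add: slab_mem)
  from tame_Pair[OF tf this] have t2: "tame ?G' slab"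
    by (rule tame_compose[OF GD(2)]) (intro image_subsetI, simp add: slab_mem hD cs)
  have inv: "?c' s (?c s z) = z" "?c s (?c' s z) = z" if "z \<in> strip" for s z
    using that kD by (simp_all add: shift_commutator_def shift_commutator'_def)
  have "strip_inverses (\<lambda>z. ?G (t, z)) (\<lambda>z. ?G' (t, z))" if t: "t \<in> {0..1}" for t
  proof -
    have e: "equivariant (\<lambda>z. ?G (t, z))"
      using equivariant_compose[OF hD(1) equivariant_compose[OF equivariant_commutator(1)[OF kD(1,2), of "t * d"]
          equivariant_compose[OF hD(2) GD(3)[OF t]]]] by simp
    have e': "equivariant (\<lambda>z. ?G' (t, z))"
      using equivariant_compose[OF GD(4)[OF t] equivariant_compose[OF hD(1)
          equivariant_compose[OF equivariant_commutator(2)[OF kD(1,2), of "t * d"] hD(2)]]] by simp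
    have "?G' (t, ?G (t, z)) = z \<and> ?G (t, ?G' (t, z)) = z" if z: "z \<in> strip" for z
    proof -
      have Gz: "G (t, z) \<in> strip" using GD(8) t z by (simp add: slab_mem)
      have w: "h (?c' (t * d) (h' z)) \<in> strip" by (intro hD cs z)
      have "?G' (t, ?G (t, z)) = G' (t, h (?c' (t * d) (h' (h (?c (t * d) (h' (G (t, z))))))))" by simp
      also have "\<dots> = z" using Gz by (simp add: hD cs inv GD(5)[OF t z])
      finally have 1: "?G' (t, ?G (t, z)) = z" .
      have "?G (t, ?G' (t, z)) = h (?c (t * d) (h' (G (t, G' (t, h (?c' (t * d) (h' z)))))))" by simp
      also have "\<dots> = z" unfolding GD(6)[OF t w] using z by (simp add: hD cs inv)
      finally show ?thesis using 1 by simp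
    qed
    then show ?thesis using e e' by (simp add: strip_inverses_def)
  qed
  moreover have "?G (0, z) = z" if "z \<in> strip" for z
    using that by (simp add: shift_commutator_def zero_prod_def[symmetric] GD hD kD)
  ultimately show ?thesis unfolding isotopy_pair_def using t1 t2 by simp
qed

text \<open>
  With \<open>d = \<alpha> - p / q\<close>, the shift by \<open>- d\<close> in the commutator reduces the rotation by \<open>\<alpha>\<close> to that by \<open>p / q\<close>,
  which commutes with the twist; the shift by \<open>d\<close> then restores the angle \<open>\<alpha>\<close>, now between the twist and
  its inverse.
\<close>

lemma isotopy_end_step:
  fixes q p :: int
  assumes h: "conj_pair h h'" and q: "q \<noteq> 0" and z: "z \<in> strip" and Gz: "Gz = conj_rotation \<alpha> h h' z"
    and k: "k = narrow_twist q C" "k' = narrow_twist q (- C)"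
  shows "h (shift_commutator k k' (\<alpha> - of_int p / of_int q) (h' Gz))
     = conj_rotation \<alpha> (\<lambda>z. h (k z)) (\<lambda>z. k' (h' z)) z"
proof -
  let ?d = "\<alpha> - of_int p / of_int q"
  note hD = conj_pairD[OF h]
  have "h' Gz = h' z + (\<alpha>, 0)" unfolding Gz conj_rotation_def using hD z by simp
  then have "h' Gz - (?d, 0) = h' z + (of_int p / of_int q, 0)" by (simp add: prod_eq_iff)
  then have "k' (h' Gz - (?d, 0)) = k' (h' z) + (of_int p / of_int q, 0)"
    unfolding k by (simp only: narrow_twist_add_fraction[OF q])
  then have "k' (h' Gz - (?d, 0)) + (?d, 0) = k' (h' z) + (\<alpha>, 0)" by (simp add: prod_eq_iff)
  then show ?thesis by (simp add: shift_commutator_def conj_rotation_def)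
qed

lemma Cm_le_cong: "(\<And>x. x \<in> S \<Longrightarrow> u x = v x) \<Longrightarrow> Cm_le m e u S \<Longrightarrow> Cm_le m e v S"
proof (cases m)
  case 0
  assume "\<And>x. x \<in> S \<Longrightarrow> u x = v x" "Cm_le m e u S"
  then show ?thesis using 0 by (auto simp: uniformly_continuous_on_def)
next
  case (Suc k)
  assume eq: "\<And>x. x \<in> S \<Longrightarrow> u x = v x" and C: "Cm_le m e u S"
  from C Suc obtain u' where u': "uniformly_continuous_on S u" "\<forall>x\<in>S. norm (u x) \<le> e"
    "\<forall>x\<in>S. (u has_derivative u' x) (at x within S)" "\<forall>b\<in>Basis. Cm_le k e (\<lambda>x. u' x b) S" by auto
  have "(v has_derivative u' x) (at x within S)" if "x \<in> S" for x
    by (rule has_derivative_transform[OF that _ u'(3)[rule_format, OF that]]) (simp add: eq)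
  moreover have "uniformly_continuous_on S v" using u'(1) eq by (auto simp: uniformly_continuous_on_def)
  ultimately show ?thesis using u' eq Suc by auto
qed

text \<open>
  The commutators converge to the identity, and \<open>h\<close>, \<open>h'\<close>, \<open>G\<close> and \<open>G'\<close> do not depend on \<open>n\<close>, so the corrected
  isotopies and their inverses converge to the uncorrected ones.
\<close>

lemma step_converges:
  fixes q :: "nat \<Rightarrow> real"
  assumes G: "isotopy_pair G G'" and h: "conj_pair h h'"
    and kp: "\<And>n. conj_pair (narrow_twist (q n) C) (narrow_twist (q n) (- C))"
    and q: "\<And>n. q n \<ge> 1" and d: "\<And>n. \<bar>q n * d n\<bar> \<le> 1" and lim: "(\<lambda>n. q n ^ Suc m * d n) \<longlonglongrightarrow> 0" and \<epsilon>: "\<epsilon> > 0"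
  defines "k \<equiv> \<lambda>n. narrow_twist (q n) C" and "k' \<equiv> \<lambda>n. narrow_twist (q n) (- C)"
  shows "\<forall>\<^sub>F n in sequentially. Cm_le m \<epsilon> (\<lambda>z. h (shift_commutator (k n) (k' n) (fst z * d n) (h' (G z))) - G z) slab"
    (is "\<forall>\<^sub>F n in _. Cm_le m \<epsilon> (\<lambda>z. ?G n z - G z) slab")
    and "\<forall>\<^sub>F n in sequentially. Cm_le m \<epsilon> (\<lambda>z. G' (fst z, h (shift_commutator' (k n) (k' n) (fst z * d n) (h' (snd z)))) - G' z) slab"
    (is "\<forall>\<^sub>F n in _. Cm_le m \<epsilon> (\<lambda>z. ?G' n z - G' z) slab")
proof -
  note GD = isotopy_pairD[OF G] and hD = conj_pairD[OF h]
  have cs: "shift_commutator (k n) (k' n) s z \<in> strip" "shift_commutator' (k n) (k' n) s z \<in> strip"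
    if "z \<in> strip" for n s z
    using commutator_strip[OF conj_pairD(10,11)[OF kp] that] by (simp_all add: k_def k'_def)
  define fam where "fam i z = (case i of enat n \<Rightarrow> shift_commutator (k n) (k' n) (fst z * d n) (snd z) | \<infinity> \<Rightarrow> snd z)"
    for i and z :: "timed"
  define fam' where "fam' i z = (case i of enat n \<Rightarrow> shift_commutator' (k n) (k' n) (fst z * d n) (snd z) | \<infinity> \<Rightarrow> snd z)"
    for i and z :: "timed"
  have C: "Cconv m fam slab" "Cconv m fam' slab"
    unfolding fam_def[abs_def] fam'_def[abs_def] k_def k'_def
    by (rule commutators_conv(1)[OF q d lim], rule commutators_conv(2)[OF q d lim])
  have fs: "fam i z \<in> strip" "fam' i z \<in> strip" if "z \<in> slab" for i z
    using that cs by (auto simp: fam_def fam'_def slab_mem split: enat.split)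
  have th: "Cconv m (\<lambda>_. h) strip" using hD(5) by (simp add: tame_def)
  have tG': "Cconv m (\<lambda>_. G') slab" using GD(2) by (simp add: tame_def)
  have tf: "tame (fst :: timed \<Rightarrow> real) slab" by (rule tame_fst)
  have ts: "tame (snd :: timed \<Rightarrow> plane) slab" by (rule tame_snd)
  have I: "tame (\<lambda>z. (fst z, h' (G z))) slab"
    by (intro tame_Pair tf tame_compose[OF hD(6) GD(1)]) (use GD(8) in auto)
  have Is: "(fst z, h' (G z)) \<in> slab" if "z \<in> slab" for z using that by (simp add: slab_mem hD GD(8))
  have J: "tame (\<lambda>z. (fst z, h' (snd z))) slab"
    by (intro tame_Pair tf tame_compose[OF hD(6) ts]) (auto simp: slab_mem)
  have Js: "(fst z, h' (snd z)) \<in> slab" if "z \<in> slab" for z using that by (simp add: slab_mem hD)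
  have "Cconv m (\<lambda>i z. fam i (fst z, h' (G z))) slab"
    by (rule Cconv_compose[OF C(1), where G="\<lambda>_ z. (fst z, h' (G z))"]) (use I Is in \<open>auto simp: tame_def\<close>)
  then have "Cconv m (\<lambda>i z. h (fam i (fst z, h' (G z)))) slab"
    by (rule Cconv_compose[OF th]) (intro image_subsetI fs Is)
  from Cconv_eventually_Cm_le[OF this \<epsilon>]
  show "\<forall>\<^sub>F n in sequentially. Cm_le m \<epsilon> (\<lambda>z. ?G n z - G z) slab"
  proof (rule eventually_mono)
    fix n assume "Cm_le m \<epsilon> (\<lambda>z. h (fam (enat n) (fst z, h' (G z))) - h (fam \<infinity> (fst z, h' (G z)))) slab"
    then show "Cm_le m \<epsilon> (\<lambda>z. ?G n z - G z) slab"
      by (rule Cm_le_cong[rotated]) (simp add: fam_def hD GD(8))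
  qed
  have "Cconv m (\<lambda>i z. fam' i (fst z, h' (snd z))) slab"
    by (rule Cconv_compose[OF C(2), where G="\<lambda>_ z. (fst z, h' (snd z))"]) (use J Js in \<open>auto simp: tame_def\<close>)
  then have "Cconv m (\<lambda>i z. h (fam' i (fst z, h' (snd z)))) slab"
    by (rule Cconv_compose[OF th]) (intro image_subsetI fs Js)
  then have "Cconv m (\<lambda>i z. (fst z, h (fam' i (fst z, h' (snd z))))) slab"
    using tf by (intro Cconv_Pair) (auto simp: tame_def)
  then have "Cconv m (\<lambda>i z. G' (fst z, h (fam' i (fst z, h' (snd z))))) slab"
    by (rule Cconv_compose[OF tG']) (intro image_subsetI, simp add: slab_mem hD fs Js)
  from Cconv_eventually_Cm_le[OF this \<epsilon>]
  show "\<forall>\<^sub>F n in sequentially. Cm_le m \<epsilon> (\<lambda>z. ?G' n z - G' z) slab"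
  proof (rule eventually_mono)
    fix n assume "Cm_le m \<epsilon> (\<lambda>z. G' (fst z, h (fam' (enat n) (fst z, h' (snd z)))) - G' (fst z, h (fam' \<infinity> (fst z, h' (snd z))))) slab"
    then show "Cm_le m \<epsilon> (\<lambda>z. ?G' n z - G' z) slab"
      by (rule Cm_le_cong[rotated]) (simp add: fam'_def hD slab_mem)
  qed
qed

lemma conj_pair_near_boundary:
  assumes h: "conj_pair h h'" and \<epsilon>: "\<epsilon> > 0"
  obtains \<delta> where "0 < \<delta>" "\<delta> < 1" "\<And>z. z \<in> strip \<Longrightarrow> \<bar>snd z\<bar> \<ge> 1 - \<delta> \<Longrightarrow> \<bar>snd (h z)\<bar> \<ge> 1 - \<epsilon>"
proof -
  note hD = conj_pairD[OF h]
  obtain d where d: "d > 0" "\<And>x y. x \<in> strip \<Longrightarrow> y \<in> strip \<Longrightarrow> dist y x < d \<Longrightarrow> dist (h y) (h x) < \<epsilon>"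
    using tame_uniformly_continuous[OF hD(5)] \<epsilon> unfolding uniformly_continuous_on_def by metis
  define \<delta> where "\<delta> = min (1 / 2) (d / 2)"
  have "\<bar>snd (h z)\<bar> \<ge> 1 - \<epsilon>" if z: "z \<in> strip" "\<bar>snd z\<bar> \<ge> 1 - \<delta>" for z
  proof -
    have z1: "\<bar>snd z\<bar> \<le> 1" using z(1) by (auto simp: strip_def abs_le_iff)
    define w where "w = (fst z, sgn (snd z))"
    have nz: "snd z \<noteq> 0" using z(2) by (auto simp: \<delta>_def)
    have sw: "\<bar>snd w\<bar> = 1" using nz by (simp add: w_def abs_sgn_eq)
    have ws: "w \<in> strip" using sw by (auto simp: strip_def w_def abs_if split: if_splits)
    have "dist z w = \<bar>snd z - sgn (snd z)\<bar>" by (cases z) (simp add: w_def dist_prod_def dist_real_def)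
    also have "\<dots> = 1 - \<bar>snd z\<bar>" using z1 nz by (auto simp: sgn_if abs_if)
    also have "\<dots> < d" using z(2) d(1) by (simp add: \<delta>_def)
    finally have "dist (h z) (h w) < \<epsilon>" using d(2)[OF ws z(1)] by simp
    then have "\<bar>snd (h z) - snd (h w)\<bar> < \<epsilon>"
      using dist_snd_le[of "h z" "h w"] by (simp add: dist_real_def)
    then show ?thesis using hD(7)[OF sw] sw by simp
  qed
  then show thesis using d(1) by (intro that[of \<delta>]) (auto simp: \<delta>_def)
qed

text \<open>
  The order of choices matters: \<open>h\<close> and \<open>\<delta>\<close> determine how close to the boundary the twist has to bring the
  horizontal circles, this determines the strength \<open>C\<close> of the twist, and the approximation \<open>p / q\<close> is chosen
  last, good enough for all of them.
\<close>

lemma construction_step: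
  assumes G: "isotopy_pair G G'" and h: "conj_pair h h'" and ap: "approximable r \<alpha>"
    and e: "\<And>z. z \<in> strip \<Longrightarrow> G (1, z) = conj_rotation \<alpha> h h' z"
    and \<epsilon>: "\<epsilon> > 0" and \<delta>: "\<delta> > 0"
  obtains H H' K K' where "isotopy_pair K K'" "conj_pair H H'"
    "\<And>z. z \<in> strip \<Longrightarrow> K (1, z) = conj_rotation \<alpha> H H' z"
    "\<And>m. m \<le> M \<Longrightarrow> enat m \<le> r \<Longrightarrow> Cm_le m \<epsilon> (\<lambda>z. K z - G z) slab"
    "\<And>m. m \<le> M \<Longrightarrow> enat m \<le> r \<Longrightarrow> Cm_le m \<epsilon> (\<lambda>z. K' z - G' z) slab"
    "\<And>y. \<bar>y\<bar> \<le> 1 \<Longrightarrow> \<exists>x. \<bar>snd (H (x, y))\<bar> \<ge> 1 - \<delta>"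
proof -
  from ap obtain p q :: "nat \<Rightarrow> int" where q: "\<And>n. q n \<ge> 1"
    and d: "\<And>n. \<bar>of_int (q n) * (\<alpha> - of_int (p n) / of_int (q n))\<bar> \<le> 1"
    and lim: "\<And>m. enat m \<le> r \<Longrightarrow> (\<lambda>n. of_int (q n) ^ Suc m * (\<alpha> - of_int (p n) / of_int (q n))) \<longlonglongrightarrow> 0"
    unfolding approximable_def by blast
  obtain \<delta>' where \<delta>': "0 < \<delta>'" "\<delta>' < 1" "\<And>z. z \<in> strip \<Longrightarrow> \<bar>snd z\<bar> \<ge> 1 - \<delta>' \<Longrightarrow> \<bar>snd (h z)\<bar> \<ge> 1 - \<delta>"
    using conj_pair_near_boundary[OF h \<delta>] by blast
  obtain C where C: "\<And>y. \<bar>y\<bar> \<le> 1 \<Longrightarrow> \<exists>x. \<bar>snd (twist C (x, y))\<bar> \<ge> 1 - \<delta>'"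
    using twist_reaches_boundary[OF \<delta>'(1,2)] by blast
  have q1: "real_of_int (q n) \<ge> 1" and q0: "q n \<noteq> 0" for n using q[of n] by simp_all
  define k where "k n = narrow_twist (q n) C" for n
  define k' where "k' n = narrow_twist (q n) (- C)" for n
  define \<delta>n where "\<delta>n n = \<alpha> - of_int (p n) / of_int (q n)" for n
  have kp: "conj_pair (narrow_twist (q n) C) (narrow_twist (q n) (- C))" for n
    by (rule conj_pair_narrow_twist[OF q0])
  define K where "K n z = h (shift_commutator (k n) (k' n) (fst z * \<delta>n n) (h' (G z)))" for n z
  define K' where "K' n z = G' (fst z, h (shift_commutator' (k n) (k' n) (fst z * \<delta>n n) (h' (snd z))))" for n z
  have "\<forall>\<^sub>F n in sequentially. \<forall>m\<in>{m. m \<le> M \<and> enat m \<le> r}.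
      Cm_le m \<epsilon> (\<lambda>z. K n z - G z) slab \<and> Cm_le m \<epsilon> (\<lambda>z. K' n z - G' z) slab"
  proof (rule eventually_ball_finite)
    show "finite {m. m \<le> M \<and> enat m \<le> r}" by (rule finite_subset[of _ "{..M}"]) auto
    show "\<forall>m\<in>{m. m \<le> M \<and> enat m \<le> r}. \<forall>\<^sub>F n in sequentially.
      Cm_le m \<epsilon> (\<lambda>z. K n z - G z) slab \<and> Cm_le m \<epsilon> (\<lambda>z. K' n z - G' z) slab"
      using step_converges[OF G h kp q1 d lim \<epsilon>]
      by (simp add: K_def K'_def k_def k'_def \<delta>n_def eventually_conj_iff)
  qed
  then obtain n where n: "\<And>m. m \<le> M \<Longrightarrow> enat m \<le> r \<Longrightarrow>
      Cm_le m \<epsilon> (\<lambda>z. K n z - G z) slab \<and> Cm_le m \<epsilon> (\<lambda>z. K' n z - G' z) slab"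
    using eventually_happens'[OF sequentially_bot] by blast
  show thesis
  proof (rule that[of "K n" "K' n" "\<lambda>z. h (k n z)" "\<lambda>z. k' n (h' z)"])
    show "isotopy_pair (K n) (K' n)"
      unfolding K_def[abs_def] K'_def[abs_def] k_def k'_def by (rule isotopy_pair_step[OF G h kp])
    show "conj_pair (\<lambda>z. h (k n z)) (\<lambda>z. k' n (h' z))"
      unfolding k_def k'_def by (rule conj_pair_compose[OF h kp])
    show "K n (1, z) = conj_rotation \<alpha> (\<lambda>z. h (k n z)) (\<lambda>z. k' n (h' z)) z" if "z \<in> strip" for z
      using isotopy_end_step[OF h q0 that e[OF that] refl refl, where C=C and p="p n"]
      by (simp add: K_def k_def k'_def \<delta>n_def)
    show "Cm_le m \<epsilon> (\<lambda>z. K n z - G z) slab" "Cm_le m \<epsilon> (\<lambda>z. K' n z - G' z) slab"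
      if "m \<le> M" "enat m \<le> r" for m using n[OF that] by auto
    show "\<exists>x. \<bar>snd (h (k n (x, y)))\<bar> \<ge> 1 - \<delta>" if y: "\<bar>y\<bar> \<le> 1" for y
    proof -
      obtain x where x: "\<bar>snd (twist C (x, y))\<bar> \<ge> 1 - \<delta>'" using C[OF y] by blast
      have "squeeze (q n) (x / q n, y) = (x, y)" using q0[of n] by (simp add: squeeze_def)
      then have "snd (k n (x / q n, y)) = snd (twist C (x, y))" by (simp add: k_def narrow_twist_def squeeze_def)
      moreover have "k n (x / q n, y) \<in> strip"
        unfolding k_def by (rule conj_pairD(10)[OF kp]) (use y in \<open>auto simp: strip_def abs_le_iff\<close>)
      ultimately show ?thesis using \<delta>'(3) x by (intro exI[of _ "x / q n"]) auto
    qed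
  qed
qed

section \<open>The limit map\<close>

text \<open>
  The \<open>n\<close>-th correction is small only in the derivatives of order up to \<open>n\<close>. So for order \<open>m\<close> the series is
  started at the \<open>m\<close>-th term, which is why the limit is compared with \<open>G m\<close> when its smoothness is shown.
\<close>

lemma limit_of_corrections:
  fixes G :: "nat \<Rightarrow> timed \<Rightarrow> plane"
  assumes tame: "\<And>n. tame (G n) slab"
    and le: "\<And>n m. m \<le> n \<Longrightarrow> enat m \<le> r \<Longrightarrow> Cm_le m (e n) (\<lambda>z. G (Suc n) z - G n z) slab"
    and sm: "summable e"
  obtains L where "smooth r L slab" "\<And>n z. z \<in> slab \<Longrightarrow> norm (L z - G n z) \<le> (\<Sum>j. e (j + n))"
proof -
  define u where "u n z = G (Suc n) z - G n z" for n z
  define L where "L z = G 0 z + (\<Sum>n. u n z)" for z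
  have cs: "convex slab" unfolding slab_def strip_def by (intro convex_Times) auto
  have r0: "enat 0 \<le> r" by (simp add: zero_enat_def[symmetric])
  have smu: "summable (\<lambda>n. u n z)" if "z \<in> slab" for z
    by (rule summable_comparison_test'[OF sm, of 0]) (use Cm_leD(2)[OF le[OF _ r0] that] in \<open>simp add: u_def\<close>)
  have tail: "Cm_le m (\<Sum>j. e (j + n)) (\<lambda>z. \<Sum>j. u (j + n) z) slab" if "m \<le> n" "enat m \<le> r" for m n
    by (rule Cm_le_suminf[OF cs]) (use that le sm in \<open>auto simp: u_def\<close>)
  have L: "L z - G n z = (\<Sum>j. u (j + n) z)" if "z \<in> slab" for z n
  proof -
    have "(\<Sum>j. u j z) = (\<Sum>j. u (j + n) z) + (\<Sum>j<n. u j z)"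
      by (rule suminf_split_initial_segment[OF smu[OF that]])
    moreover have "(\<Sum>j<n. u j z) = G n z - G 0 z"
      unfolding u_def by (rule sum_lessThan_telescope)
    ultimately show ?thesis by (simp add: L_def)
  qed
  show thesis
  proof (rule that[of L])
    show "smooth r L slab" unfolding smooth_def
    proof (intro allI impI)
      fix m assume m: "enat m \<le> r"
      have "Cconv m (\<lambda>_ z. G m z + (\<Sum>j. u (j + m) z)) slab"
        using tame[of m] by (intro Cconv_add Cm_le_imp_Cconv[OF tail[OF order_refl m]]) (simp add: tame_def)
      then show "Cconv m (\<lambda>_. L) slab"
        by (rule Cconv_cong[rotated]) (simp flip: L)
    qed
    show "norm (L z - G n z) \<le> (\<Sum>j. e (j + n))" if "z \<in> slab" for n z
      unfolding L[OF that] by (rule Cm_leD(2)[OF tail[OF _ r0] that]) simp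
  qed
qed

lemma limit_inverse:
  fixes L L' :: "timed \<Rightarrow> plane"
  assumes c: "continuous_on slab L'" and t: "t \<in> {0..1}" and z: "z \<in> strip"
    and Gs: "\<And>n. G n (t, z) \<in> strip" and Ls: "L (t, z) \<in> strip"
    and lim: "(\<lambda>n. G n (t, z)) \<longlonglongrightarrow> L (t, z)"
    and close: "\<And>n w. w \<in> slab \<Longrightarrow> norm (L' w - G' n w) \<le> \<epsilon> n" and \<epsilon>: "\<epsilon> \<longlonglongrightarrow> 0"
    and inv: "\<And>n. G' n (t, G n (t, z)) = z"
  shows "L' (t, L (t, z)) = z"
proof -
  have m: "(t, w) \<in> slab" if "w \<in> strip" for w using t that by (simp add: slab_mem)
  have "(\<lambda>n. (t, G n (t, z))) \<longlonglongrightarrow> (t, L (t, z))" by (intro tendsto_intros lim)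
  then have 1: "(\<lambda>n. L' (t, G n (t, z))) \<longlonglongrightarrow> L' (t, L (t, z))"
    by (rule continuous_on_tendsto_compose[OF c]) (simp_all add: m Gs Ls)
  have "(\<lambda>n. L' (t, G n (t, z)) - z) \<longlonglongrightarrow> 0"
  proof (rule Lim_null_comparison[OF _ \<epsilon>], rule always_eventually, rule allI)
    fix n
    show "norm (L' (t, G n (t, z)) - z) \<le> \<epsilon> n" using close[OF m[OF Gs], of n n] by (simp add: inv)
  qed
  then have "(\<lambda>n. L' (t, G n (t, z))) \<longlonglongrightarrow> z" by (simp add: LIM_zero_iff)
  with 1 show ?thesis by (rule LIMSEQ_unique)
qed

text \<open>
  A stage of the construction: conjugating map and inverse, isotopy and inverses, and the size \<open>\<eta>\<close> of the
  perturbations that do not destroy the properties achieved so far.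
\<close>

type_synonym stage = "(plane \<Rightarrow> plane) \<times> (plane \<Rightarrow> plane) \<times>
  (timed \<Rightarrow> plane) \<times> (timed \<Rightarrow> plane) \<times> real"

fun stage :: "real \<Rightarrow> stage \<Rightarrow> bool" where
  "stage \<alpha> (h, h', G, G', \<eta>) \<longleftrightarrow> isotopy_pair G G' \<and> conj_pair h h' \<and>
     (\<forall>z\<in>strip. G (1, z) = conj_rotation \<alpha> h h' z) \<and> 0 < \<eta> \<and> \<eta> \<le> 1"

fun next_stage :: "enat \<Rightarrow> real \<Rightarrow> nat \<Rightarrow> stage \<Rightarrow> stage \<Rightarrow> bool" where
  "next_stage r \<alpha> n (h, h', G, G', \<eta>) (H, H', K, K', \<theta>) \<longleftrightarrow>
     (\<forall>m\<le>n. enat m \<le> r \<longrightarrow> Cm_le m (\<eta> / 2 ^ Suc n) (\<lambda>z. K z - G z) slab \<and>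
        Cm_le m (\<eta> / 2 ^ Suc n) (\<lambda>z. K' z - G' z) slab) \<and> \<theta> \<le> \<eta> \<and>
     (\<forall>F. (\<forall>z\<in>strip. F z \<in> strip \<and> dist (F z) (conj_rotation \<alpha> H H' z) \<le> \<theta>) \<longrightarrow> escaping \<alpha> (Suc n) F)"

lemma next_stage_exists:
  assumes irr: "\<alpha> \<notin> \<rat>" and ap: "approximable r \<alpha>" and s: "stage \<alpha> s"
  shows "\<exists>s'. stage \<alpha> s' \<and> next_stage r \<alpha> n s s'"
proof -
  obtain h h' G G' \<eta> where s_eq: "s = (h, h', G, G', \<eta>)" by (metis prod_cases5)
  have st: "isotopy_pair G G'" "conj_pair h h'" "\<And>z. z \<in> strip \<Longrightarrow> G (1, z) = conj_rotation \<alpha> h h' z"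
    "0 < \<eta>" "\<eta> \<le> 1" using s by (auto simp: s_eq)
  have pos: "\<eta> / 2 ^ Suc n > 0" "1 / (2 * real (Suc n)) > 0" using st(4) by simp_all
  show ?thesis
  proof (rule construction_step[OF st(1,2) ap _ pos, where M=n])
    show "G (1, z) = conj_rotation \<alpha> h h' z" if "z \<in> strip" for z by (rule st(3)[OF that])
  next
    fix H H' K K' assume K: "isotopy_pair K K'" "conj_pair H H'"
      "\<And>z. z \<in> strip \<Longrightarrow> K (1, z) = conj_rotation \<alpha> H H' z"
      "\<And>m. m \<le> n \<Longrightarrow> enat m \<le> r \<Longrightarrow> Cm_le m (\<eta> / 2 ^ Suc n) (\<lambda>z. K z - G z) slab"
      "\<And>m. m \<le> n \<Longrightarrow> enat m \<le> r \<Longrightarrow> Cm_le m (\<eta> / 2 ^ Suc n) (\<lambda>z. K' z - G' z) slab"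
      "\<And>y. \<bar>y\<bar> \<le> 1 \<Longrightarrow> \<exists>x. \<bar>snd (H (x, y))\<bar> \<ge> 1 - 1 / (2 * real (Suc n))"
    obtain \<theta> where \<theta>: "\<theta> > 0" "\<And>F. \<forall>z\<in>strip. F z \<in> strip \<and> dist (F z) (conj_rotation \<alpha> H H' z) \<le> \<theta> \<Longrightarrow> escaping \<alpha> (Suc n) F"
      using escaping_stable[OF K(2) irr zero_less_Suc K(6)] by blast
    have "stage \<alpha> (H, H', K, K', min \<theta> \<eta>)" using K \<theta>(1) st(4,5) by simp
    moreover have "next_stage r \<alpha> n s (H, H', K, K', min \<theta> \<eta>)"
      unfolding s_eq next_stage.simps using K(4,5) by (auto intro!: \<theta>(2))
    ultimately show ?thesis by blast
  qed
qed

lemma approximable_rotation_number_realized: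
  assumes irr: "\<alpha> \<notin> \<rat>" and ap: "approximable r \<alpha>"
  shows "\<exists>f F. f \<in> G\<^sup>r \<and> NICIS f \<and> is_lift f F \<and> has_rotation_number f F \<alpha>"
proof -
  have "stage \<alpha> (\<lambda>z. z, \<lambda>z. z, \<lambda>z. snd z + (fst z * \<alpha>, 0), \<lambda>z. snd z + (- (fst z * \<alpha>), 0), 1)"
    using isotopy_pair_shift conj_pair_id by (simp add: conj_rotation_def)
  then obtain S where S: "\<And>n. stage \<alpha> (S n)" "\<And>n. next_stage r \<alpha> n (S n) (S (Suc n))"
    using dependent_nat_choice[of "\<lambda>_. stage \<alpha>" "next_stage r \<alpha>"] next_stage_exists[OF irr ap] by blast
  define h h' G G' \<eta> where defs: "h n = fst (S n)" "h' n = fst (snd (S n))" "G n = fst (snd (snd (S n)))"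
    "G' n = fst (snd (snd (snd (S n))))" "\<eta> n = snd (snd (snd (snd (S n))))" for n
  have S_eq: "S n = (h n, h' n, G n, G' n, \<eta> n)" for n by (simp add: defs)
  have st: "isotopy_pair (G n) (G' n)" "conj_pair (h n) (h' n)"
    "\<And>z. z \<in> strip \<Longrightarrow> G n (1, z) = conj_rotation \<alpha> (h n) (h' n) z" "0 < \<eta> n" "\<eta> n \<le> 1" for n
    using S(1)[of n] by (auto simp: S_eq)
  have nx: "m \<le> n \<Longrightarrow> enat m \<le> r \<Longrightarrow> Cm_le m (\<eta> n / 2 ^ Suc n) (\<lambda>z. G (Suc n) z - G n z) slab"
    "m \<le> n \<Longrightarrow> enat m \<le> r \<Longrightarrow> Cm_le m (\<eta> n / 2 ^ Suc n) (\<lambda>z. G' (Suc n) z - G' n z) slab"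
    "\<eta> (Suc n) \<le> \<eta> n"
    "\<forall>z\<in>strip. F z \<in> strip \<and> dist (F z) (conj_rotation \<alpha> (h (Suc n)) (h' (Suc n)) z) \<le> \<eta> (Suc n) \<Longrightarrow> escaping \<alpha> (Suc n) F"
    for m n F
    using S(2)[of n] by (auto simp: S_eq simp del: power_Suc)
  note GD = isotopy_pairD[OF st(1)]
  \<comment> \<open>As \<open>\<eta>\<close> decreases, all corrections after stage \<open>n\<close> together are at most \<open>\<eta> n\<close>, and they tend to 0.\<close>
  define e where "e n = \<eta> n / 2 ^ Suc n" for n
  have \<eta>_le: "\<eta> (j + n) \<le> \<eta> n" for j n
    by (induction j) (auto intro: order_trans[OF nx(3)])
  have half: "(\<lambda>j. c * (1 / 2) ^ Suc j) sums c" for c :: real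
    using sums_mult[OF power_half_series, of c] by simp
  have e0: "0 \<le> e n" for n using st(4)[of n] by (simp add: e_def)
  have e_le: "e (j + n) \<le> \<eta> n * (1 / 2) ^ Suc j" "e (j + n) \<le> (1 / 2) ^ n * (1 / 2) ^ Suc j" for j n
  proof -
    have "e (j + n) = \<eta> (j + n) * ((1 / 2) ^ n * (1 / 2) ^ Suc j)"
      by (simp add: e_def power_add power_one_over field_simps)
    moreover have "\<eta> (j + n) * ((1 / 2) ^ n * (1 / 2) ^ Suc j) \<le> \<eta> n * (1 * (1 / 2) ^ Suc j)"
      using \<eta>_le st(4) by (intro mult_mono) (auto simp: power_le_one less_imp_le)
    moreover have "\<eta> (j + n) * ((1 / 2) ^ n * (1 / 2) ^ Suc j) \<le> 1 * ((1 / 2) ^ n * (1 / 2) ^ Suc j)"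
      using st(5) by (intro mult_right_mono) auto
    ultimately show "e (j + n) \<le> \<eta> n * (1 / 2) ^ Suc j" "e (j + n) \<le> (1 / 2) ^ n * (1 / 2) ^ Suc j" by simp_all
  qed
  have sm: "summable e"
    by (rule summable_comparison_test'[of "\<lambda>j. 1 * (1 / 2) ^ Suc j" 0])
       (use sums_summable[OF half, of 1] e_le(2)[of _ 0] e0 in simp_all)
  have tail: "(\<Sum>j. e (j + n)) \<le> \<eta> n" "(\<Sum>j. e (j + n)) \<le> (1 / 2) ^ n" for n
    using sums_le[OF e_le(1) summable_sums[OF summable_ignore_initial_segment[OF sm]] half]
      sums_le[OF e_le(2) summable_sums[OF summable_ignore_initial_segment[OF sm]] half] by blast+
  obtain L where L: "smooth r L slab" "\<And>n z. z \<in> slab \<Longrightarrow> norm (L z - G n z) \<le> (\<Sum>j. e (j + n))"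
    using limit_of_corrections[where G=G and e=e and r=r, OF GD(1) nx(1)[folded e_def] sm] by blast
  obtain L' where L': "smooth r L' slab" "\<And>n z. z \<in> slab \<Longrightarrow> norm (L' z - G' n z) \<le> (\<Sum>j. e (j + n))"
    using limit_of_corrections[where G=G' and e=e and r=r, OF GD(2) nx(2)[folded e_def] sm] by blast
  have close: "norm (L z - G n z) \<le> (1 / 2) ^ n" "norm (L' z - G' n z) \<le> (1 / 2) ^ n" "norm (L z - G n z) \<le> \<eta> n"
    if "z \<in> slab" for z n
    using L(2)[OF that, of n] L'(2)[OF that, of n] tail[of n] by linarith+
  have half0: "(\<lambda>n. (1 / 2 :: real) ^ n) \<longlonglongrightarrow> 0" by (rule LIMSEQ_power_zero) simp
  have lim: "(\<lambda>n. G n z) \<longlonglongrightarrow> L z" "(\<lambda>n. G' n z) \<longlonglongrightarrow> L' z" if "z \<in> slab" for z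
  proof -
    have "(\<lambda>n. G n z - L z) \<longlonglongrightarrow> 0" "(\<lambda>n. G' n z - L' z) \<longlonglongrightarrow> 0"
      by (rule Lim_null_comparison[OF _ half0], rule always_eventually, rule allI,
          use close[OF that] in \<open>simp add: norm_minus_commute\<close>)+
    then show "(\<lambda>n. G n z) \<longlonglongrightarrow> L z" "(\<lambda>n. G' n z) \<longlonglongrightarrow> L' z" by (simp_all add: LIM_zero_iff)
  qed
  have closed_strip: "closed strip" unfolding strip_def by (intro closed_Times) auto
  have Ls: "L z \<in> strip" "L' z \<in> strip" if "z \<in> slab" for z
    by (rule closed_sequentially[OF closed_strip GD(8)[OF that] lim(1)[OF that]],
        rule closed_sequentially[OF closed_strip GD(9)[OF that] lim(2)[OF that]])
  have cont: "continuous_on slab L" "continuous_on slab L'"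
    using L(1) L'(1) smooth_continuous uniformly_continuous_imp_continuous by blast+
  have in_slab: "(t, z) \<in> slab" if "t \<in> {0..1}" "z \<in> strip" for t z using that by (simp add: slab_mem)
  have inv: "strip_inverses (\<lambda>z. L (t, z)) (\<lambda>z. L' (t, z))" if t: "t \<in> {0..1}" for t
  proof -
    have "L (t, z + (1, 0)) = L (t, z) + (1, 0) \<and> L' (t, z + (1, 0)) = L' (t, z) + (1, 0)" if z: "z \<in> strip" for z
    proof -
      have zz: "(t, z) \<in> slab" "(t, z + (1, 0)) \<in> slab" using t z by (simp_all add: slab_mem)
      have "G n (t, z + (1, 0)) = G n (t, z) + (1, 0)" "G' n (t, z + (1, 0)) = G' n (t, z) + (1, 0)" for n
        using GD(3,4)[OF t] z by (simp_all add: equivariant_def)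
      then show ?thesis
        using LIMSEQ_unique[OF lim(1)[OF zz(2)]] LIMSEQ_unique[OF lim(2)[OF zz(2)]]
          tendsto_add[OF lim(1)[OF zz(1)] tendsto_const, of "(1, 0)"]
          tendsto_add[OF lim(2)[OF zz(1)] tendsto_const, of "(1, 0)"] by simp
    qed
    moreover have "L' (t, L (t, z)) = z" if z: "z \<in> strip" for z
    proof (rule limit_inverse[where G=G and G'=G' and \<epsilon>="\<lambda>n. (1 / 2) ^ n", OF cont(2) t z _ _ _ _ half0])
      show "G n (t, z) \<in> strip" "L (t, z) \<in> strip" "(\<lambda>n. G n (t, z)) \<longlonglongrightarrow> L (t, z)"
        "G' n (t, G n (t, z)) = z" for n
        using GD(8) Ls(1) lim(1) GD(5)[OF t z] in_slab[OF t z] by blast+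
    qed (rule close(2))
    moreover have "L (t, L' (t, z)) = z" if z: "z \<in> strip" for z
    proof (rule limit_inverse[where G=G' and G'=G and \<epsilon>="\<lambda>n. (1 / 2) ^ n", OF cont(1) t z _ _ _ _ half0])
      show "G' n (t, z) \<in> strip" "L' (t, z) \<in> strip" "(\<lambda>n. G' n (t, z)) \<longlonglongrightarrow> L' (t, z)"
        "G n (t, G' n (t, z)) = z" for n
        using GD(9) Ls(2) lim(2) GD(6)[OF t z] in_slab[OF t z] by blast+
    qed (rule close(1))
    ultimately show ?thesis using Ls in_slab[OF t] by (simp add: strip_inverses_def equivariant_def)
  qed
  have start: "L (0, z) = z" if z: "z \<in> strip" for z
  proof (rule LIMSEQ_unique[OF lim(1)])
    show "(0, z) \<in> slab" using z by (auto simp: slab_def)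
    show "(\<lambda>n. G n (0, z)) \<longlonglongrightarrow> z" using GD(7)[OF z] by simp
  qed
  have slice: "smooth r (\<lambda>z. L (t, z)) strip" "smooth r (\<lambda>z. L' (t, z)) strip" if t: "t \<in> {0..1}" for t
  proof -
    have "smooth r (\<lambda>z :: plane. (t, z)) strip"
      by (intro tame_imp_smooth tame_Pair tame_const tame_ident)
    then show "smooth r (\<lambda>z. L (t, z)) strip" "smooth r (\<lambda>z. L' (t, z)) strip"
      using smooth_compose[OF L(1)] smooth_compose[OF L'(1)] in_slab[OF t] by blast+
  qed
  define F where "F z = L (1, z)" for z
  define f where "f = descend F"
  have one: "(1::real) \<in> {0..1}" by simp
  have eF: "equivariant F" using inv[OF one] by (simp add: strip_inverses_def F_def[abs_def])
  have cF: "continuous_on strip F"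
    using smooth_continuous[OF slice(1)[OF one]] uniformly_continuous_imp_continuous by (simp add: F_def[abs_def])
  have diffeo: "annulus_diffeo r (descend (\<lambda>z. L (t, z)))" if t: "t \<in> {0..1}" for t
    by (rule annulus_diffeo_descend[OF inv[OF t] slice[OF t]])
  have "isotopic_to_id r f"
    unfolding isotopic_to_id_def
  proof (intro exI[of _ "\<lambda>t. descend (\<lambda>z. L (t, z))"] conjI ballI)
    have "C_on r (\<lambda>z. cover (L z)) slab"
      by (rule smooth_imp_C_on[OF smooth_compose[OF tame_imp_smooth[OF tame_cover[of UNIV]] L(1)]]) simp
    then show "C_on r (\<lambda>(t, z). descend (\<lambda>z. L (t, z)) (cover z)) ({0..1} \<times> strip)"
      unfolding slab_def[symmetric]
    proof (rule C_on_cong[rotated])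
      fix z assume "z \<in> slab"
      then obtain t w where z: "z = (t, w)" "t \<in> {0..1}" "w \<in> strip" by (auto simp: slab_def)
      show "cover (L z) = (case z of (t, z) \<Rightarrow> descend (\<lambda>z. L (t, z)) (cover z))"
        using inv[OF z(2)] descend_cover[OF _ z(3), of "\<lambda>z. L (t, z)"] by (simp add: z(1) strip_inverses_def)
    qed
  next
    fix a assume a: "a \<in> annulus"
    show "descend (\<lambda>z. L (0, z)) a = a"
      using start[OF base_point_in_strip[OF a]] cover_base_point[OF a] by (simp add: descend_def)
    show "descend (\<lambda>z. L (1, z)) a = f a" by (simp add: f_def F_def[abs_def])
  qed (rule diffeo)
  moreover have "annulus_diffeo r f" using diffeo[OF one] by (simp add: f_def F_def[abs_def])
  moreover have "measure_preserving area f"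
  proof (rule measure_preserving_uniform_limit)
    show "f \<in> measurable area area" unfolding f_def
      by (intro measurable_annulus continuous_on_descend eF cF descend_in_annulus)
    fix \<epsilon> :: real assume "\<epsilon> > 0"
    then obtain d where d: "d > 0" "\<And>x y. dist y x < d \<Longrightarrow> dist (cover y) (cover x) < \<epsilon>"
      using tame_uniformly_continuous[OF tame_cover[of UNIV]] unfolding uniformly_continuous_on_def by (metis UNIV_I)
    obtain n where n: "(1 / 2 :: real) ^ n < d" using real_arch_pow_inv[OF d(1), of "1 / 2"] by auto
    show "\<exists>g. measure_preserving area g \<and> (\<forall>a\<in>annulus. dist (g a) (f a) < \<epsilon>)"
    proof (intro exI[of _ "descend (conj_rotation \<alpha> (h n) (h' n))"] conjI ballI)
      show "measure_preserving area (descend (conj_rotation \<alpha> (h n) (h' n)))"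
        by (rule measure_preserving_conj_rotation[OF st(2)])
      fix a assume a: "a \<in> annulus"
      let ?z = "base_point a"
      have z: "?z \<in> strip" by (rule base_point_in_strip[OF a])
      have "dist (G n (1, ?z)) (L (1, ?z)) < d"
        using close(1)[OF in_slab[OF one z], of n] n by (simp add: dist_norm norm_minus_commute)
      then show "dist (descend (conj_rotation \<alpha> (h n) (h' n)) a) (f a) < \<epsilon>"
        unfolding descend_def f_def F_def by (intro d(2)) (simp add: st(3)[OF z])
    qed
  qed
  ultimately have "f \<in> G\<^sup>r" by (simp add: area_diffeos_def)
  have esc: "escaping \<alpha> n F" if n: "n > 0" for n
  proof -
    obtain k where k: "n = Suc k" using gr0_implies_Suc[OF n] by blast
    show ?thesis unfolding k
    proof (rule nx(4), intro ballI conjI)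
      fix z assume z: "z \<in> strip"
      show "F z \<in> strip" using equivariant_strip[OF eF z] .
      show "dist (F z) (conj_rotation \<alpha> (h (Suc k)) (h' (Suc k)) z) \<le> \<eta> (Suc k)"
        using close(3)[OF in_slab[OF one z], of "Suc k"] by (simp add: F_def dist_norm st(3)[OF z])
    qed
  qed
  have "NICIS f" unfolding f_def
    by (rule NICIS_descend[OF eF]) (use esc in \<open>auto simp: escaping_def\<close>)
  moreover have "has_rotation_number f F \<alpha>" unfolding f_def
    by (rule has_rotation_number_descend[OF eF cF]) (use esc in \<open>auto simp: escaping_def\<close>)
  moreover have "is_lift f F" unfolding f_def by (rule is_lift_descend[OF eF cF])
  ultimately show ?thesis using \<open>f \<in> G\<^sup>r\<close> by blast
qed

theorem theorem1:
  shows "(\<forall>\<alpha>::real. liouville \<alpha> \<longrightarrow>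
            (\<exists>f F. f \<in> G\<^sup>\<infinity> \<and> NICIS f \<and> is_lift f F \<and> has_rotation_number f F \<alpha>)) \<and>
         (\<forall>\<alpha>::real. \<alpha> \<notin> \<rat> \<longrightarrow>
            (\<exists>f F. f \<in> G\<^sup>0 \<and> NICIS f \<and> is_lift f F \<and> has_rotation_number f F \<alpha>))"
proof (intro conjI allI impI)
  fix \<alpha> :: real assume "liouville \<alpha>"
  then show "\<exists>f F. f \<in> G\<^sup>\<infinity> \<and> NICIS f \<and> is_lift f F \<and> has_rotation_number f F \<alpha>"
    by (intro approximable_rotation_number_realized liouville_approximable) (simp add: liouville_def)
next
  fix \<alpha> :: real assume "\<alpha> \<notin> \<rat>"
  then show "\<exists>f F. f \<in> G\<^sup>0 \<and> NICIS f \<and> is_lift f F \<and> has_rotation_number f F \<alpha>"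
    by (intro approximable_rotation_number_realized irrational_approximable)
qed

end
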